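(* Let $d\ge2$, let $\Phi,\Psi\in\mathcal T_E(\Sigma_d)$ be two essentially affine iterated function systems and let $u,v\in\mathbb R\setminus\{0\}$. Then the following three statements are equivalent: (i) $\mu_{\Phi,u}\cong\mu_{\Psi,v}$; (ii) $\displaystyle I_\Phi\simeq\frac vu\,I_\Psi+\frac{P_\Phi(u)-P_\Psi(v)}{u}$; (iii) $\displaystyle P_\Phi(s)=P_\Psi\Big(s\cdot\frac vu\Big)+s\cdot\frac{P_\Phi(u)-P_\Psi(v)}{u}$ for all $s\in\mathbb R$. Furthermore, each of the statements (i), (ii), (iii) implies (iv) $\alpha_\Phi(u)\,\ell_\Phi(\alpha_\Phi(u))=\alpha_\Psi(v)\,\ell_\Psi(\alpha_\Psi(v))$.
   Context: Let $I=\{1,\dots,d\}$, $d\ge2$, $\Sigma_d=I^{\mathbb N}$ with left shift $\sigma$, $[x_1\dots x_n]$ the cylinder of all $y\in\Sigma_d$ with $y_i=x_i$ for $i\le n$, and $S_nf=\sum_{k=0}^{n-1}f\circ\sigma^k$. Conformal iterated function system (CS). An ordered family $\Phi=(\phi_i:X\to\operatorname{Int}X\mid i\in I)$ of injective contractions of a connected compact set (interval) $X\subset\mathbb R$, such that, writing $\phi_\omega=\phi_{x_1}\circ\dots\circ\phi_{x_n}$ for $\omega=x_1\dots x_n\in I^n$: - (open set condition) $\phi_i(\operatorname{Int}X)\subset\operatorname{Int}X$ for all $i$, and $\phi_i(\operatorname{Int}X)\cap\phi_j(\operatorname{Int}X)=\emptyset$ for $i\ne j$; - (conformality) there is an open connected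 set $U\subset\mathbb C$ containing $X$ such that each $\phi_i$ extends to a conformal map on $U$ (into $U$, so that the $\phi_\omega$ are defined on $U$); - (bounded distortion) there is $C\ge1$ with $|\phi_\omega'(y)|\le C|\phi_\omega'(x)|$ for all $n\in\mathbb N$, $\omega\in I^n$, $x,y\in U$. The limit set is $\Lambda(\Phi)=\bigcap_n\bigcup_{\omega\in I^n}\phi_\omega(X)$, and $\pi_\Phi:\Sigma_d\to\Lambda(\Phi)$, $\pi_\Phi(x_1x_2\dots)=\lim_n\phi_{x_1\dots x_n}(X)$, is the canonical bijection. $\mathcal T(\Sigma_d)$ is the set of all CS with index set $I$. A CS is an affine system (AS) if all $\phi_i$ are affine. A CS $\Psi$ is an essentially affine system (EAS) if there are an AS $\Phi$ and a bi-Lipschitz bijection $h:\Lambda(\Phi)\to\Lambda(\Psi)$ with $\psi_i=h\circ\phi_i\circ h^{-1}$ on $\Lambda(\Psi)$ for all $i\in I$. $\mathcal T_E(\Sigma_d)$ is the set of all EAS in $\mathcal T(\Sigma_d)$. The canonical geometric potential is $I_\Phi:\Sigma_d\to\mathbb R$, $I_\Phi(x)=\log|\phi_{x_1}'(\pi_\Phi(\sigma x))|$. The pressure of $f:\Sigma_d\to\mathbb R$ is $\mathcal P(f)=\lim_n\frac1n\log\sum_{\omega\in I^n}\exp(\sup_{x\in[\omega]}S_nf(x))$, and $P_\Phi(u):=\mathcal P(u I_\Phi)$ for $u\in\mathbb R$. $\mu_{\Phi,u}$ is the $\sigma$-invariant Gibbs probability measure on $\Sigma_d$ for $uI_\Phi-P_\Phi(u)$,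 i.e. the $\sigma$-invariant probability measure with $\mu_{\Phi,u}([x_1\dots x_n])\asymp e^{uS_nI_\Phi(x)-nP_\Phi(u)}$ uniformly in $n$, $(x_1,\dots,x_n)\in I^n$ and $x\in[x_1\dots x_n]$. Moreover $\alpha_\Phi(u):=-P_\Phi'(u)=-\int I_\Phi\,d\mu_{\Phi,u}$. The Lyapunov spectrum is $\ell_\Phi(\alpha)=\dim_H\big(\pi_\Phi(\{x\in\Sigma_d:\lim_n\frac{S_nI_\Phi(x)}{-n}=\alpha\})\big)$, $\alpha\in\mathbb R$ (with $\dim_H\emptyset=0$). $\mu_{\Phi,u}\cong\mu_{\Psi,v}$ means $\mu_{\Phi,u}=\mu_{\Psi_0,v}$ for some system $\Psi_0$ obtained from $\Psi$ by a permutation of its generators. For constants $a,b\in\mathbb R$, $I_\Phi\simeq aI_\Psi+b$ means that $I_\Phi$ is cohomologous to $aI_{\Psi_0}+b$ for some such $\Psi_0$, where $f,g$ are cohomologous if $f-g=e-e\circ\sigma$ for some continuous $e:\Sigma_d\to\mathbb R$. *)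

theory Defs
  imports "HOL-Analysis.Analysis" "HOL-Probability.Probability_Measure"
begin

section \<open>The full shift\<close>

text \<open>Sequences are indexed from \<open>0\<close>: the letter written \<open>x\<^sub>1\<close> on paper is \<open>x 0\<close>.
  The type \<^typ>\<open>nat \<Rightarrow> nat\<close> carries the product of the discrete topologies, which induces
  the usual topology on \<open>shift_space d\<close>.\<close>

definition shift_space :: "nat \<Rightarrow> (nat \<Rightarrow> nat) set" where
  "shift_space d = {x. \<forall>n. x n \<in> {1..d}}"

definition shift :: "(nat \<Rightarrow> nat) \<Rightarrow> (nat \<Rightarrow> nat)" where
  "shift x = (\<lambda>n. x (Suc n))"

definition words :: "nat \<Rightarrow> nat \<Rightarrow> nat list set" where
  "words d n = {w. length w = n \<and> set w \<subseteq> {1..d}}"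

definition cylinder :: "nat \<Rightarrow> nat list \<Rightarrow> (nat \<Rightarrow> nat) set" where
  "cylinder d w = {y \<in> shift_space d. \<forall>i < length w. y i = w ! i}"

definition birkhoff_sum :: "nat \<Rightarrow> ((nat \<Rightarrow> nat) \<Rightarrow> real) \<Rightarrow> (nat \<Rightarrow> nat) \<Rightarrow> real" where
  "birkhoff_sum n f x = (\<Sum>k<n. f ((shift ^^ k) x))"

definition pressure :: "nat \<Rightarrow> ((nat \<Rightarrow> nat) \<Rightarrow> real) \<Rightarrow> real" where
  "pressure d f =
     lim (\<lambda>n. 1 / real n * ln (\<Sum>w\<in>words d n. exp (SUP x\<in>cylinder d w. birkhoff_sum n f x)))"

definition invariant_gibbs :: "nat \<Rightarrow> ((nat \<Rightarrow> nat) \<Rightarrow> real) \<Rightarrow> (nat \<Rightarrow> nat) measure \<Rightarrow> bool" where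
  "invariant_gibbs d f \<mu> \<longleftrightarrow>
     sets \<mu> = sets (restrict_space borel (shift_space d)) \<and>
     prob_space \<mu> \<and>
     (\<forall>A\<in>sets \<mu>. emeasure \<mu> (shift -` A \<inter> space \<mu>) = emeasure \<mu> A) \<and>
     (\<exists>C\<ge>1. \<forall>n. \<forall>w\<in>words d n. \<forall>x\<in>cylinder d w.
        exp (birkhoff_sum n f x) / C \<le> measure \<mu> (cylinder d w) \<and>
        measure \<mu> (cylinder d w) \<le> C * exp (birkhoff_sum n f x))"

definition cohomologous :: "nat \<Rightarrow> ((nat \<Rightarrow> nat) \<Rightarrow> real) \<Rightarrow> ((nat \<Rightarrow> nat) \<Rightarrow> real) \<Rightarrow> bool" where
  "cohomologous d f g \<longleftrightarrow>
     (\<exists>e. continuous_on (shift_space d) e \<and>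
          (\<forall>x\<in>shift_space d. f x - g x = e x - e (shift x)))"

section \<open>Hausdorff dimension\<close>

text \<open>\<^const>\<open>diameter\<close> is only meaningful on bounded sets, hence the explicit boundedness
  condition on covers.  The dimension uses only exponents \<open>s > 0\<close>; this gives the usual value
  (in particular \<open>0\<close> for the empty set) and avoids any convention for \<open>0\<close> to the power \<open>0\<close>.\<close>

definition hausdorff_premeasure :: "real \<Rightarrow> real \<Rightarrow> 'a::metric_space set \<Rightarrow> ennreal" where
  "hausdorff_premeasure \<delta> s A =
     (INF V\<in>{V :: nat \<Rightarrow> 'a set.
               A \<subseteq> (\<Union>i. V i) \<and> (\<forall>i. bounded (V i) \<and> diameter (V i) \<le> \<delta>)}.
        \<Sum>i. ennreal (diameter (V i) powr s))"

definition hausdorff_measure :: "real \<Rightarrow> 'a::metric_space set \<Rightarrow> ennreal" where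
  "hausdorff_measure s A = (SUP \<delta>\<in>{0<..}. hausdorff_premeasure \<delta> s A)"

definition hausdorff_dim :: "'a::metric_space set \<Rightarrow> ereal" where
  "hausdorff_dim A = Inf {ereal s | s. s > 0 \<and> hausdorff_measure s A = 0}"

section \<open>Conformal iterated function systems\<close>

text \<open>The generators are total functions, but only their restrictions to \<open>base\<close> and
  the indices \<open>1, \<dots>, d\<close> matter.\<close>

record ifs =
  base :: "real set"
  gen :: "nat \<Rightarrow> real \<Rightarrow> real"

definition word_map :: "(nat \<Rightarrow> 'a \<Rightarrow> 'a) \<Rightarrow> nat list \<Rightarrow> 'a \<Rightarrow> 'a" where
  "word_map f w = foldr (\<lambda>i g. f i \<circ> g) w id"

definition conformal_on :: "(complex \<Rightarrow> complex) \<Rightarrow> complex set \<Rightarrow> bool" where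
  "conformal_on f U \<longleftrightarrow> f holomorphic_on U \<and> (\<forall>z\<in>U. deriv f z \<noteq> 0)"

definition conformal_systems :: "nat \<Rightarrow> ifs set" where
  "conformal_systems d = {\<Phi>.
     base \<Phi> \<noteq> {} \<and> compact (base \<Phi>) \<and> connected (base \<Phi>) \<and>
     (\<forall>i\<in>{1..d}. gen \<Phi> i ` base \<Phi> \<subseteq> interior (base \<Phi>) \<and> inj_on (gen \<Phi> i) (base \<Phi>) \<and>
        (\<exists>c<1. c-lipschitz_on (base \<Phi>) (gen \<Phi> i))) \<and>
     (\<forall>i\<in>{1..d}. gen \<Phi> i ` interior (base \<Phi>) \<subseteq> interior (base \<Phi>)) \<and>
     (\<forall>i\<in>{1..d}. \<forall>j\<in>{1..d}. i \<noteq> j \<longrightarrow>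
        gen \<Phi> i ` interior (base \<Phi>) \<inter> gen \<Phi> j ` interior (base \<Phi>) = {}) \<and>
     (\<exists>U F. open U \<and> connected U \<and> complex_of_real ` base \<Phi> \<subseteq> U \<and>
        (\<forall>i\<in>{1..d}. conformal_on (F i) U \<and> F i ` U \<subseteq> U \<and>
           (\<forall>x\<in>base \<Phi>. F i (complex_of_real x) = complex_of_real (gen \<Phi> i x))) \<and>
        (\<exists>C\<ge>1. \<forall>n. \<forall>w\<in>words d n. \<forall>x\<in>U. \<forall>y\<in>U.
           norm (deriv (word_map F w) y) \<le> C * norm (deriv (word_map F w) x)))}"

definition limit_set :: "nat \<Rightarrow> ifs \<Rightarrow> real set" where
  "limit_set d \<Phi> = (\<Inter>n. \<Union>w\<in>words d n. word_map (gen \<Phi>) w ` base \<Phi>)"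

text \<open>The sets below decrease to a single point, which is their limit.\<close>

definition coding :: "ifs \<Rightarrow> (nat \<Rightarrow> nat) \<Rightarrow> real" where
  "coding \<Phi> x = the_elem (\<Inter>n. word_map (gen \<Phi>) (map x [0..<n]) ` base \<Phi>)"

definition affine_systems :: "nat \<Rightarrow> ifs set" where
  "affine_systems d =
     {\<Phi> \<in> conformal_systems d. \<forall>i\<in>{1..d}. \<exists>a b. \<forall>x\<in>base \<Phi>. gen \<Phi> i x = a * x + b}"

definition bi_lipschitz_bijection :: "(real \<Rightarrow> real) \<Rightarrow> real set \<Rightarrow> real set \<Rightarrow> bool" where
  "bi_lipschitz_bijection h A B \<longleftrightarrow>
     bij_betw h A B \<and> (\<exists>L. L-lipschitz_on A h) \<and> (\<exists>L. L-lipschitz_on B (inv_into A h))"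

definition essentially_affine_systems :: "nat \<Rightarrow> ifs set" where
  "essentially_affine_systems d =
     {\<Psi> \<in> conformal_systems d. \<exists>\<Phi>\<in>affine_systems d. \<exists>h.
        bi_lipschitz_bijection h (limit_set d \<Phi>) (limit_set d \<Psi>) \<and>
        (\<forall>i\<in>{1..d}. \<forall>y\<in>limit_set d \<Psi>.
           gen \<Psi> i y = h (gen \<Phi> i (inv_into (limit_set d \<Phi>) h y)))}"

definition permuted :: "(nat \<Rightarrow> nat) \<Rightarrow> ifs \<Rightarrow> ifs" where
  "permuted \<tau> \<Phi> = \<Phi>\<lparr>gen := \<lambda>i. gen \<Phi> (\<tau> i)\<rparr>"

section \<open>Thermodynamic quantities of a system\<close>

text \<open>The limit set lies in the interior of \<open>base \<Phi>\<close>, so the derivative is an ordinary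
  two-sided one and agrees with that of any conformal extension.\<close>

definition geom_potential :: "ifs \<Rightarrow> (nat \<Rightarrow> nat) \<Rightarrow> real" where
  "geom_potential \<Phi> x = ln \<bar>deriv (gen \<Phi> (x 0)) (coding \<Phi> (shift x))\<bar>"

definition geom_pressure :: "nat \<Rightarrow> ifs \<Rightarrow> real \<Rightarrow> real" where
  "geom_pressure d \<Phi> u = pressure d (\<lambda>x. u * geom_potential \<Phi> x)"

definition gibbs_measure :: "nat \<Rightarrow> ifs \<Rightarrow> real \<Rightarrow> (nat \<Rightarrow> nat) measure" where
  "gibbs_measure d \<Phi> u =
     (THE \<mu>. invariant_gibbs d (\<lambda>x. u * geom_potential \<Phi> x - geom_pressure d \<Phi> u) \<mu>)"

definition lyapunov_exponent :: "nat \<Rightarrow> ifs \<Rightarrow> real \<Rightarrow> real" where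
  "lyapunov_exponent d \<Phi> u = - deriv (geom_pressure d \<Phi>) u"

definition lyapunov_spectrum :: "nat \<Rightarrow> ifs \<Rightarrow> real \<Rightarrow> real" where
  "lyapunov_spectrum d \<Phi> \<alpha> = real_of_ereal (hausdorff_dim (coding \<Phi> `
     {x \<in> shift_space d. (\<lambda>n. birkhoff_sum n (geom_potential \<Phi>) x / - real n) \<longlonglongrightarrow> \<alpha>}))"

definition gibbs_equal_up_to_permutation :: "nat \<Rightarrow> ifs \<Rightarrow> real \<Rightarrow> ifs \<Rightarrow> real \<Rightarrow> bool" where
  "gibbs_equal_up_to_permutation d \<Phi> u \<Psi> v \<longleftrightarrow>
     (\<exists>\<tau>. \<tau> permutes {1..d} \<and> gibbs_measure d \<Phi> u = gibbs_measure d (permuted \<tau> \<Psi>) v)"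

text \<open>The relation \<open>I\<^sub>\<Phi> \<simeq> a I\<^sub>\<Psi> + b\<close>.\<close>

definition potentials_cohomologous_up_to_permutation ::
    "nat \<Rightarrow> ifs \<Rightarrow> real \<Rightarrow> ifs \<Rightarrow> real \<Rightarrow> bool" where
  "potentials_cohomologous_up_to_permutation d \<Phi> a \<Psi> b \<longleftrightarrow>
     (\<exists>\<tau>. \<tau> permutes {1..d} \<and>
        cohomologous d (geom_potential \<Phi>) (\<lambda>x. a * geom_potential (permuted \<tau> \<Psi>) x + b))"

end

theory Submission
  imports Defs "HOL-Probability.Infinite_Product_Measure" "HOL-Probability.Probability_Mass_Function"
    "HOL-Complex_Analysis.Complex_Analysis" "HOL-Combinatorics.Permutations"
begin

text \<open>
  An essentially affine system is, up to a coboundary, governed by finitely many numbers.  If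
  \<open>\<Psi>\<close> is conjugate to an affine system with contraction ratios \<open>a\<^sub>1, \<dots>, a\<^sub>d\<close> by a bi-Lipschitz map,
  then the derivatives of the compositions \<open>\<psi>\<^sub>w\<close> are comparable to the products
  \<open>a\<^sub>w = a\<^bsub>w\<^sub>1\<^esub> \<cdots> a\<^bsub>w\<^sub>n\<^esub>\<close> with constants independent of the word \<open>w\<close>
  (\<open>essentially_affine_comparison\<close>).  Hence the Birkhoff sums of the difference between
  \<open>I\<^sub>\<Psi>\<close> and \<open>x \<mapsto> log a\<^bsub>x\<^sub>1\<^esub>\<close> are bounded, and a Livsic type argument
  (\<open>cohomologous_first_letter\<close>) turns boundedness into a continuous transfer function.  The same
  comparison shows that cylinders have length comparable to \<open>a\<^sub>w\<close> and are separated on that scale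
  (\<open>coding_distance\<close>).  The predicate \<open>log_ratios\<close> collects these consequences; it is everything
  that the rest of the argument knows about a system.

  With \<open>\<theta>\<^sub>i = log a\<^sub>i\<close> one gets \<open>P\<^sub>\<Psi>(u) = log (\<Sum>\<^sub>i exp (u \<theta>\<^sub>i))\<close>, and \<open>\<mu>\<^bsub>\<Psi>,u\<^esub>\<close> is the Bernoulli measure
  with weights \<open>exp (u \<theta>\<^sub>i - P\<^sub>\<Psi>(u))\<close>; for this the shift-invariant Gibbs measure has to be
  unique, which follows from the variance estimate in \<open>rigid_left_right_additive\<close>.  If
  \<open>\<theta>\<close> belongs to \<open>\<Phi>\<close> and \<open>\<eta>\<close> to \<open>\<Psi>\<close>, put \<open>a = v / u\<close> and \<open>b = (P\<^sub>\<Phi>(u) - P\<^sub>\<Psi>(v)) / u\<close>.  Then each of the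
  three equivalent statements says that there is a permutation \<open>\<tau>\<close> with
  \<open>\<theta>\<^sub>i = a \<eta>\<^bsub>\<tau>(i)\<^esub> + b\<close> for all \<open>i\<close>: the measures are equal iff their weights are, the potentials are
  cohomologous iff they agree on the fixed points of the shift, and the pressure identity equates
  the power sums of the numbers \<open>exp \<theta>\<^sub>i\<close> and \<open>exp (a \<eta>\<^sub>i + b)\<close>, which determine them up to order.

  For the last claim no dimension has to be computed.  Once the generators of \<open>\<Psi>\<close> are permuted by
  \<open>\<tau>\<close>, the relation between \<open>\<theta>\<close> and \<open>\<eta>\<close> makes the two level sets of sequences coincide.  On that common level set the cylinder of
  length \<open>n\<close> around a point has diameter roughly \<open>exp (- n \<alpha>)\<close> for one system and
  \<open>exp (- n \<beta>)\<close> for the other, where \<open>\<alpha>\<close> and \<open>\<beta>\<close> are the two Lyapunov exponents, so the passage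
  between the two codings is Hoelder with exponents arbitrarily close to \<open>\<beta> / \<alpha>\<close> on countably many pieces
  that exhaust the level set.  Therefore \<open>\<alpha>\<close> times the first dimension equals \<open>\<beta>\<close> times the
  second (\<open>level_set_dim_scaling\<close>).
\<close>


section \<open>Words and sequences\<close>

lemma words_0 [simp]: "words d 0 = {[]}"
  by (auto simp: words_def)

lemma finite_words [simp]: "finite (words d n)"
  using finite_lists_length_eq[of "{1..d}" n] by (simp add: words_def conj_commute)

lemma sum_words_Suc:
  "(\<Sum>w\<in>words d (Suc n). f w) = (\<Sum>i\<in>{1..d}. \<Sum>w\<in>words d n. f (i # w))"
proof -
  have "words d (Suc n) = (\<lambda>(i, w). i # w) ` ({1..d} \<times> words d n)"
    by (auto simp: words_def image_iff length_Suc_conv)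
  moreover have "inj_on (\<lambda>(i, w). i # w) ({1..d} \<times> words d n)"
    by (auto simp: inj_on_def)
  ultimately show ?thesis
    by (simp add: sum.reindex sum.cartesian_product case_prod_beta')
qed

lemma sum_words_add:
  "(\<Sum>w\<in>words d (m + n). f w) = (\<Sum>u\<in>words d m. \<Sum>v\<in>words d n. f (u @ v))"
  by (induction m arbitrary: f) (simp_all add: sum_words_Suc)

lemma sum_exp_words:
  fixes \<phi> :: "nat \<Rightarrow> real"
  shows "(\<Sum>w\<in>words d n. exp (sum_list (map \<phi> w))) = (\<Sum>i\<in>{1..d}. exp (\<phi> i)) ^ n"
  by (induction n) (simp_all add: sum_words_Suc exp_add sum_distrib_left[symmetric]
      sum_distrib_right[symmetric])

lemma shift_funpow: "(shift ^^ k) x = (\<lambda>n. x (n + k))"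
  by (induction k arbitrary: x) (auto simp: shift_def)

lemma shift_in_shift_space: "x \<in> shift_space d \<Longrightarrow> shift x \<in> shift_space d"
  by (auto simp: shift_space_def shift_def)

lemma shift_funpow_in_shift_space: "x \<in> shift_space d \<Longrightarrow> (shift ^^ k) x \<in> shift_space d"
  by (auto simp: shift_space_def shift_funpow)

lemma prefix_Suc: "map x [0..<Suc n] = x 0 # map (shift x) [0..<n]"
  by (simp add: upt_conv_Cons map_Suc_upt[symmetric] shift_def comp_def del: upt_Suc)

lemma prefix_in_words: "x \<in> shift_space d \<Longrightarrow> map x [0..<n] \<in> words d n"
  by (auto simp: words_def shift_space_def)

lemma birkhoff_sum_Suc: "birkhoff_sum (Suc n) f x = birkhoff_sum n f x + f ((shift ^^ n) x)"
  by (simp add: birkhoff_sum_def)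

lemma mem_cylinder_iff:
  "y \<in> cylinder d w \<longleftrightarrow> y \<in> shift_space d \<and> map y [0..<length w] = w"
  unfolding cylinder_def mem_Collect_eq list_eq_iff_nth_eq[of "map y _"] by simp

lemma cylinder_nonempty:
  assumes "w \<in> words d n" "1 \<le> d"
  shows "cylinder d w \<noteq> {}"
proof -
  have "w ! k \<in> {1..d}" if "k < length w" for k
    using assms(1) nth_mem[OF that] unfolding words_def by blast
  then have "(\<lambda>k. if k < length w then w ! k else 1) \<in> cylinder d w"
    using assms(2) by (simp add: cylinder_def shift_space_def)
  then show ?thesis by blast
qed

section \<open>Bernoulli measures are the invariant Gibbs measures\<close>

text \<open>Uniqueness of the invariant Gibbs measure in terms of the masses \<open>r w\<close> of cylinders.  Let
  \<open>p w\<close> be the Bernoulli mass and \<open>R = r / p\<close>.  Additivity makes \<open>R u\<close> the average of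
  \<open>R (u @ v)\<close> over \<open>v\<close>, and invariance makes \<open>R v\<close> its average over \<open>u\<close>, while \<open>u\<close> and
  \<open>v\<close> are independent under \<open>p\<close>.  So \<open>R u - 1\<close> and \<open>R v - 1\<close> are orthogonal to each other and
  are both projections of \<open>R (u @ v) - 1\<close>, whence the variance of \<open>R\<close> at least doubles when the length does.  Being
  bounded, it vanishes.\<close>
lemma rigid_left_right_additive:
  fixes r :: "nat list \<Rightarrow> real" and \<phi> :: "nat \<Rightarrow> real"
  assumes one: "(\<Sum>i\<in>{1..d}. exp (\<phi> i)) = 1" and Nil: "r [] = 1"
    and right: "\<And>w. set w \<subseteq> {1..d} \<Longrightarrow> (\<Sum>i\<in>{1..d}. r (w @ [i])) = r w"
    and left: "\<And>w. set w \<subseteq> {1..d} \<Longrightarrow> (\<Sum>i\<in>{1..d}. r (i # w)) = r w"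
    and bound: "\<And>w. set w \<subseteq> {1..d} \<Longrightarrow> 0 \<le> r w \<and> r w \<le> C * exp (sum_list (map \<phi> w))"
    and w0: "set w0 \<subseteq> {1..d}"
  shows "r w0 = exp (sum_list (map \<phi> w0))"
proof -
  define p where "p w = exp (sum_list (map \<phi> w))" for w
  have p_pos: "p w > 0" for w by (simp add: p_def)
  have p_app: "p (u @ v) = p u * p v" for u v by (simp add: p_def exp_add)
  have p_sum: "(\<Sum>w\<in>words d n. p w) = 1" for n
    using one by (simp add: p_def sum_exp_words)
  have sub: "set w \<subseteq> {1..d}" if "w \<in> words d n" for w n using that by (simp add: words_def)
  have right_n: "(\<Sum>v\<in>words d n. r (w @ v)) = r w" if "set w \<subseteq> {1..d}" for w n
    using that
  proof (induction n arbitrary: w)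
    case (Suc n)
    have "(\<Sum>v\<in>words d (Suc n). r (w @ v)) = (\<Sum>i\<in>{1..d}. r (w @ [i]))"
      unfolding sum_words_Suc
    proof (rule sum.cong[OF refl])
      fix i assume "i \<in> {1..d}"
      then show "(\<Sum>v\<in>words d n. r (w @ i # v)) = r (w @ [i])"
        using Suc.IH[of "w @ [i]"] Suc.prems by simp
    qed
    then show ?case using right[OF Suc.prems] by simp
  qed simp
  have left_n: "(\<Sum>u\<in>words d n. r (u @ w)) = r w" if "set w \<subseteq> {1..d}" for w n
    using that
  proof (induction n)
    case (Suc n)
    have "(\<Sum>u\<in>words d (Suc n). r (u @ w)) = (\<Sum>u\<in>words d n. \<Sum>i\<in>{1..d}. r (i # u @ w))"
      unfolding sum_words_Suc by (subst sum.swap) simp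
    also have "\<dots> = (\<Sum>u\<in>words d n. r (u @ w))"
      by (rule sum.cong[OF refl], rule left) (use Suc.prems sub in auto)
    finally show ?case using Suc by simp
  qed simp
  have r_sum: "(\<Sum>w\<in>words d n. r w) = 1" for n
    using right_n[of "[]" n] Nil by simp
  define Q where "Q n = (\<Sum>w\<in>words d n. r w ^ 2 / p w)" for n
  have Q_var: "Q n - 1 = (\<Sum>w\<in>words d n. (r w - p w) ^ 2 / p w)" for n
  proof -
    have "(r w - p w) ^ 2 / p w = r w ^ 2 / p w - 2 * r w + p w" for w
      using p_pos[of w] by (simp add: field_simps power2_eq_square)
    then have "(\<Sum>w\<in>words d n. (r w - p w) ^ 2 / p w) = Q n - 2 * 1 + 1"
      by (simp add: sum.distrib sum_subtractf Q_def p_sum r_sum sum_distrib_left[symmetric])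
    then show ?thesis by simp
  qed
  \<comment> \<open>The doubling of the variance: expand the mean of the nonnegative \<open>(R (u @ v) - R u - R v + 1)\<^sup>2\<close>.\<close>
  have Q_double: "2 * (Q n - 1) \<le> Q (n + n) - 1" for n
  proof -
    let ?W = "words d n"
    define T where "T u v = (r (u @ v) / (p u * p v) - r u / p u - r v / p v + 1) ^ 2 * (p u * p v)"
      for u v
    have expand: "T u v = r (u @ v) ^ 2 / p (u @ v) + r u ^ 2 / p u * p v + r v ^ 2 / p v * p u
        + p u * p v - 2 * (r u / p u * r (u @ v)) - 2 * (r v / p v * r (u @ v)) + 2 * r (u @ v)
        + 2 * (r u * r v) - 2 * (r u * p v) - 2 * (r v * p u)" for u v
    proof -
      have "(R - a - b + 1) ^ 2 * (x * y) = (R * (x * y)) ^ 2 / (x * y) + (a * x) ^ 2 / x * y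
          + (b * y) ^ 2 / y * x + x * y - 2 * (a * (R * (x * y))) - 2 * (b * (R * (x * y)))
          + 2 * (R * (x * y)) + 2 * (a * x * (b * y)) - 2 * (a * x * y) - 2 * (b * y * x)"
        if "x > 0" "y > 0" for R a b x y :: real
        using that by (simp add: power2_eq_square) (simp add: algebra_simps)
      from this[OF p_pos[of u] p_pos[of v], of "r (u @ v) / (p u * p v)" "r u / p u" "r v / p v"]
      show ?thesis
        using p_pos[of u] p_pos[of v] by (simp add: T_def p_app)
    qed
    have s1: "(\<Sum>u\<in>?W. \<Sum>v\<in>?W. r (u @ v) ^ 2 / p (u @ v)) = Q (n + n)"
      by (simp add: Q_def sum_words_add)
    have s2: "(\<Sum>u\<in>?W. \<Sum>v\<in>?W. r u ^ 2 / p u * p v) = Q n"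
      by (simp only: Q_def sum_distrib_left[symmetric] p_sum mult_1_right)
    have s3: "(\<Sum>u\<in>?W. \<Sum>v\<in>?W. r v ^ 2 / p v * p u) = Q n"
      by (subst sum.swap) (simp only: Q_def sum_distrib_left[symmetric] p_sum mult_1_right)
    have s4: "(\<Sum>u\<in>?W. \<Sum>v\<in>?W. p u * p v) = 1"
      by (simp add: sum_distrib_left[symmetric] p_sum)
    have s5: "(\<Sum>u\<in>?W. \<Sum>v\<in>?W. r u / p u * r (u @ v)) = Q n"
      unfolding Q_def by (simp only: sum_distrib_left[symmetric], intro sum.cong refl)
        (simp only: right_n[OF sub], simp add: power2_eq_square)
    have s6: "(\<Sum>u\<in>?W. \<Sum>v\<in>?W. r v / p v * r (u @ v)) = Q n"
      unfolding Q_def by (subst sum.swap, simp only: sum_distrib_left[symmetric], intro sum.cong refl)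
        (simp only: left_n[OF sub], simp add: power2_eq_square)
    have s7: "(\<Sum>u\<in>?W. \<Sum>v\<in>?W. r (u @ v)) = 1"
      using r_sum[of "n + n"] by (simp add: sum_words_add)
    have s8: "(\<Sum>u\<in>?W. \<Sum>v\<in>?W. r u * r v) = 1"
      by (simp add: sum_distrib_left[symmetric] r_sum)
    have s9: "(\<Sum>u\<in>?W. \<Sum>v\<in>?W. r u * p v) = 1"
      by (simp add: sum_distrib_left[symmetric] r_sum p_sum)
    have s10: "(\<Sum>u\<in>?W. \<Sum>v\<in>?W. r v * p u) = 1"
      by (subst sum.swap) (simp add: sum_distrib_left[symmetric] r_sum p_sum)
    have "0 \<le> (\<Sum>u\<in>?W. \<Sum>v\<in>?W. T u v)"
      by (intro sum_nonneg) (simp add: T_def p_pos less_imp_le)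
    also have "\<dots> = Q (n + n) + Q n + Q n + 1 - 2 * Q n - 2 * Q n + 2 * 1 + 2 * 1 - 2 * 1 - 2 * 1"
      unfolding expand sum.distrib sum_subtractf
      by (simp only: sum_distrib_left[where r=2, symmetric] s1 s2 s3 s4 s5 s6 s7 s8 s9 s10)
    finally show ?thesis by simp
  qed
  have Q_bound: "Q n \<le> C ^ 2" for n
  proof -
    have "r w ^ 2 / p w \<le> C ^ 2 * p w" if "w \<in> words d n" for w
    proof -
      have "r w ^ 2 \<le> (C * p w) ^ 2"
        using bound[OF sub[OF that]] by (intro power_mono) (auto simp: p_def)
      then show ?thesis using p_pos[of w] by (simp add: field_simps power2_eq_square)
    qed
    then have "Q n \<le> (\<Sum>w\<in>words d n. C ^ 2 * p w)"
      unfolding Q_def by (rule sum_mono)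
    then show ?thesis by (simp add: sum_distrib_left[symmetric] p_sum)
  qed
  define n where "n = length w0"
  have pow: "2 ^ k * (Q n - 1) \<le> Q (2 ^ k * n) - 1" for k
  proof (induction k)
    case (Suc k)
    have "2 ^ Suc k * (Q n - 1) \<le> 2 * (Q (2 ^ k * n) - 1)"
      using Suc by (simp only: power_Suc mult.assoc mult_left_mono zero_le_numeral)
    also have "\<dots> \<le> Q (2 ^ k * n + 2 ^ k * n) - 1" by (rule Q_double)
    also have "2 ^ k * n + 2 ^ k * n = 2 ^ Suc k * n" by simp
    finally show ?case .
  qed simp
  have "Q n - 1 \<le> 0"
  proof (rule ccontr)
    assume "\<not> Q n - 1 \<le> 0"
    then obtain k where "(C ^ 2 - 1) / (Q n - 1) < 2 ^ k"
      using real_arch_pow[of 2 "(C ^ 2 - 1) / (Q n - 1)"] by auto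
    with \<open>\<not> Q n - 1 \<le> 0\<close> have "C ^ 2 - 1 < 2 ^ k * (Q n - 1)"
      by (simp add: field_simps)
    with pow[of k] Q_bound[of "2 ^ k * n"] show False by linarith
  qed
  moreover have nonneg: "0 \<le> (r w - p w) ^ 2 / p w" for w
    by (simp add: p_pos less_imp_le)
  ultimately have "(\<Sum>w\<in>words d n. (r w - p w) ^ 2 / p w) = 0"
    unfolding Q_var[of n] by (intro antisym sum_nonneg) auto
  then have "(r w0 - p w0) ^ 2 / p w0 = 0"
    using w0 by (subst (asm) sum_nonneg_eq_0_iff[OF finite_words])
      (auto simp: nonneg words_def n_def)
  then show ?thesis using p_pos[of w0] by (simp add: p_def)
qed

text \<open>Cylinders form a base of the product topology.  This gives both the generation of the Borel
  sets by cylinders and the criterion for continuity on the shift space.\<close>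
lemma open_contains_prefix_set:
  fixes U :: "(nat \<Rightarrow> nat) set"
  assumes "open U" "x \<in> U"
  obtains m where "\<And>y. \<forall>k<m. y k = x k \<Longrightarrow> y \<in> U"
proof -
  have "openin (product_topology (\<lambda>i. euclidean) UNIV) U"
    using assms(1) by (simp add: open_fun_def)
  from product_topology_open_contains_basis[OF this assms(2)]
  obtain X where X: "x \<in> (\<Pi>\<^sub>E i\<in>UNIV. X i)" "finite {i. X i \<noteq> topspace euclidean}"
      "(\<Pi>\<^sub>E i\<in>UNIV. X i) \<subseteq> U" by blast
  obtain m where m: "\<And>i. X i \<noteq> UNIV \<Longrightarrow> i < m"
    using X(2) finite_nat_set_iff_bounded by auto
  have "y \<in> U" if "\<forall>k<m. y k = x k" for y
  proof -
    have "y i \<in> X i" for i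
      using that m[of i] X(1) by (cases "X i = UNIV") (auto simp: PiE_def Pi_def)
    then show ?thesis using X(3) by (auto simp: PiE_def)
  qed
  then show ?thesis by (rule that)
qed

lemma open_prefix_set: "open {y :: nat \<Rightarrow> nat. \<forall>k<m. y k = x k}"
proof -
  have "{y :: nat \<Rightarrow> nat. \<forall>k<m. y k = x k} = (\<Inter>k\<in>{..<m}. (\<lambda>y. y k) -` {x k})"
    by auto
  also have "open \<dots>"
    by (intro open_INT open_vimage ballI continuous_on_product_coordinates)
       (auto simp: open_discrete)
  finally show ?thesis .
qed

lemma cylinder_eq_Int: "cylinder d w = shift_space d \<inter> {y. \<forall>k<length w. y k = w ! k}"
  by (auto simp: cylinder_def)

lemma cylinder_in_sets: "cylinder d w \<in> sets (restrict_space borel (shift_space d))"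
  unfolding sets_restrict_space cylinder_eq_Int
  by (intro imageI borel_open open_prefix_set)

lemma sets_restrict_borel_shift_space:
  "sets (restrict_space borel (shift_space d)) = sigma_sets (shift_space d) (range (cylinder d))"
    (is "sets ?B = ?S")
proof
  have sub: "range (cylinder d) \<subseteq> Pow (shift_space d)"
    by (auto simp: cylinder_def)
  have "?S \<subseteq> sigma_sets (shift_space d) (sets ?B)"
    by (rule sigma_sets_mono') (auto simp: cylinder_in_sets)
  then show "?S \<subseteq> sets ?B"
    using sets.sigma_sets_eq[of ?B] by (simp add: space_restrict_space)
  have meas: "(\<lambda>x. x) \<in> borel_measurable (sigma (shift_space d) (range (cylinder d)))"
  proof (rule borel_measurableI)
    fix U :: "(nat \<Rightarrow> nat) set" assume U: "open U"
    have "U \<inter> shift_space d = (\<Union>w\<in>{w. cylinder d w \<subseteq> U}. cylinder d w)"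
    proof (intro equalityI subsetI)
      fix x assume x: "x \<in> U \<inter> shift_space d"
      with U obtain m where m: "\<And>y. \<forall>k<m. y k = x k \<Longrightarrow> y \<in> U"
        using open_contains_prefix_set by blast
      have "cylinder d (map x [0..<m]) \<subseteq> U" "x \<in> cylinder d (map x [0..<m])"
        using m x by (auto simp: cylinder_def)
      then show "x \<in> (\<Union>w\<in>{w. cylinder d w \<subseteq> U}. cylinder d w)" by blast
    qed (auto simp: cylinder_def)
    also have "\<dots> \<in> sets (sigma (shift_space d) (range (cylinder d)))"
      by (intro sets.countable_UN') (auto simp: sub intro!: sigma_sets.Basic)
    finally show "(\<lambda>x. x) -` U \<inter> space (sigma (shift_space d) (range (cylinder d)))
        \<in> sets (sigma (shift_space d) (range (cylinder d)))"
      by (simp add: sub)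
  qed
  show "sets ?B \<subseteq> ?S"
  proof
    fix A assume "A \<in> sets ?B"
    then obtain A' where A': "A' \<in> sets borel" "A = shift_space d \<inter> A'"
      by (auto simp: sets_restrict_space)
    from measurable_sets[OF meas A'(1)] show "A \<in> ?S"
      using A'(2) by (simp add: sub Int_commute)
  qed
qed

lemma Int_stable_cylinders: "Int_stable (insert {} (range (cylinder d)))"
proof -
  have *: "cylinder d v \<inter> cylinder d w \<in> insert {} (range (cylinder d))"
    if "length v \<le> length w" for v w
  proof (cases "\<exists>y. y \<in> cylinder d v \<inter> cylinder d w")
    case True
    then obtain y where y: "\<And>i. i < length v \<Longrightarrow> y i = v ! i" "\<And>i. i < length w \<Longrightarrow> y i = w ! i"
      by (auto simp: cylinder_def)
    then have "v ! i = w ! i" if "i < length v" for i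
      using that \<open>length v \<le> length w\<close> by (metis order_less_le_trans)
    then have "cylinder d v \<inter> cylinder d w = cylinder d w"
      using \<open>length v \<le> length w\<close> by (auto simp: cylinder_def)
    then show ?thesis by auto
  qed auto
  show ?thesis
  proof (rule Int_stableI)
    fix A B assume "A \<in> insert {} (range (cylinder d))" "B \<in> insert {} (range (cylinder d))"
    then consider "A = {}" | "B = {}" | v w where "A = cylinder d v" "B = cylinder d w" by blast
    then show "A \<inter> B \<in> insert {} (range (cylinder d))"
    proof cases
      case 3
      then show ?thesis using *[of v w] *[of w v] by (cases "length v \<le> length w") (auto simp: Int_commute)
    qed auto
  qed
qed

lemma cylinder_eq_empty:
  assumes "\<not> set w \<subseteq> {1..d}"
  shows "cylinder d w = {}"
proof -
  obtain k where "k < length w" "w ! k \<notin> {1..d}"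
    using assms by (auto simp: subset_iff in_set_conv_nth)
  then have "y \<notin> cylinder d w" for y
    by (metis (mono_tags, lifting) cylinder_def shift_space_def mem_Collect_eq)
  then show ?thesis by blast
qed

lemma cylinder_Nil [simp]: "cylinder d [] = shift_space d"
  by (simp add: cylinder_def)

lemma measure_eqI_cylinders:
  assumes "sets M = sets (restrict_space borel (shift_space d))"
    and "sets N = sets (restrict_space borel (shift_space d))"
    and "finite_measure M" "finite_measure N"
    and eq: "\<And>w. set w \<subseteq> {1..d} \<Longrightarrow> measure M (cylinder d w) = measure N (cylinder d w)"
  shows "M = N"
proof -
  interpret M: finite_measure M by fact
  interpret N: finite_measure N by fact
  let ?E = "insert {} (range (cylinder d))"
  have gen: "sigma_sets (shift_space d) (range (cylinder d)) = sigma_sets (shift_space d) ?E"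
    by (intro sigma_sets_eqI) (auto intro: sigma_sets.intros)
  show ?thesis
  proof (rule measure_eqI_generator_eq[OF Int_stable_cylinders, where \<Omega> = "shift_space d"
        and A = "\<lambda>_. shift_space d"])
    show "?E \<subseteq> Pow (shift_space d)" by (auto simp: cylinder_def)
    show "emeasure M X = emeasure N X" if "X \<in> ?E" for X
    proof -
      from that consider "X = {}" | w where "X = cylinder d w" "set w \<subseteq> {1..d}"
        using cylinder_eq_empty by blast
      then show ?thesis
        using eq by cases (auto simp: M.emeasure_eq_measure N.emeasure_eq_measure)
    qed
    show "sets M = sigma_sets (shift_space d) ?E" "sets N = sigma_sets (shift_space d) ?E"
      using assms(1,2) by (simp_all add: sets_restrict_borel_shift_space gen)
    show "range (\<lambda>_. shift_space d) \<subseteq> ?E"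
      using cylinder_Nil[of d, symmetric] by blast
    show "emeasure M (shift_space d) \<noteq> \<infinity>"
      by (simp add: M.emeasure_eq_measure)
  qed simp
qed

lemma cylinder_append_UN:
  "cylinder d w = (\<Union>i\<in>{1..d}. cylinder d (w @ [i]))"
  "disjoint_family_on (\<lambda>i. cylinder d (w @ [i])) {1..d}"
proof -
  have *: "x \<in> cylinder d (w @ [i]) \<longleftrightarrow> x \<in> cylinder d w \<and> x (length w) = i" for x i
    by (auto simp: cylinder_def nth_append less_Suc_eq)
  show "cylinder d w = (\<Union>i\<in>{1..d}. cylinder d (w @ [i]))"
    by (auto simp: *) (auto simp: cylinder_def shift_space_def)
  show "disjoint_family_on (\<lambda>i. cylinder d (w @ [i])) {1..d}"
    by (auto simp: disjoint_family_on_def *)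
qed

lemma shift_vimage_cylinder_UN:
  "shift -` cylinder d w \<inter> shift_space d = (\<Union>i\<in>{1..d}. cylinder d (i # w))"
  "disjoint_family_on (\<lambda>i. cylinder d (i # w)) {1..d}"
proof -
  have *: "x \<in> cylinder d (i # w) \<longleftrightarrow> x \<in> shift_space d \<and> x 0 = i \<and> shift x \<in> cylinder d w" for x i
    unfolding cylinder_def
    by (auto simp: shift_def shift_space_def less_Suc_eq_0_disj)
  show "shift -` cylinder d w \<inter> shift_space d = (\<Union>i\<in>{1..d}. cylinder d (i # w))"
    by (auto simp: * shift_space_def)
  show "disjoint_family_on (\<lambda>i. cylinder d (i # w)) {1..d}"
    by (auto simp: disjoint_family_on_def *)
qed

text \<open>The product of the weights lives on all sequences of natural numbers; it is restricted to
  the shift space, which carries full measure.\<close>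
lemma bernoulli_measure_exists:
  fixes \<phi> :: "nat \<Rightarrow> real"
  assumes one: "(\<Sum>i\<in>{1..d}. exp (\<phi> i)) = 1"
  obtains \<mu> where "sets \<mu> = sets (restrict_space borel (shift_space d))" "prob_space \<mu>"
    "\<And>w. set w \<subseteq> {1..d} \<Longrightarrow> measure \<mu> (cylinder d w) = exp (sum_list (map \<phi> w))"
proof -
  define f where "f i = (if i \<in> {1..d} then exp (\<phi> i) else 0)" for i
  have "(\<integral>\<^sup>+ i. ennreal (f i) \<partial>count_space UNIV) = (\<Sum>i\<in>{1..d}. ennreal (f i))"
    by (rule nn_integral_count_space') (auto simp: f_def)
  also have "\<dots> = ennreal (\<Sum>i\<in>{1..d}. f i)"
    by (rule sum_ennreal) (simp add: f_def)
  also have "\<dots> = 1" using one by (simp add: f_def)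
  finally have f1: "(\<integral>\<^sup>+ i. ennreal (f i) \<partial>count_space UNIV) = 1" .
  have f0: "0 \<le> f i" for i by (simp add: f_def)
  define P where "P = embed_pmf f"
  have pmf_P: "pmf P i = f i" for i
    unfolding P_def by (rule pmf_embed_pmf) (use f0 f1 in auto)
  define M where "M = PiM (UNIV :: nat set) (\<lambda>_. measure_pmf P)"
  interpret product_prob_space "\<lambda>_ :: nat. measure_pmf P" UNIV
    by unfold_locales
  have setsM: "sets M = sets borel"
  proof -
    have "sets M = sets (PiM UNIV (\<lambda>_ :: nat. borel :: nat measure))"
      unfolding M_def by (rule sets_PiM_cong) (auto simp: sets_borel_eq_count_space)
    then show ?thesis by (simp add: sets_PiM_equal_borel)
  qed
  have spaceM: "space M = UNIV" using sets_eq_imp_space_eq[OF setsM] by simp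
  have prefix: "measure M {x. \<forall>k<length w. x k = w ! k} = exp (sum_list (map \<phi> w))"
    if "set w \<subseteq> {1..d}" for w
  proof -
    have "emeasure M {x \<in> space M. \<forall>k\<in>{..<length w}. x k \<in> {w ! k}}
        = (\<Prod>k<length w. emeasure (measure_pmf P) {w ! k})"
      unfolding M_def by (rule emeasure_PiM_Collect) auto
    also have "\<dots> = (\<Prod>k<length w. ennreal (exp (\<phi> (w ! k))))"
    proof (rule prod.cong[OF refl])
      fix k assume "k \<in> {..<length w}"
      then have "w ! k \<in> {1..d}" using that nth_mem[of k w] by blast
      then show "emeasure (measure_pmf P) {w ! k} = ennreal (exp (\<phi> (w ! k)))"
        unfolding emeasure_pmf_single pmf_P by (simp only: f_def if_True)
    qed
    also have "\<dots> = ennreal (exp (\<Sum>k<length w. \<phi> (w ! k)))"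
      by (simp add: prod_ennreal exp_sum)
    also have "(\<Sum>k<length w. \<phi> (w ! k)) = sum_list (map \<phi> w)"
      by (simp add: sum_list_sum_nth atLeast0LessThan)
    finally show ?thesis by (simp add: spaceM measure_def Ball_def)
  qed
  have AE: "AE x in M. x \<in> shift_space d"
  proof -
    have "AE i in measure_pmf P. i \<in> {1..d}"
      by (auto simp: AE_measure_pmf_iff set_pmf_iff pmf_P f_def split: if_splits)
    then have "AE x in M. x n \<in> {1..d}" for n
      unfolding M_def by (intro AE_PiM_component) (auto intro: measure_pmf.prob_space_axioms)
    then show ?thesis by (simp add: shift_space_def AE_all_countable)
  qed
  have closed: "closed (shift_space d)"
  proof -
    have "shift_space d = (\<Inter>n. (\<lambda>x. x n) -` {1..d})"
      by (auto simp: shift_space_def)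
    also have "closed \<dots>"
      by (intro closed_INT closed_vimage ballI continuous_on_product_coordinates)
         (auto intro: finite_imp_closed)
    finally show ?thesis .
  qed
  then have S: "shift_space d \<in> sets M" by (simp add: setsM)
  interpret M: prob_space M unfolding M_def by (rule prob_space_PiM) (rule measure_pmf.prob_space_axioms)
  show ?thesis
  proof (rule that)
    show "sets (restrict_space M (shift_space d)) = sets (restrict_space borel (shift_space d))"
      by (rule sets_restrict_space_cong[OF setsM])
    show "prob_space (restrict_space M (shift_space d))"
      by (rule prob_space_restrict_space[OF S M.emeasure_eq_1_AE[OF S AE]])
    fix w :: "nat list" assume w: "set w \<subseteq> {1..d}"
    have "measure (restrict_space M (shift_space d)) (cylinder d w) = measure M (cylinder d w)"
      by (rule measure_restrict_space) (auto simp: S cylinder_def)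
    also have "\<dots> = measure M {x. \<forall>k<length w. x k = w ! k}"
    proof (rule M.finite_measure_eq_AE)
      show "AE x in M. (x \<in> cylinder d w) = (x \<in> {x. \<forall>k<length w. x k = w ! k})"
        using AE by eventually_elim (simp add: cylinder_def)
      show "{x. \<forall>k<length w. x k = w ! k} \<in> sets M"
        using open_prefix_set[of "length w" "\<lambda>k. w ! k"] by (simp add: setsM)
      then show "cylinder d w \<in> sets M"
        unfolding cylinder_eq_Int by (rule sets.Int[OF S])
    qed
    finally show "measure (restrict_space M (shift_space d)) (cylinder d w)
        = exp (sum_list (map \<phi> w))"
      using prefix[OF w] by simp
  qed
qed

lemma shift_invariant_of_cylinders:
  fixes \<phi> :: "nat \<Rightarrow> real"
  assumes one: "(\<Sum>i\<in>{1..d}. exp (\<phi> i)) = 1"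
    and sets: "sets \<mu> = sets (restrict_space borel (shift_space d))" and "prob_space \<mu>"
    and cyl: "\<And>w. set w \<subseteq> {1..d} \<Longrightarrow> measure \<mu> (cylinder d w) = exp (sum_list (map \<phi> w))"
    and A: "A \<in> sets \<mu>"
  shows "emeasure \<mu> (shift -` A \<inter> space \<mu>) = emeasure \<mu> A"
proof -
  interpret prob_space \<mu> by fact
  have space: "space \<mu> = shift_space d"
    using sets_eq_imp_space_eq[OF sets] by (simp add: space_restrict_space)
  have cs: "cylinder d w \<in> sets \<mu>" for w by (simp add: sets cylinder_in_sets)
  have meas: "shift \<in> measurable \<mu> \<mu>"
  proof (rule measurable_sigma_sets)
    show "sets \<mu> = sigma_sets (shift_space d) (range (cylinder d))"
      by (simp add: sets sets_restrict_borel_shift_space)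
    show "range (cylinder d) \<subseteq> Pow (shift_space d)" by (auto simp: cylinder_def)
    show "shift \<in> space \<mu> \<rightarrow> shift_space d" by (simp add: space shift_in_shift_space)
    fix B assume "B \<in> range (cylinder d)"
    then show "shift -` B \<inter> space \<mu> \<in> sets \<mu>"
      unfolding space by (auto simp only: shift_vimage_cylinder_UN(1) intro!: sets.finite_UN cs)
  qed
  have "distr \<mu> \<mu> shift = \<mu>"
  proof (rule measure_eqI_cylinders[where d = d])
    show "finite_measure (distr \<mu> \<mu> shift)"
      using prob_space_distr[OF meas] by (simp add: prob_space.finite_measure)
    fix w assume w: "set w \<subseteq> {1..d}"
    have "measure (distr \<mu> \<mu> shift) (cylinder d w) = measure \<mu> (\<Union>i\<in>{1..d}. cylinder d (i # w))"
      by (simp add: measure_distr[OF meas cs] space shift_vimage_cylinder_UN(1))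
    also have "\<dots> = (\<Sum>i\<in>{1..d}. measure \<mu> (cylinder d (i # w)))"
      by (intro finite_measure_finite_Union shift_vimage_cylinder_UN(2)) (auto simp: cs)
    also have "\<dots> = (\<Sum>i\<in>{1..d}. exp (\<phi> i) * exp (sum_list (map \<phi> w)))"
      using w by (intro sum.cong) (auto simp: cyl exp_add)
    also have "\<dots> = exp (sum_list (map \<phi> w))"
      by (simp only: sum_distrib_right[symmetric] one mult_1)
    finally show "measure (distr \<mu> \<mu> shift) (cylinder d w) = measure \<mu> (cylinder d w)"
      by (simp only: cyl[OF w])
  qed (auto simp: sets finite_measure_axioms)
  then show ?thesis using emeasure_distr[OF meas A] by simp
qed

lemma invariant_bounded_measure_eq_weights:
  fixes \<phi> :: "nat \<Rightarrow> real"
  assumes one: "(\<Sum>i\<in>{1..d}. exp (\<phi> i)) = 1"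
    and sets: "sets \<mu> = sets (restrict_space borel (shift_space d))" and "prob_space \<mu>"
    and inv: "\<And>A. A \<in> sets \<mu> \<Longrightarrow> emeasure \<mu> (shift -` A \<inter> space \<mu>) = emeasure \<mu> A"
    and bound: "\<And>w. set w \<subseteq> {1..d} \<Longrightarrow> measure \<mu> (cylinder d w) \<le> C * exp (sum_list (map \<phi> w))"
    and w: "set w \<subseteq> {1..d}"
  shows "measure \<mu> (cylinder d w) = exp (sum_list (map \<phi> w))"
proof (rule rigid_left_right_additive[OF one _ _ _ _ w, of "\<lambda>w. measure \<mu> (cylinder d w)"])
  interpret prob_space \<mu> by fact
  have space: "space \<mu> = shift_space d"
    using sets_eq_imp_space_eq[OF sets] by (simp add: space_restrict_space)
  have cs: "cylinder d w \<in> sets \<mu>" for w by (simp add: sets cylinder_in_sets)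
  show "measure \<mu> (cylinder d []) = 1" using prob_space by (simp add: space)
  show "(\<Sum>i\<in>{1..d}. measure \<mu> (cylinder d (w @ [i]))) = measure \<mu> (cylinder d w)" for w
    unfolding cylinder_append_UN(1)[of d w]
    by (intro finite_measure_finite_Union[symmetric] cylinder_append_UN(2)) (auto simp: cs)
  show "(\<Sum>i\<in>{1..d}. measure \<mu> (cylinder d (i # w))) = measure \<mu> (cylinder d w)" for w
  proof -
    have "(\<Sum>i\<in>{1..d}. measure \<mu> (cylinder d (i # w))) = measure \<mu> (shift -` cylinder d w \<inter> space \<mu>)"
      unfolding space shift_vimage_cylinder_UN(1)
      by (intro finite_measure_finite_Union[symmetric] shift_vimage_cylinder_UN(2)) (auto simp: cs)
    also have "\<dots> = measure \<mu> (cylinder d w)"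
      using inv[OF cs] by (simp add: measure_def)
    finally show ?thesis .
  qed
  show "0 \<le> measure \<mu> (cylinder d w) \<and> measure \<mu> (cylinder d w) \<le> C * exp (sum_list (map \<phi> w))"
    if "set w \<subseteq> {1..d}" for w using bound[OF that] by simp
qed


section \<open>Geometry of a conformal system\<close>

lemma word_map_Nil [simp]: "word_map f [] = id"
  by (simp add: word_map_def)

lemma word_map_Cons [simp]: "word_map f (i # w) = f i \<circ> word_map f w"
  by (simp add: word_map_def)

lemma word_map_append: "word_map f (v @ w) = word_map f v \<circ> word_map f w"
  by (induction v) (simp_all add: comp_assoc)

text \<open>A conformal system together with a choice of the data whose existence its definition asserts:
  the conformal extensions \<open>F\<close>, the distortion constant \<open>C\<close>, and one contraction ratio
  \<open>c\<close> for all generators.\<close>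
locale conformal_ifs =
  fixes d :: nat and \<Phi> :: ifs and U :: "complex set" and F :: "nat \<Rightarrow> complex \<Rightarrow> complex"
    and c C :: real
  assumes d: "2 \<le> d"
    and base: "base \<Phi> \<noteq> {}" "compact (base \<Phi>)" "connected (base \<Phi>)"
    and gen_base: "i \<in> {1..d} \<Longrightarrow> gen \<Phi> i ` base \<Phi> \<subseteq> interior (base \<Phi>)"
    and contr: "0 \<le> c" "c < 1" "i \<in> {1..d} \<Longrightarrow> c-lipschitz_on (base \<Phi>) (gen \<Phi> i)"
    and osc: "i \<in> {1..d} \<Longrightarrow> j \<in> {1..d} \<Longrightarrow> i \<noteq> j \<Longrightarrow>
        gen \<Phi> i ` interior (base \<Phi>) \<inter> gen \<Phi> j ` interior (base \<Phi>) = {}"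
    and U: "open U" "complex_of_real ` base \<Phi> \<subseteq> U"
    and conf: "i \<in> {1..d} \<Longrightarrow> conformal_on (F i) U" "i \<in> {1..d} \<Longrightarrow> F i ` U \<subseteq> U"
    and extension: "i \<in> {1..d} \<Longrightarrow> x \<in> base \<Phi> \<Longrightarrow>
        F i (complex_of_real x) = complex_of_real (gen \<Phi> i x)"
    and distortion: "1 \<le> C" "set w \<subseteq> {1..d} \<Longrightarrow> x \<in> U \<Longrightarrow> y \<in> U \<Longrightarrow>
        norm (deriv (word_map F w) y) \<le> C * norm (deriv (word_map F w) x)"
begin

abbreviation X where "X \<equiv> base \<Phi>"
abbreviation \<psi> where "\<psi> \<equiv> word_map (gen \<Phi>)"
abbreviation \<pi> where "\<pi> \<equiv> coding \<Phi>"

text \<open>On the interior of the base this is \<open>\<bar>\<psi>\<^sub>w'\<bar>\<close> (see \<open>word_map_real_deriv\<close>).  The extension is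
  used because the chain rule, bounded distortion and Cauchy's estimate live on \<open>U\<close>.\<close>
definition D :: "nat list \<Rightarrow> real \<Rightarrow> real" where
  "D w t = norm (deriv (word_map F w) (complex_of_real t))"

lemma gen_in_interior: "i \<in> {1..d} \<Longrightarrow> t \<in> X \<Longrightarrow> gen \<Phi> i t \<in> interior X"
  using gen_base[of i] by blast

lemma gen_in_base: "i \<in> {1..d} \<Longrightarrow> t \<in> X \<Longrightarrow> gen \<Phi> i t \<in> X"
  using gen_in_interior[of i t] interior_subset[of X] by blast

lemma word_map_base: "set w \<subseteq> {1..d} \<Longrightarrow> t \<in> X \<Longrightarrow> \<psi> w t \<in> X"
  by (induction w) (auto simp: gen_in_base)

lemma word_map_contraction:
  "set w \<subseteq> {1..d} \<Longrightarrow> s \<in> X \<Longrightarrow> t \<in> X \<Longrightarrow> \<bar>\<psi> w s - \<psi> w t\<bar> \<le> c ^ length w * \<bar>s - t\<bar>"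
proof (induction w)
  case (Cons i w)
  have "\<bar>\<psi> (i # w) s - \<psi> (i # w) t\<bar> \<le> c * \<bar>\<psi> w s - \<psi> w t\<bar>"
    using lipschitz_onD[OF contr(3), of i "\<psi> w s" "\<psi> w t"] Cons.prems word_map_base[of w]
    by (auto simp: dist_real_def)
  also have "\<dots> \<le> c * (c ^ length w * \<bar>s - t\<bar>)"
    using Cons by (intro mult_left_mono contr(1)) auto
  finally show ?case by (simp add: mult.assoc)
qed simp

lemma coding_eqI:
  assumes x: "x \<in> shift_space d" and p: "\<And>n. p \<in> \<psi> (map x [0..<n]) ` X"
  shows "\<pi> x = p"
proof -
  have unique: "q = p" if q: "\<And>n. q \<in> \<psi> (map x [0..<n]) ` X" for q
  proof -
    have bound: "\<bar>q - p\<bar> \<le> c ^ n * diameter X" for n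
    proof -
      obtain s t where st: "s \<in> X" "t \<in> X" "q = \<psi> (map x [0..<n]) s" "p = \<psi> (map x [0..<n]) t"
        using q[of n] p[of n] by auto
      have "\<bar>q - p\<bar> \<le> c ^ n * \<bar>s - t\<bar>"
        using word_map_contraction[of "map x [0..<n]" s t] st prefix_in_words[OF x, of n]
        by (simp add: words_def)
      also have "\<bar>s - t\<bar> \<le> diameter X"
        using diameter_bounded_bound[OF compact_imp_bounded[OF base(2)] st(1,2)]
        by (simp add: dist_real_def)
      finally show ?thesis using contr(1) by (simp add: mult_left_mono)
    qed
    moreover have "(\<lambda>n. c ^ n * diameter X) \<longlonglongrightarrow> 0"
      using LIMSEQ_realpow_zero[OF contr(1,2)] tendsto_mult_left_zero by blast
    ultimately have "\<bar>q - p\<bar> \<le> 0"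
      using LIMSEQ_le_const[of "\<lambda>n. c ^ n * diameter X" 0 "\<bar>q - p\<bar>"] by blast
    then show ?thesis by simp
  qed
  have "(\<Inter>n. \<psi> (map x [0..<n]) ` X) = {p}"
  proof (intro equalityI subsetI)
    fix q assume "q \<in> (\<Inter>n. \<psi> (map x [0..<n]) ` X)"
    then show "q \<in> {p}" using unique[of q] by simp
  qed (simp add: p)
  then show ?thesis by (simp add: coding_def)
qed

lemma coding_in_images:
  assumes x: "x \<in> shift_space d"
  shows "\<pi> x \<in> \<psi> (map x [0..<n]) ` X"
proof -
  let ?K = "\<lambda>n. \<psi> (map x [0..<n]) ` X"
  have sub: "set (map x [0..<n]) \<subseteq> {1..d}" for n
    using prefix_in_words[OF x, of n] by (simp add: words_def)
  have step: "?K (Suc n) \<subseteq> ?K n" for n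
  proof -
    have "gen \<Phi> (x n) ` X \<subseteq> X"
      using gen_base[of "x n"] interior_subset[of X] x unfolding shift_space_def by blast
    then show ?thesis by (auto simp: word_map_append)
  qed
  have "\<Inter>(range ?K) \<noteq> {}"
  proof (rule compact_nest)
    show "compact (?K n)" for n
    proof (rule compact_continuous_image[OF _ base(2)])
      have "(c ^ n)-lipschitz_on X (\<psi> (map x [0..<n]))"
        using word_map_contraction[OF sub[of n]] contr(1)
        by (intro lipschitz_onI) (auto simp: dist_real_def)
      then show "continuous_on X (\<psi> (map x [0..<n]))"
        by (rule lipschitz_on_continuous_on)
    qed
    show "?K n \<noteq> {}" for n using base(1) by simp
    show "?K n \<subseteq> ?K m" if "m \<le> n" for m n
      using that by (rule lift_Suc_antimono_le[of ?K, OF step])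
  qed
  then obtain p where p: "\<And>n. p \<in> ?K n" by blast
  with coding_eqI[OF x] show ?thesis by metis
qed

lemma coding_in_base: "x \<in> shift_space d \<Longrightarrow> \<pi> x \<in> X"
  using coding_in_images[of x 0] by simp

lemma coding_step:
  assumes x: "x \<in> shift_space d"
  shows "\<pi> x = gen \<Phi> (x 0) (\<pi> (shift x))"
proof (rule coding_eqI[OF x])
  fix n
  have sx: "shift x \<in> shift_space d" using x by (rule shift_in_shift_space)
  have x0: "x 0 \<in> {1..d}" using x by (simp add: shift_space_def)
  show "gen \<Phi> (x 0) (\<pi> (shift x)) \<in> \<psi> (map x [0..<n]) ` X"
  proof (cases n)
    case 0
    then show ?thesis
      using gen_base[OF x0] coding_in_base[OF sx] interior_subset[of X] by auto
  next
    case (Suc m)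
    then show ?thesis
      using coding_in_images[OF sx, of m] unfolding Suc prefix_Suc by (auto simp: image_comp[symmetric])
  qed
qed

lemma coding_interior:
  assumes x: "x \<in> shift_space d"
  shows "\<pi> x \<in> interior X"
proof -
  have "x 0 \<in> {1..d}" using x by (simp add: shift_space_def)
  from gen_base[OF this] coding_in_base[OF shift_in_shift_space[OF x]] show ?thesis
    unfolding coding_step[OF x] by blast
qed

lemma coding_prefix:
  assumes x: "x \<in> shift_space d"
  shows "\<pi> x = \<psi> (map x [0..<n]) (\<pi> ((shift ^^ n) x))"
proof (induction n)
  case (Suc n)
  have "\<pi> ((shift ^^ n) x) = gen \<Phi> (x n) (\<pi> ((shift ^^ Suc n) x))"
    using coding_step[OF shift_funpow_in_shift_space[OF x], of n] by (simp add: shift_funpow)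
  with Suc show ?case by (simp add: word_map_append)
qed simp

lemma coding_in_limit_set:
  assumes x: "x \<in> shift_space d"
  shows "\<pi> x \<in> limit_set d \<Phi>"
  unfolding limit_set_def using coding_in_images[OF x] prefix_in_words[OF x] by blast

lemma limit_set_subset_base: "limit_set d \<Phi> \<subseteq> X"
proof
  fix p assume "p \<in> limit_set d \<Phi>"
  then have "p \<in> (\<Union>w\<in>words d 0. \<psi> w ` X)" unfolding limit_set_def by blast
  then show "p \<in> X" by simp
qed

lemma limit_set_invariant:
  assumes i: "i \<in> {1..d}" and p: "p \<in> limit_set d \<Phi>"
  shows "gen \<Phi> i p \<in> limit_set d \<Phi>"
  unfolding limit_set_def
proof (rule INT_I)
  fix n
  show "gen \<Phi> i p \<in> (\<Union>w\<in>words d n. \<psi> w ` X)"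
  proof (cases n)
    case 0
    then show ?thesis
      using gen_base[OF i] limit_set_subset_base p interior_subset[of X] by auto
  next
    case (Suc m)
    obtain w q where w: "w \<in> words d m" "q \<in> X" "p = \<psi> w q"
      using p unfolding limit_set_def by blast
    then have "i # w \<in> words d n" using i Suc by (simp add: words_def)
    moreover have "gen \<Phi> i p = \<psi> (i # w) q" using w by simp
    ultimately show ?thesis using w(2) by blast
  qed
qed

lemma word_map_limit_set:
  "set w \<subseteq> {1..d} \<Longrightarrow> p \<in> limit_set d \<Phi> \<Longrightarrow> \<psi> w p \<in> limit_set d \<Phi>"
  by (induction w) (auto intro: limit_set_invariant)

text \<open>The open set condition lets first-level images of the base touch at end points.  The coded
  points, however, lie in the images of the compact set \<open>Y\<close> of first-level images, which is
  contained in the interior of the base; those second-level images are disjoint and compact.\<close>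
lemma coding_separated:
  obtains \<delta> where "\<delta> > 0"
    "\<And>x y. x \<in> shift_space d \<Longrightarrow> y \<in> shift_space d \<Longrightarrow> x 0 \<noteq> y 0 \<Longrightarrow> \<delta> \<le> \<bar>\<pi> x - \<pi> y\<bar>"
proof -
  have cont: "continuous_on X (gen \<Phi> i)" if "i \<in> {1..d}" for i
    using contr(3)[OF that] by (rule lipschitz_on_continuous_on)
  define Y where "Y = (\<Union>i\<in>{1..d}. gen \<Phi> i ` X)"
  have Y_int: "Y \<subseteq> interior X" using gen_in_interior by (auto simp: Y_def)
  then have YX: "Y \<subseteq> X" using interior_subset by blast
  have "compact Y" unfolding Y_def
    by (intro compact_UN ballI compact_continuous_image cont base(2)) auto
  then have comp: "compact (gen \<Phi> i ` Y)" if "i \<in> {1..d}" for i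
    using continuous_on_subset[OF cont[OF that] YX] by (intro compact_continuous_image)
  have "\<exists>\<delta>>0. i \<in> {1..d} \<and> j \<in> {1..d} \<and> i \<noteq> j \<longrightarrow>
      (\<forall>s\<in>gen \<Phi> i ` Y. \<forall>t\<in>gen \<Phi> j ` Y. \<delta> \<le> dist s t)" for i j
  proof (cases "i \<in> {1..d} \<and> j \<in> {1..d} \<and> i \<noteq> j")
    case True
    have "gen \<Phi> i ` Y \<inter> gen \<Phi> j ` Y = {}"
      using osc[of i j] True Y_int by blast
    then show ?thesis
      using separate_compact_closed[of "gen \<Phi> i ` Y" "gen \<Phi> j ` Y"] comp[of i] comp[of j] True
        compact_imp_closed by meson
  qed (auto intro: exI[of _ 1])
  then obtain \<delta> where \<delta>: "\<And>i j. \<delta> i j > 0" "\<And>i j s t. i \<in> {1..d} \<Longrightarrow> j \<in> {1..d} \<Longrightarrow> i \<noteq> j \<Longrightarrow>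
      s \<in> gen \<Phi> i ` Y \<Longrightarrow> t \<in> gen \<Phi> j ` Y \<Longrightarrow> \<delta> i j \<le> dist s t"
    by metis
  define \<delta>' where "\<delta>' = Min ((\<lambda>(i, j). \<delta> i j) ` ({1..d} \<times> {1..d}))"
  show ?thesis
  proof
    show "\<delta>' > 0" unfolding \<delta>'_def
      using d \<delta>(1) by (subst Min_gr_iff) auto
    fix x y assume xy: "x \<in> shift_space d" "y \<in> shift_space d" "x 0 \<noteq> y 0"
    have Y: "\<pi> z \<in> Y" if "z \<in> shift_space d" for z
    proof -
      have "z 0 \<in> {1..d}" using that by (simp add: shift_space_def)
      then show ?thesis
        using coding_step[OF that] coding_in_base[OF shift_in_shift_space[OF that]]
        unfolding Y_def by blast
    qed
    have 0: "x 0 \<in> {1..d}" "y 0 \<in> {1..d}" using xy by (auto simp: shift_space_def)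
    then have "\<delta>' \<le> \<delta> (x 0) (y 0)"
      unfolding \<delta>'_def by (intro Min_le finite_imageI rev_image_eqI[of "(x 0, y 0)"]) auto
    also have "\<dots> \<le> dist (\<pi> x) (\<pi> y)"
      using \<delta>(2)[OF 0 xy(3)] coding_step[OF xy(1)] coding_step[OF xy(2)]
        Y[OF shift_in_shift_space[OF xy(1)]] Y[OF shift_in_shift_space[OF xy(2)]]
      by (metis imageI)
    finally show "\<delta>' \<le> \<bar>\<pi> x - \<pi> y\<bar>" by (simp add: dist_real_def)
  qed
qed

subsection \<open>Derivatives along words\<close>

lemma base_U: "t \<in> X \<Longrightarrow> complex_of_real t \<in> U"
  using U(2) by blast

lemma word_map_U: "set w \<subseteq> {1..d} \<Longrightarrow> z \<in> U \<Longrightarrow> word_map F w z \<in> U"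
  by (induction w) (use conf(2) in \<open>auto simp: subset_iff image_subset_iff\<close>)

lemma F_deriv_nonzero:
  assumes "i \<in> {1..d}" "z \<in> U"
  shows "deriv (F i) z \<noteq> 0"
  using conf(1)[OF assms(1)] assms(2) by (simp add: conformal_on_def)

lemma word_map_holomorphic:
  "set w \<subseteq> {1..d} \<Longrightarrow> word_map F w holomorphic_on U"
proof (induction w)
  case (Cons i w)
  have "F i holomorphic_on U" using conf(1)[of i] Cons.prems by (simp add: conformal_on_def)
  then show ?case
    unfolding word_map_Cons using Cons word_map_U[of w]
    by (intro holomorphic_on_compose_gen[where t = U]) auto
qed (simp add: holomorphic_on_ident id_def)

lemma word_map_deriv:
  assumes "set w \<subseteq> {1..d}" "z \<in> U"
  shows "(word_map F w has_field_derivative deriv (word_map F w) z) (at z)"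
  using word_map_holomorphic[OF assms(1)] U(1) assms(2) by (rule holomorphic_derivI)

lemma deriv_word_map_append:
  assumes "set v \<subseteq> {1..d}" "set w \<subseteq> {1..d}" "z \<in> U"
  shows "deriv (word_map F (v @ w)) z = deriv (word_map F v) (word_map F w z) * deriv (word_map F w) z"
  unfolding word_map_append
  by (rule DERIV_imp_deriv, rule DERIV_chain) (auto intro!: word_map_deriv word_map_U assms)

lemma deriv_word_map_nonzero:
  "set w \<subseteq> {1..d} \<Longrightarrow> z \<in> U \<Longrightarrow> deriv (word_map F w) z \<noteq> 0"
proof (induction w)
  case (Cons i w)
  have "deriv (word_map F ([i] @ w)) z
      = deriv (word_map F [i]) (word_map F w z) * deriv (word_map F w) z"
    by (rule deriv_word_map_append) (use Cons.prems in auto)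
  moreover have "deriv (F i) (word_map F w z) \<noteq> 0"
    by (rule F_deriv_nonzero) (use Cons.prems word_map_U in auto)
  ultimately show ?case using Cons by (simp add: comp_def)
qed (simp add: id_def)

lemma word_map_of_real:
  "set w \<subseteq> {1..d} \<Longrightarrow> t \<in> X \<Longrightarrow> word_map F w (complex_of_real t) = complex_of_real (\<psi> w t)"
  by (induction w) (auto simp: extension word_map_base)

lemma D_pos: "set w \<subseteq> {1..d} \<Longrightarrow> t \<in> X \<Longrightarrow> 0 < D w t"
  by (simp add: D_def deriv_word_map_nonzero base_U)

lemma D_Nil: "D [] t = 1"
  by (simp add: D_def id_def)

lemma D_snoc:
  assumes "set w \<subseteq> {1..d}" "i \<in> {1..d}" "t \<in> X"
  shows "D (w @ [i]) t = D w (gen \<Phi> i t) * D [i] t"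
  using deriv_word_map_append[of w "[i]" "complex_of_real t"] assms
  by (simp add: D_def norm_mult base_U extension)

lemma D_distortion:
  assumes "set w \<subseteq> {1..d}" "s \<in> X" "t \<in> X"
  shows "D w s \<le> C * D w t"
  unfolding D_def by (rule distortion) (use assms base_U in auto)

lemma word_map_real_deriv:
  assumes w: "set w \<subseteq> {1..d}" and t: "t \<in> interior X"
  obtains m where "(\<psi> w has_real_derivative m) (at t)" "\<bar>m\<bar> = D w t"
proof -
  have tX: "t \<in> X" using t interior_subset by blast
  let ?z = "deriv (word_map F w) (complex_of_real t)"
  have vd: "((\<lambda>s. word_map F w (complex_of_real s)) has_vector_derivative ?z) (at t)"
    using word_map_deriv[OF w base_U[OF tX]] by (rule has_vector_derivative_real_field)
  have eq: "word_map F w (complex_of_real s) = complex_of_real (\<psi> w s)" if "s \<in> interior X" for s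
    using that interior_subset word_map_of_real[OF w] by blast
  have re: "(\<psi> w has_real_derivative Re ?z) (at t)"
    by (rule has_field_derivative_transform_within_open[OF has_field_derivative_Re[OF vd] open_interior t])
      (simp add: eq)
  have "((\<lambda>s. 0) has_real_derivative Im ?z) (at t)"
    by (rule has_field_derivative_transform_within_open[OF has_field_derivative_Im[OF vd] open_interior t])
      (simp add: eq)
  then have "Im ?z = 0"
    using DERIV_unique DERIV_const by blast
  then have "\<bar>Re ?z\<bar> = D w t" by (simp add: D_def cmod_def)
  with re show ?thesis by (rule that)
qed

lemma word_map_mean_value:
  assumes w: "set w \<subseteq> {1..d}" and st: "s \<in> interior X" "t \<in> interior X"
  obtains \<xi> where "\<xi> \<in> X" "\<bar>\<psi> w s - \<psi> w t\<bar> = D w \<xi> * \<bar>s - t\<bar>"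
proof -
  have conv: "convex (interior X)"
    using base(3) by (intro convex_interior) (simp add: is_interval_connected_1[symmetric] is_interval_convex_1[symmetric])
  have "\<exists>\<xi>\<in>X. \<bar>\<psi> w s - \<psi> w t\<bar> = D w \<xi> * \<bar>s - t\<bar>"
    if "s < t" "s \<in> interior X" "t \<in> interior X" for s t
  proof -
    have "\<exists>m. (\<psi> w has_real_derivative m) (at r) \<and> \<bar>m\<bar> = D w r" if "r \<in> interior X" for r
      using word_map_real_deriv[OF w that] by blast
    then obtain m where m: "\<And>r. r \<in> interior X \<Longrightarrow> (\<psi> w has_real_derivative m r) (at r) \<and> \<bar>m r\<bar> = D w r"
      by metis
    have "{s..t} \<subseteq> interior X"
      using conv that by (meson atLeastAtMost_iff is_interval_1 is_interval_convex_1 subsetI)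
    then have "\<exists>z>s. z < t \<and> \<psi> w t - \<psi> w s = (t - s) * m z"
      using that m by (intro MVT2) auto
    then obtain z where z: "s < z" "z < t" "\<psi> w t - \<psi> w s = (t - s) * m z" by blast
    then have "z \<in> interior X" using \<open>{s..t} \<subseteq> interior X\<close> by auto
    moreover have "\<bar>\<psi> w s - \<psi> w t\<bar> = \<bar>m z\<bar> * \<bar>s - t\<bar>"
      using z(3) by (metis abs_minus_commute abs_mult mult.commute)
    ultimately show ?thesis
      using m[of z] interior_subset[of X] by auto
  qed
  from this[of s t] this[of t s] st show ?thesis
  proof (cases s t rule: linorder_cases)
    case equal
    then show ?thesis using that[of s] st(1) interior_subset[of X] by auto
  qed (use that in \<open>auto simp: abs_minus_commute\<close>)
qed

lemma geom_potential_eq: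
  assumes x: "x \<in> shift_space d"
  shows "geom_potential \<Phi> x = ln (D [x 0] (\<pi> (shift x)))"
proof -
  have "set [x 0] \<subseteq> {1..d}" using x by (simp add: shift_space_def)
  then obtain m where "(\<psi> [x 0] has_real_derivative m) (at (\<pi> (shift x)))"
      "\<bar>m\<bar> = D [x 0] (\<pi> (shift x))"
    using word_map_real_deriv coding_interior[OF shift_in_shift_space[OF x]] by metis
  then show ?thesis by (simp add: geom_potential_def DERIV_imp_deriv)
qed

text \<open>Bounded distortion bounds \<open>\<psi>\<^sub>w'\<close> on \<open>U\<close> by \<open>C \<bar>\<psi>\<^sub>w'(t)\<bar>\<close>, so Cauchy's estimate on a
  disc of fixed radius around the base bounds \<open>\<psi>\<^sub>w''\<close> by a fixed multiple of \<open>\<bar>\<psi>\<^sub>w'(t)\<bar>\<close>.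
  The resulting Lipschitz constant of \<open>log \<bar>\<psi>\<^sub>w'\<bar>\<close> does not depend on the word.\<close>
lemma D_Lipschitz:
  obtains M where "0 \<le> M" "\<And>w s t. set w \<subseteq> {1..d} \<Longrightarrow> s \<in> X \<Longrightarrow> t \<in> X \<Longrightarrow>
      ln (D w s) \<le> ln (D w t) + M * \<bar>s - t\<bar>"
proof -
  let ?X = "complex_of_real ` X"
  have cX: "compact ?X" by (intro compact_continuous_image continuous_intros base(2))
  obtain r where r: "r > 0" "(\<Union>z\<in>?X. cball z r) \<subseteq> U"
    using compact_subset_open_imp_cball_epsilon_subset[OF cX U] by blast
  have convX: "convex ?X"
    using base(3) by (intro convex_linear_image bounded_linear.linear bounded_linear_of_real)
      (simp add: is_interval_connected_1[symmetric] is_interval_convex_1[symmetric])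
  show ?thesis
  proof
    show "0 \<le> C / r" using r(1) distortion(1) by simp
    fix w s t assume w: "set w \<subseteq> {1..d}" and s: "s \<in> X" and t: "t \<in> X"
    define f where "f = deriv (word_map F w)"
    have hol: "f holomorphic_on U"
      unfolding f_def by (rule holomorphic_deriv[OF word_map_holomorphic[OF w] U(1)])
    have f': "norm (deriv f z) \<le> C * D w t / r" if z: "z \<in> ?X" for z
    proof -
      have cb: "cball z r \<subseteq> U" using r z by blast
      have "norm ((deriv ^^ 1) f z) \<le> fact 1 * (C * D w t) / r ^ 1"
      proof (rule Cauchy_inequality)
        show "f holomorphic_on ball z r"
          using hol cb ball_subset_cball holomorphic_on_subset by blast
        show "continuous_on (cball z r) f"
          using hol cb holomorphic_on_imp_continuous_on continuous_on_subset by blast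
        fix y assume "norm (z - y) = r"
        then have "y \<in> U" using cb by (auto simp: dist_norm)
        then show "norm (f y) \<le> C * D w t"
          unfolding f_def D_def by (intro distortion(2) w base_U t)
      qed (rule r(1))
      then show ?thesis by simp
    qed
    have "norm (f (complex_of_real s) - f (complex_of_real t))
        \<le> C * D w t / r * norm (complex_of_real s - complex_of_real t)"
    proof (rule field_differentiable_bound[OF convX])
      fix z assume "z \<in> ?X"
      then show "norm (deriv f z) \<le> C * D w t / r" by (rule f')
      have "z \<in> U" using \<open>z \<in> ?X\<close> U(2) by (rule rev_subsetD)
      then show "(f has_field_derivative deriv f z) (at z within ?X)"
        by (rule has_field_derivative_at_within[OF holomorphic_derivI[OF hol U(1)]])
    qed (use s t in auto)
    also have "norm (complex_of_real s - complex_of_real t) = \<bar>s - t\<bar>"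
      by (simp add: norm_of_real flip: of_real_diff)
    finally have "D w s \<le> D w t * (1 + C / r * \<bar>s - t\<bar>)"
      using norm_triangle_ineq2[of "f (complex_of_real s)" "f (complex_of_real t)"]
      unfolding D_def f_def by (simp add: algebra_simps)
    also have "\<dots> \<le> D w t * exp (C / r * \<bar>s - t\<bar>)"
      using D_pos[OF w t] by (intro mult_left_mono exp_ge_add_one_self) simp
    finally have "ln (D w s) \<le> ln (D w t * exp (C / r * \<bar>s - t\<bar>))"
      using D_pos[OF w s] D_pos[OF w t] by simp
    also have "\<dots> = ln (D w t) + C / r * \<bar>s - t\<bar>"
      using D_pos[OF w t] by (simp add: ln_mult)
    finally show "ln (D w s) \<le> ln (D w t) + C / r * \<bar>s - t\<bar>" .
  qed
qed

end


section \<open>The geometric potential of an essentially affine system\<close>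

lemma continuous_on_shift_spaceI:
  fixes f :: "(nat \<Rightarrow> nat) \<Rightarrow> real"
  assumes "\<And>x \<epsilon>. x \<in> shift_space d \<Longrightarrow> 0 < \<epsilon> \<Longrightarrow>
      \<exists>n. \<forall>y\<in>shift_space d. (\<forall>k<n. y k = x k) \<longrightarrow> \<bar>f y - f x\<bar> < \<epsilon>"
  shows "continuous_on (shift_space d) f"
  unfolding continuous_on
proof (intro ballI tendstoI)
  fix x \<epsilon> assume "x \<in> shift_space d" "(0 :: real) < \<epsilon>"
  then obtain n where "\<forall>y\<in>shift_space d. (\<forall>k<n. y k = x k) \<longrightarrow> \<bar>f y - f x\<bar> < \<epsilon>"
    using assms by blast
  then show "\<forall>\<^sub>F y in at x within shift_space d. dist (f y) (f x) < \<epsilon>"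
    unfolding eventually_at_topological
    by (intro exI[of _ "{y. \<forall>k<n. y k = x k}"]) (auto simp: open_prefix_set dist_real_def)
qed

context conformal_ifs
begin

lemma birkhoff_geom_potential:
  assumes x: "x \<in> shift_space d"
  shows "birkhoff_sum n (geom_potential \<Phi>) x = ln (D (map x [0..<n]) (\<pi> ((shift ^^ n) x)))"
proof (induction n)
  case 0
  then show ?case by (simp add: birkhoff_sum_def D_Nil)
next
  case (Suc n)
  let ?y = "(shift ^^ n) x" and ?w = "map x [0..<n]"
  have y: "?y \<in> shift_space d" "shift ?y \<in> shift_space d"
    using x shift_funpow_in_shift_space shift_in_shift_space by blast+
  have i: "x n \<in> {1..d}" "?y 0 = x n" using x by (simp_all add: shift_space_def shift_funpow)
  have w: "set ?w \<subseteq> {1..d}" using prefix_in_words[OF x] by (simp add: words_def)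
  have "D (?w @ [x n]) (\<pi> (shift ?y)) = D ?w (\<pi> ?y) * D [x n] (\<pi> (shift ?y))"
    using D_snoc[OF w i(1) coding_in_base[OF y(2)]] coding_step[OF y(1)] i(2) by simp
  moreover have "0 < D ?w (\<pi> ?y)" "0 < D [x n] (\<pi> (shift ?y))"
    using D_pos[OF w coding_in_base[OF y(1)]] D_pos[OF _ coding_in_base[OF y(2)]] i(1) by auto
  ultimately have "ln (D (?w @ [x n]) (\<pi> (shift ?y))) = ln (D ?w (\<pi> ?y)) + geom_potential \<Phi> ?y"
    using geom_potential_eq[OF y(1)] i(2) by (simp add: ln_mult)
  then show ?case
    unfolding birkhoff_sum_Suc Suc by simp
qed

lemma coding_close:
  assumes "x \<in> shift_space d" "y \<in> shift_space d" "\<forall>k<n. y k = x k"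
  shows "\<bar>\<pi> x - \<pi> y\<bar> \<le> c ^ n * diameter X"
proof -
  have eq: "map y [0..<n] = map x [0..<n]" using assms(3) by simp
  have in_X: "\<pi> ((shift ^^ n) x) \<in> X" "\<pi> ((shift ^^ n) y) \<in> X"
    using assms(1,2) by (auto intro: coding_in_base shift_funpow_in_shift_space)
  have "\<bar>\<pi> x - \<pi> y\<bar> \<le> c ^ n * \<bar>\<pi> ((shift ^^ n) x) - \<pi> ((shift ^^ n) y)\<bar>"
    using word_map_contraction[OF _ in_X, of "map x [0..<n]"] prefix_in_words[OF assms(1), of n]
      coding_prefix[OF assms(1), of n] coding_prefix[OF assms(2), of n] eq
    by (simp add: words_def)
  also have "\<bar>\<pi> ((shift ^^ n) x) - \<pi> ((shift ^^ n) y)\<bar> \<le> diameter X"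
    using diameter_bounded_bound[OF compact_imp_bounded[OF base(2)] in_X] by (simp add: dist_real_def)
  finally show ?thesis using contr(1) by (simp add: mult_left_mono)
qed

text \<open>A Livsic theorem.  The function \<open>E x = sup\<^sub>w (log \<bar>\<psi>\<^sub>w'(\<pi> x)\<bar> - \<theta>\<^sub>w)\<close> is the supremum of the
  Birkhoff sums of \<open>g x = I\<^sub>\<Phi> x - \<theta>(x\<^sub>1)\<close> along all finite pasts \<open>w\<close> of \<open>x\<close>, where
  \<open>\<theta>\<^sub>w\<close> is the sum of \<open>\<theta>\<close> over the letters of \<open>w\<close>.  A past of \<open>x\<close> followed by
  \<open>x\<^sub>1\<close> is a past of \<open>\<sigma> x\<close>, so \<open>r = E \<circ> \<sigma> - E - g\<close> is nonnegative.  It is continuous, because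
  the functions under the supremum are equi-Lipschitz, and its Birkhoff sums are bounded.  If it
  were positive somewhere, it would be bounded below along the orbit of a nearby periodic point at
  a positive frequency, and these sums would diverge.  Hence \<open>r = 0\<close> and \<open>- E\<close> is the
  transfer function.\<close>
lemma cohomologous_first_letter:
  fixes \<theta> :: "nat \<Rightarrow> real"
  assumes K: "\<And>w t. set w \<subseteq> {1..d} \<Longrightarrow> t \<in> X \<Longrightarrow> \<bar>ln (D w t) - sum_list (map \<theta> w)\<bar> \<le> K"
  obtains e where "continuous_on (shift_space d) e"
    "\<And>x. x \<in> shift_space d \<Longrightarrow> \<bar>e x\<bar> \<le> K"
    "\<And>x. x \<in> shift_space d \<Longrightarrow> geom_potential \<Phi> x = \<theta> (x 0) + e x - e (shift x)"
proof -
  obtain M where M: "0 \<le> M" "\<And>w s t. set w \<subseteq> {1..d} \<Longrightarrow> s \<in> X \<Longrightarrow> t \<in> X \<Longrightarrow>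
      ln (D w s) \<le> ln (D w t) + M * \<bar>s - t\<bar>"
    using D_Lipschitz by blast
  define W where "W = {w. set w \<subseteq> {1..d}}"
  define v where "v w x = ln (D w (\<pi> x)) - sum_list (map \<theta> w)" for w x
  define E where "E x = (SUP w\<in>W. v w x)" for x
  define g where "g x = geom_potential \<Phi> x - \<theta> (x 0)" for x
  define r where "r x = E (shift x) - E x - g x" for x
  have Nil: "[] \<in> W" by (simp add: W_def)
  have v_K: "\<bar>v w x\<bar> \<le> K" if "x \<in> shift_space d" "w \<in> W" for w x
    unfolding v_def using that by (intro K coding_in_base) (auto simp: W_def)
  have bdd: "bdd_above ((\<lambda>w. v w x) ` W)" if "x \<in> shift_space d" for x
    using v_K[OF that] by (intro bdd_aboveI2[of _ _ K]) (simp add: abs_le_iff)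
  have E_lower: "v w x \<le> E x" if "x \<in> shift_space d" "w \<in> W" for w x
    unfolding E_def using that bdd by (intro cSUP_upper)
  have E_bounds: "0 \<le> E x" "E x \<le> K" if "x \<in> shift_space d" for x
  proof -
    show "0 \<le> E x" using E_lower[OF that Nil] by (simp add: v_def D_Nil)
    show "E x \<le> K" unfolding E_def
      using v_K[OF that] Nil by (intro cSUP_least) (auto simp: abs_le_iff)
  qed
  have E_Lip1: "E x \<le> E y + M * \<bar>\<pi> x - \<pi> y\<bar>" if xy: "x \<in> shift_space d" "y \<in> shift_space d" for x y
    unfolding E_def[of x]
  proof (rule cSUP_least)
    fix w assume w: "w \<in> W"
    have "v w x \<le> v w y + M * \<bar>\<pi> x - \<pi> y\<bar>"
      using M(2)[of w "\<pi> x" "\<pi> y"] w xy by (simp add: v_def W_def coding_in_base)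
    also have "v w y \<le> E y" by (rule E_lower[OF xy(2) w])
    finally show "v w x \<le> E y + M * \<bar>\<pi> x - \<pi> y\<bar>" by simp
  qed (use Nil in auto)
  have E_Lip: "\<bar>E x - E y\<bar> \<le> M * \<bar>\<pi> x - \<pi> y\<bar>" if xy: "x \<in> shift_space d" "y \<in> shift_space d" for x y
    using E_Lip1[OF xy] E_Lip1[OF xy(2,1)] by (simp add: abs_le_iff abs_minus_commute)
  define \<Delta> where "\<Delta> = M * diameter X"
  have "0 \<le> diameter X" by (rule diameter_ge_0[OF compact_imp_bounded[OF base(2)]])
  then have \<Delta>: "0 \<le> \<Delta>" using M(1) by (simp add: \<Delta>_def)
  have close: "M * \<bar>\<pi> x - \<pi> y\<bar> \<le> \<Delta> * c ^ n"
    if "x \<in> shift_space d" "y \<in> shift_space d" "\<forall>k<n. y k = x k" for x y n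
    using mult_left_mono[OF coding_close[OF that] M(1)] by (simp add: \<Delta>_def mult_ac)
  have E_close: "\<bar>E x - E y\<bar> \<le> \<Delta> * c ^ n"
    if "x \<in> shift_space d" "y \<in> shift_space d" "\<forall>k<n. y k = x k" for x y n
    using E_Lip[OF that(1,2)] close[OF that] by linarith
  have small: "\<exists>n. \<Delta> * c ^ n < \<epsilon>" if "0 < \<epsilon>" for \<epsilon>
  proof -
    have "(\<lambda>n. \<Delta> * c ^ n) \<longlonglongrightarrow> \<Delta> * 0"
      by (intro tendsto_mult_left LIMSEQ_realpow_zero contr)
    then have "\<forall>\<^sub>F n in sequentially. \<Delta> * c ^ n < \<epsilon>"
      using that by (simp add: order_tendstoD(2))
    then show ?thesis by (auto simp: eventually_sequentially)
  qed
  have g_close: "\<bar>g x - g y\<bar> \<le> \<Delta> * c ^ n"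
    if xy: "x \<in> shift_space d" "y \<in> shift_space d" and eq: "\<forall>k<Suc n. y k = x k" for x y n
  proof -
    have 0: "y 0 = x 0" "x 0 \<in> {1..d}" using eq xy(1) by (auto simp: shift_space_def)
    note s = xy[THEN shift_in_shift_space]
    have "\<bar>g x - g y\<bar> = \<bar>ln (D [x 0] (\<pi> (shift x))) - ln (D [x 0] (\<pi> (shift y)))\<bar>"
      by (simp add: g_def geom_potential_eq xy 0)
    also have "\<dots> \<le> M * \<bar>\<pi> (shift x) - \<pi> (shift y)\<bar>"
      using M(2)[of "[x 0]" "\<pi> (shift x)" "\<pi> (shift y)"] M(2)[of "[x 0]" "\<pi> (shift y)" "\<pi> (shift x)"]
        0 s by (simp add: coding_in_base abs_le_iff abs_minus_commute)
    also have "\<dots> \<le> \<Delta> * c ^ n"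
      using eq by (intro close s) (simp add: shift_def)
    finally show ?thesis .
  qed
  have r_close: "\<bar>r x - r y\<bar> \<le> 3 * (\<Delta> * c ^ n)"
    if xy: "x \<in> shift_space d" "y \<in> shift_space d" and eq: "\<forall>k<Suc n. y k = x k" for x y n
  proof -
    have "\<bar>E x - E y\<bar> \<le> \<Delta> * c ^ n" using eq by (intro E_close xy) simp
    moreover have "\<bar>E (shift x) - E (shift y)\<bar> \<le> \<Delta> * c ^ n"
      using eq by (intro E_close xy[THEN shift_in_shift_space]) (simp add: shift_def)
    ultimately show ?thesis
      using g_close[OF that] unfolding r_def by linarith
  qed
  have r_nonneg: "0 \<le> r x" if x: "x \<in> shift_space d" for x
  proof -
    note s = shift_in_shift_space[OF x]
    have 0: "x 0 \<in> {1..d}" using x by (simp add: shift_space_def)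
    have "E x \<le> E (shift x) - g x"
      unfolding E_def[of x]
    proof (rule cSUP_least)
      fix w assume w: "w \<in> W"
      have "D (w @ [x 0]) (\<pi> (shift x)) = D w (\<pi> x) * D [x 0] (\<pi> (shift x))"
        using D_snoc[of w "x 0" "\<pi> (shift x)"] w 0 coding_in_base[OF s] coding_step[OF x]
        by (simp add: W_def)
      moreover have "0 < D w (\<pi> x)" "0 < D [x 0] (\<pi> (shift x))"
        using w 0 s x by (auto simp: W_def intro!: D_pos coding_in_base)
      ultimately have "v (w @ [x 0]) (shift x) = v w x + g x"
        by (simp add: v_def g_def geom_potential_eq[OF x] ln_mult)
      moreover have "w @ [x 0] \<in> W" using w 0 by (simp add: W_def)
      ultimately show "v w x \<le> E (shift x) - g x"
        using E_lower[OF s, of "w @ [x 0]"] by linarith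
    qed (use Nil in auto)
    then show ?thesis by (simp add: r_def)
  qed
  have r_sum: "(\<Sum>k<n. r ((shift ^^ k) x)) \<le> 2 * K" if x: "x \<in> shift_space d" for x n
  proof -
    have "(\<Sum>k<n. r ((shift ^^ k) x))
        = E ((shift ^^ n) x) - E x - (birkhoff_sum n (geom_potential \<Phi>) x
            - sum_list (map \<theta> (map x [0..<n])))"
      by (induction n) (simp_all add: r_def g_def birkhoff_sum_def shift_funpow)
    also have "\<dots> = E ((shift ^^ n) x) - E x - v (map x [0..<n]) ((shift ^^ n) x)"
      by (simp add: v_def birkhoff_geom_potential[OF x])
    also have "\<dots> \<le> K - 0 + K"
    proof -
      have "map x [0..<n] \<in> W" using prefix_in_words[OF x] by (simp add: W_def words_def)
      from v_K[OF shift_funpow_in_shift_space[OF x] this]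
      show ?thesis
        using E_bounds[OF x] E_bounds[OF shift_funpow_in_shift_space[OF x]]
        by (smt (verit))
    qed
    finally show ?thesis by simp
  qed
  have r_0: "r x = 0" if x: "x \<in> shift_space d" for x
  proof (rule ccontr)
    assume "r x \<noteq> 0"
    then have rx: "0 < r x" using r_nonneg[OF x] by simp
    obtain n where n: "\<Delta> * c ^ n < r x / 6" using small[of "r x / 6"] rx by auto
    \<comment> \<open>the periodic point that shares its first \<open>n + 1\<close> letters with \<open>x\<close>\<close>
    define p where "p k = x (k mod Suc n)" for k
    have p: "p \<in> shift_space d" using x by (simp add: shift_space_def p_def)
    have rp: "r x / 2 \<le> r p"
      using r_close[OF x p, of n] n by (simp add: p_def abs_le_iff)
    have per: "(shift ^^ (m * Suc n)) p = p" for m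
      by (rule ext) (simp only: shift_funpow p_def mod_mult_self1)
    have "m * (r x / 2) \<le> (\<Sum>k<m * Suc n. r ((shift ^^ k) p))" for m :: nat
    proof (induction m)
      case (Suc m)
      have "real (Suc m) * (r x / 2) \<le> (\<Sum>k<m * Suc n. r ((shift ^^ k) p)) + r ((shift ^^ (m * Suc n)) p)"
        using Suc rp unfolding per by (simp add: algebra_simps)
      also have "\<dots> = (\<Sum>k<Suc (m * Suc n). r ((shift ^^ k) p))" by simp
      also have "\<dots> \<le> (\<Sum>k<Suc m * Suc n. r ((shift ^^ k) p))"
        by (rule sum_mono2) (auto intro: r_nonneg shift_funpow_in_shift_space p)
      finally show ?case .
    qed simp
    then have "m * (r x / 2) \<le> 2 * K" for m :: nat
      using r_sum[OF p] order_trans by blast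
    moreover obtain m :: nat where "2 * K / (r x / 2) < m"
      using reals_Archimedean2 by blast
    then have "2 * K < m * (r x / 2)"
      using rx by (simp only: pos_divide_less_eq half_gt_zero)
    ultimately show False by (metis not_le)
  qed
  show ?thesis
  proof
    show "continuous_on (shift_space d) (\<lambda>x. - E x)"
    proof (rule continuous_on_shift_spaceI)
      fix x \<epsilon> assume x: "x \<in> shift_space d" and "(0 :: real) < \<epsilon>"
      then obtain n where "\<Delta> * c ^ n < \<epsilon>" using small by blast
      then show "\<exists>n. \<forall>y\<in>shift_space d. (\<forall>k<n. y k = x k) \<longrightarrow> \<bar>- E y - - E x\<bar> < \<epsilon>"
        using E_close[OF x] by (intro exI[of _ n]) (auto intro: le_less_trans)
    qed
    fix x assume x: "x \<in> shift_space d"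
    show "\<bar>- E x\<bar> \<le> K" using E_bounds[OF x] by simp
    show "geom_potential \<Phi> x = \<theta> (x 0) + - E x - - E (shift x)"
      using r_0[OF x] by (simp add: r_def g_def)
  qed
qed

text \<open>If \<open>x\<close> and \<open>y\<close> agree on \<open>w\<close>, their codings are the images under \<open>\<psi>\<^sub>w\<close> of the codings
  of the tails, whose distance is at most the diameter of the base and, if the next letters differ,
  at least the separation constant.  The mean value theorem supplies the factor
  \<open>\<bar>\<psi>\<^sub>w'\<bar>\<close>, which is comparable to \<open>exp \<theta>\<^sub>w\<close>.\<close>
lemma coding_distance:
  fixes \<theta> :: "nat \<Rightarrow> real"
  assumes K: "\<And>w t. set w \<subseteq> {1..d} \<Longrightarrow> t \<in> X \<Longrightarrow> \<bar>ln (D w t) - sum_list (map \<theta> w)\<bar> \<le> K"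
  obtains A where "0 < A"
    "\<And>x y n. x \<in> shift_space d \<Longrightarrow> y \<in> shift_space d \<Longrightarrow> \<forall>k<n. x k = y k \<Longrightarrow>
      \<bar>\<pi> x - \<pi> y\<bar> \<le> A * exp (sum_list (map \<theta> (map x [0..<n])))"
    "\<And>x y n. x \<in> shift_space d \<Longrightarrow> y \<in> shift_space d \<Longrightarrow> \<forall>k<n. x k = y k \<Longrightarrow> x n \<noteq> y n \<Longrightarrow>
      exp (sum_list (map \<theta> (map x [0..<n]))) \<le> A * \<bar>\<pi> x - \<pi> y\<bar>"
proof -
  obtain \<delta> where \<delta>: "\<delta> > 0"
    "\<And>x y. x \<in> shift_space d \<Longrightarrow> y \<in> shift_space d \<Longrightarrow> x 0 \<noteq> y 0 \<Longrightarrow> \<delta> \<le> \<bar>\<pi> x - \<pi> y\<bar>"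
    using coding_separated by blast
  have diam: "0 \<le> diameter X" by (rule diameter_ge_0[OF compact_imp_bounded[OF base(2)]])
  define A where "A = exp K * (diameter X + 1 / \<delta>)"
  have main: "\<exists>\<eta>. \<bar>\<pi> x - \<pi> y\<bar> = \<eta> * \<bar>\<pi> ((shift ^^ n) x) - \<pi> ((shift ^^ n) y)\<bar> \<and>
      \<eta> \<le> exp K * exp (sum_list (map \<theta> (map x [0..<n]))) \<and>
      exp (sum_list (map \<theta> (map x [0..<n]))) \<le> exp K * \<eta>"
    if x: "x \<in> shift_space d" and y: "y \<in> shift_space d" and eq: "\<forall>k<n. x k = y k" for x y n
  proof -
    let ?w = "map x [0..<n]"
    have w: "set ?w \<subseteq> {1..d}" using prefix_in_words[OF x] by (simp add: words_def)
    have eq': "map y [0..<n] = ?w" using eq by simp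
    obtain \<xi> where \<xi>: "\<xi> \<in> X" "\<bar>\<psi> ?w (\<pi> ((shift ^^ n) x)) - \<psi> ?w (\<pi> ((shift ^^ n) y))\<bar>
        = D ?w \<xi> * \<bar>\<pi> ((shift ^^ n) x) - \<pi> ((shift ^^ n) y)\<bar>"
      using word_map_mean_value[OF w] coding_interior shift_funpow_in_shift_space x y by metis
    have "\<bar>ln (D ?w \<xi>) - sum_list (map \<theta> ?w)\<bar> \<le> K" by (rule K[OF w \<xi>(1)])
    then have "exp (ln (D ?w \<xi>)) \<le> exp (K + sum_list (map \<theta> ?w))"
        "exp (sum_list (map \<theta> ?w)) \<le> exp (K + ln (D ?w \<xi>))"
      unfolding exp_le_cancel_iff by linarith+
    then have "D ?w \<xi> \<le> exp K * exp (sum_list (map \<theta> ?w))"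
        "exp (sum_list (map \<theta> ?w)) \<le> exp K * D ?w \<xi>"
      unfolding exp_add exp_ln[OF D_pos[OF w \<xi>(1)]] .
    then show ?thesis
      using \<xi>(2) coding_prefix[OF x, of n] coding_prefix[OF y, of n] eq'
      by (intro exI[of _ "D ?w \<xi>"]) simp
  qed
  show ?thesis
  proof
    show "0 < A" using diam \<delta>(1) by (simp add: A_def add_nonneg_pos)
    fix x y n assume x: "x \<in> shift_space d" and y: "y \<in> shift_space d" and eq: "\<forall>k<n. x k = y k"
    let ?S = "sum_list (map \<theta> (map x [0..<n]))"
    and ?r = "\<bar>\<pi> ((shift ^^ n) x) - \<pi> ((shift ^^ n) y)\<bar>"
    obtain \<eta> where \<eta>: "\<bar>\<pi> x - \<pi> y\<bar> = \<eta> * ?r" "\<eta> \<le> exp K * exp ?S" "exp ?S \<le> exp K * \<eta>"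
      using main[OF x y eq] by blast
    have "?r \<le> diameter X"
      using diameter_bounded_bound[OF compact_imp_bounded[OF base(2)], of "\<pi> ((shift ^^ n) x)" "\<pi> ((shift ^^ n) y)"]
        coding_in_base shift_funpow_in_shift_space x y by (simp add: dist_real_def)
    also have "\<dots> \<le> diameter X + 1 / \<delta>" using \<delta>(1) by simp
    finally have r1: "?r \<le> diameter X + 1 / \<delta>" .
    have "\<eta> * ?r \<le> (exp K * exp ?S) * (diameter X + 1 / \<delta>)"
      by (rule mult_mono[OF \<eta>(2) r1]) auto
    then show "\<bar>\<pi> x - \<pi> y\<bar> \<le> A * exp ?S"
      using \<eta>(1) by (simp add: A_def mult_ac)
    assume "x n \<noteq> y n"
    then have "\<delta> \<le> ?r"
      by (intro \<delta>(2) shift_funpow_in_shift_space x y) (simp add: shift_funpow)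
    then have "1 \<le> 1 / \<delta> * ?r" using \<delta>(1) by (simp add: field_simps)
    also have "\<dots> \<le> (diameter X + 1 / \<delta>) * ?r" using diam by (intro mult_right_mono) auto
    finally have r2: "1 \<le> (diameter X + 1 / \<delta>) * ?r" .
    have nonneg: "0 \<le> exp K * \<eta>" using \<eta>(3) exp_ge_zero order_trans by blast
    have "exp ?S \<le> (exp K * \<eta>) * 1" using \<eta>(3) by simp
    also have "\<dots> \<le> (exp K * \<eta>) * ((diameter X + 1 / \<delta>) * ?r)"
      by (rule mult_left_mono[OF r2 nonneg])
    also have "\<dots> = A * \<bar>\<pi> x - \<pi> y\<bar>" unfolding \<eta>(1) A_def by (simp only: mult_ac)
    finally show "exp ?S \<le> A * \<bar>\<pi> x - \<pi> y\<bar>" .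
  qed
qed

end

text \<open>The system behaves like an affine one with contraction ratios \<open>exp (\<theta> i)\<close>: its potential is
  cohomologous to \<open>\<theta>\<close> of the first letter by a bounded continuous transfer function, and two
  sequences that part after \<open>n\<close> letters are coded at a distance comparable to the product of the
  first \<open>n\<close> ratios.\<close>
definition log_ratios :: "nat \<Rightarrow> ifs \<Rightarrow> (nat \<Rightarrow> real) \<Rightarrow> bool" where
  "log_ratios d \<Phi> \<theta> \<longleftrightarrow> (\<forall>i\<in>{1..d}. \<theta> i < 0) \<and>
     (\<exists>e K. continuous_on (shift_space d) e \<and> (\<forall>x\<in>shift_space d. \<bar>e x\<bar> \<le> K) \<and>
        (\<forall>x\<in>shift_space d. geom_potential \<Phi> x = \<theta> (x 0) + e x - e (shift x))) \<and>
     (\<exists>A>0. \<forall>x\<in>shift_space d. \<forall>y\<in>shift_space d. \<forall>n. (\<forall>k<n. x k = y k) \<longrightarrow>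
        \<bar>coding \<Phi> x - coding \<Phi> y\<bar> \<le> A * exp (sum_list (map \<theta> (map x [0..<n]))) \<and>
        (x n \<noteq> y n \<longrightarrow>
          exp (sum_list (map \<theta> (map x [0..<n]))) \<le> A * \<bar>coding \<Phi> x - coding \<Phi> y\<bar>))"

lemma conformal_systems_gen:
  assumes \<Phi>: "\<Phi> \<in> conformal_systems d" and i: "i \<in> {1..d}"
  shows "gen \<Phi> i ` base \<Phi> \<subseteq> interior (base \<Phi>)" "inj_on (gen \<Phi> i) (base \<Phi>)"
    "\<exists>c<1. c-lipschitz_on (base \<Phi>) (gen \<Phi> i)"
proof -
  have "\<forall>i\<in>{1..d}. gen \<Phi> i ` base \<Phi> \<subseteq> interior (base \<Phi>) \<and> inj_on (gen \<Phi> i) (base \<Phi>) \<and>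
        (\<exists>c<1. c-lipschitz_on (base \<Phi>) (gen \<Phi> i))"
    using \<Phi> unfolding conformal_systems_def mem_Collect_eq by (elim conjE)
  from bspec[OF this i] show "gen \<Phi> i ` base \<Phi> \<subseteq> interior (base \<Phi>)"
    "inj_on (gen \<Phi> i) (base \<Phi>)" "\<exists>c<1. c-lipschitz_on (base \<Phi>) (gen \<Phi> i)"
    by - (elim conjE, assumption)+
qed

lemma conformal_systems_imp_conformal_ifs:
  assumes \<Phi>: "\<Phi> \<in> conformal_systems d" and d: "2 \<le> d"
  obtains U F c C where "conformal_ifs d \<Phi> U F c C"
proof -
  note parts = \<Phi>[unfolded conformal_systems_def mem_Collect_eq]
  have base: "base \<Phi> \<noteq> {}" "compact (base \<Phi>)" "connected (base \<Phi>)"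
    using parts by - (elim conjE, assumption)+
  have osc: "\<forall>i\<in>{1..d}. \<forall>j\<in>{1..d}. i \<noteq> j \<longrightarrow>
        gen \<Phi> i ` interior (base \<Phi>) \<inter> gen \<Phi> j ` interior (base \<Phi>) = {}"
    using parts by (elim conjE)
  have "\<exists>U F. open U \<and> connected U \<and> complex_of_real ` base \<Phi> \<subseteq> U \<and>
        (\<forall>i\<in>{1..d}. conformal_on (F i) U \<and> F i ` U \<subseteq> U \<and>
           (\<forall>x\<in>base \<Phi>. F i (complex_of_real x) = complex_of_real (gen \<Phi> i x))) \<and>
        (\<exists>C\<ge>1. \<forall>n. \<forall>w\<in>words d n. \<forall>x\<in>U. \<forall>y\<in>U.
           norm (deriv (word_map F w) y) \<le> C * norm (deriv (word_map F w) x))"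
    using parts by (elim conjE)
  then obtain U F C where U: "open U" "complex_of_real ` base \<Phi> \<subseteq> U"
    and F: "\<forall>i\<in>{1..d}. conformal_on (F i) U \<and> F i ` U \<subseteq> U \<and>
           (\<forall>x\<in>base \<Phi>. F i (complex_of_real x) = complex_of_real (gen \<Phi> i x))"
    and C: "1 \<le> C" "\<forall>n. \<forall>w\<in>words d n. \<forall>x\<in>U. \<forall>y\<in>U.
        norm (deriv (word_map F w) y) \<le> C * norm (deriv (word_map F w) x)"
    by (elim exE conjE) (rule that; assumption)
  obtain k where k: "\<And>i. i \<in> {1..d} \<Longrightarrow> k i < 1 \<and> (k i)-lipschitz_on (base \<Phi>) (gen \<Phi> i)"
    using conformal_systems_gen(3)[OF \<Phi>] by metis
  define c where "c = Max (k ` {1..d})"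
  have kc: "k i \<le> c" if "i \<in> {1..d}" for i
    using that unfolding c_def by (intro Max_ge) auto
  have "c \<in> k ` {1..d}" unfolding c_def using d by (intro Max_in) auto
  then obtain i where i: "i \<in> {1..d}" "c = k i" by blast
  then have c: "0 \<le> c" "c < 1" using k[of i] lipschitz_on_nonneg by auto
  have "conformal_ifs d \<Phi> U F c C"
  proof
    show "norm (deriv (word_map F w) y) \<le> C * norm (deriv (word_map F w) x)"
      if "set w \<subseteq> {1..d}" "x \<in> U" "y \<in> U" for w x y
      using C(2)[rule_format, of w "length w"] that by (simp add: words_def)
    show "c-lipschitz_on (base \<Phi>) (gen \<Phi> i)" if "i \<in> {1..d}" for i
      using k[OF that] kc[OF that] lipschitz_on_le by blast
    show "gen \<Phi> i ` base \<Phi> \<subseteq> interior (base \<Phi>)" if "i \<in> {1..d}" for i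
      by (rule conformal_systems_gen(1)[OF \<Phi> that])
    show "gen \<Phi> i ` interior (base \<Phi>) \<inter> gen \<Phi> j ` interior (base \<Phi>) = {}"
      if "i \<in> {1..d}" "j \<in> {1..d}" "i \<noteq> j" for i j
      using osc that by simp
    show "conformal_on (F i) U" "F i ` U \<subseteq> U" if "i \<in> {1..d}" for i
      using bspec[OF F that] by simp_all
    show "F i (complex_of_real x) = complex_of_real (gen \<Phi> i x)"
      if "i \<in> {1..d}" "x \<in> base \<Phi>" for i x
      using bspec[OF F that(1)] that(2) by simp
  qed (fact d base U C c)+
  then show ?thesis by (rule that)
qed

text \<open>Compare the images of two fixed points \<open>s\<^sub>1, s\<^sub>2\<close> of the affine limit set under \<open>\<phi>\<^sub>w\<close>: their
  distance is exactly \<open>exp \<theta>\<^sub>w \<bar>s\<^sub>1 - s\<^sub>2\<bar>\<close>.  The conjugacy \<open>h\<close> carries them to \<open>\<psi>\<^sub>w (h s\<^sub>1)\<close> and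
  \<open>\<psi>\<^sub>w (h s\<^sub>2)\<close>, whose distance is \<open>\<bar>\<psi>\<^sub>w'(\<xi>)\<bar> \<bar>h s\<^sub>1 - h s\<^sub>2\<bar>\<close>, and changes distances by at most
  its Lipschitz constants.  Bounded distortion replaces \<open>\<xi>\<close> by an arbitrary point.\<close>
lemma essentially_affine_comparison:
  assumes \<Psi>: "\<Psi> \<in> essentially_affine_systems d" and sys: "conformal_ifs d \<Psi> U F c C"
  obtains \<theta> K where "\<And>i. i \<in> {1..d} \<Longrightarrow> \<theta> i < 0"
    "\<And>w t. set w \<subseteq> {1..d} \<Longrightarrow> t \<in> base \<Psi> \<Longrightarrow>
      \<bar>ln (conformal_ifs.D F w t) - sum_list (map \<theta> w)\<bar> \<le> K"
proof -
  interpret \<Psi>: conformal_ifs d \<Psi> U F c C by (rule sys)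
  obtain \<Phi> h where \<Phi>: "\<Phi> \<in> affine_systems d"
    and h: "bi_lipschitz_bijection h (limit_set d \<Phi>) (limit_set d \<Psi>)"
    and conj: "\<And>i y. i \<in> {1..d} \<Longrightarrow> y \<in> limit_set d \<Psi> \<Longrightarrow>
        gen \<Psi> i y = h (gen \<Phi> i (inv_into (limit_set d \<Phi>) h y))"
    using \<Psi> unfolding essentially_affine_systems_def by blast
  let ?A = "limit_set d \<Phi>" and ?B = "limit_set d \<Psi>"
  obtain L L' where bij: "bij_betw h ?A ?B" and L: "L-lipschitz_on ?A h"
    and L': "L'-lipschitz_on ?B (inv_into ?A h)"
    using h unfolding bi_lipschitz_bijection_def by blast
  obtain U1 F1 c1 C1 where "conformal_ifs d \<Phi> U1 F1 c1 C1"
    using \<Phi> \<Psi>.d conformal_systems_imp_conformal_ifs unfolding affine_systems_def by blast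
  then interpret \<Phi>: conformal_ifs d \<Phi> U1 F1 c1 C1 .
  obtain a b where ab: "\<And>i x. i \<in> {1..d} \<Longrightarrow> x \<in> base \<Phi> \<Longrightarrow> gen \<Phi> i x = a i * x + b i"
  proof -
    have "\<forall>i\<in>{1..d}. \<exists>a b. \<forall>x\<in>base \<Phi>. gen \<Phi> i x = a * x + b"
      using \<Phi> unfolding affine_systems_def by blast
    then show ?thesis using that by metis
  qed
  define y1 y2 where "y1 = coding \<Psi> (\<lambda>_. 1)" and "y2 = coding \<Psi> (\<lambda>_. 2)"
  have seq: "(\<lambda>_. 1) \<in> shift_space d" "(\<lambda>_. 2) \<in> shift_space d"
    using \<Psi>.d by (auto simp: shift_space_def)
  have y: "y1 \<in> ?B" "y2 \<in> ?B" "y1 \<in> interior (base \<Psi>)" "y2 \<in> interior (base \<Psi>)"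
    unfolding y1_def y2_def using seq \<Psi>.coding_in_limit_set \<Psi>.coding_interior by blast+
  have "y1 \<noteq> y2"
  proof -
    obtain \<delta> where "\<delta> > 0" "\<And>x y. x \<in> shift_space d \<Longrightarrow> y \<in> shift_space d \<Longrightarrow> x 0 \<noteq> y 0 \<Longrightarrow>
        \<delta> \<le> \<bar>coding \<Psi> x - coding \<Psi> y\<bar>"
      using \<Psi>.coding_separated by blast
    with seq show ?thesis unfolding y1_def y2_def by fastforce
  qed
  define s1 s2 where "s1 = inv_into ?A h y1" and "s2 = inv_into ?A h y2"
  have s: "s1 \<in> ?A" "s2 \<in> ?A" "h s1 = y1" "h s2 = y2"
    using y bij by (auto simp: s1_def s2_def bij_betw_def inv_into_into f_inv_into_f)
  have "s1 \<noteq> s2" using s \<open>y1 \<noteq> y2\<close> by auto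
  have sX: "s1 \<in> base \<Phi>" "s2 \<in> base \<Phi>" using s \<Phi>.limit_set_subset_base by blast+
  define p q where "p = \<bar>y1 - y2\<bar>" and "q = \<bar>s1 - s2\<bar>"
  have pq: "0 < p" "0 < q" using \<open>y1 \<noteq> y2\<close> \<open>s1 \<noteq> s2\<close> by (auto simp: p_def q_def)
  have a: "a i \<noteq> 0" "\<bar>a i\<bar> < 1" if i: "i \<in> {1..d}" for i
  proof -
    have "inj_on (gen \<Phi> i) (base \<Phi>)"
      using \<Phi> conformal_systems_gen(2)[OF _ i] by (simp add: affine_systems_def)
    then have "gen \<Phi> i s1 \<noteq> gen \<Phi> i s2" using sX \<open>s1 \<noteq> s2\<close> by (auto dest: inj_onD)
    then show "a i \<noteq> 0" using ab[OF i] sX by auto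
    have "\<bar>gen \<Phi> i s1 - gen \<Phi> i s2\<bar> \<le> c1 * q"
      using lipschitz_onD[OF \<Phi>.contr(3)[OF i] sX] by (simp add: dist_real_def q_def)
    moreover have "gen \<Phi> i s1 - gen \<Phi> i s2 = a i * (s1 - s2)"
      using ab[OF i] sX by (simp add: algebra_simps)
    ultimately have "\<bar>a i\<bar> * q \<le> c1 * q" by (simp add: abs_mult q_def)
    then show "\<bar>a i\<bar> < 1" using pq \<Phi>.contr(2) by simp
  qed
  define \<theta> where "\<theta> i = ln \<bar>a i\<bar>" for i
  have \<Phi>_dist: "\<bar>word_map (gen \<Phi>) w s1 - word_map (gen \<Phi>) w s2\<bar> = exp (sum_list (map \<theta> w)) * q"
    if "set w \<subseteq> {1..d}" for w
    using that
  proof (induction w)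
    case (Cons i w)
    then have i: "i \<in> {1..d}" and w: "set w \<subseteq> {1..d}" by auto
    have "word_map (gen \<Phi>) (i # w) s1 - word_map (gen \<Phi>) (i # w) s2
        = a i * (word_map (gen \<Phi>) w s1 - word_map (gen \<Phi>) w s2)"
      using ab[OF i] \<Phi>.word_map_base[OF w] sX by (simp add: algebra_simps)
    then show ?case using Cons.IH[OF w] a(1)[OF i] by (simp add: abs_mult exp_add \<theta>_def)
  qed (simp add: q_def)
  have conj_word: "word_map (gen \<Psi>) w (h r) = h (word_map (gen \<Phi>) w r)"
    if "set w \<subseteq> {1..d}" "r \<in> ?A" for w r
    using that
  proof (induction w)
    case (Cons i w)
    then have i: "i \<in> {1..d}" and w: "set w \<subseteq> {1..d}" by auto
    have m: "word_map (gen \<Phi>) w r \<in> ?A" by (rule \<Phi>.word_map_limit_set[OF w Cons.prems(2)])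
    then have "h (word_map (gen \<Phi>) w r) \<in> ?B" "inv_into ?A h (h (word_map (gen \<Phi>) w r)) = word_map (gen \<Phi>) w r"
      using bij by (auto simp: bij_betw_def)
    then show ?case using conj[OF i] Cons.IH[OF w Cons.prems(2)] by simp
  qed simp
  define k1 k2 where "k1 = L' * (C * p) / q" and "k2 = C * (L * q) / p"
  have comp: "exp (sum_list (map \<theta> w)) \<le> k1 * \<Psi>.D w t" "\<Psi>.D w t \<le> k2 * exp (sum_list (map \<theta> w))"
    if w: "set w \<subseteq> {1..d}" and t: "t \<in> base \<Psi>" for w t
  proof -
    let ?E = "exp (sum_list (map \<theta> w))"
    define f1 f2 where "f1 = word_map (gen \<Phi>) w s1" and "f2 = word_map (gen \<Phi>) w s2"
    have f: "f1 \<in> ?A" "f2 \<in> ?A" unfolding f1_def f2_def using \<Phi>.word_map_limit_set[OF w] s by auto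
    then have hf: "h f1 \<in> ?B" "h f2 \<in> ?B" "inv_into ?A h (h f1) = f1" "inv_into ?A h (h f2) = f2"
      using bij by (auto simp: bij_betw_def)
    obtain \<xi> where \<xi>: "\<xi> \<in> base \<Psi>"
      "\<bar>word_map (gen \<Psi>) w y1 - word_map (gen \<Psi>) w y2\<bar> = \<Psi>.D w \<xi> * p"
      using \<Psi>.word_map_mean_value[OF w y(3,4)] unfolding p_def by blast
    have h\<xi>: "\<bar>h f1 - h f2\<bar> = \<Psi>.D w \<xi> * p"
      using \<xi>(2) conj_word[OF w s(1)] conj_word[OF w s(2)] s(3,4) by (simp add: f1_def f2_def)
    have f\<Phi>: "\<bar>f1 - f2\<bar> = ?E * q" using \<Phi>_dist[OF w] by (simp add: f1_def f2_def)
    have "?E * q \<le> L' * (\<Psi>.D w \<xi> * p)"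
      using lipschitz_onD[OF L' hf(1,2)] hf h\<xi> f\<Phi> by (simp add: dist_real_def)
    also have "\<dots> \<le> L' * (C * \<Psi>.D w t * p)"
      using lipschitz_on_nonneg[OF L'] pq \<Psi>.D_distortion[OF w \<xi>(1) t]
      by (intro mult_left_mono mult_right_mono) auto
    finally show "?E \<le> k1 * \<Psi>.D w t" using pq by (simp add: k1_def field_simps)
    have "\<Psi>.D w \<xi> * p \<le> L * (?E * q)"
      using lipschitz_onD[OF L f] h\<xi> f\<Phi> by (simp add: dist_real_def)
    then have "\<Psi>.D w \<xi> \<le> L * (?E * q) / p" using pq by (simp add: field_simps)
    then have "C * \<Psi>.D w \<xi> \<le> C * (L * (?E * q) / p)"
      using \<Psi>.distortion(1) by (intro mult_left_mono) auto
    with \<Psi>.D_distortion[OF w t \<xi>(1)] show "\<Psi>.D w t \<le> k2 * ?E"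
      by (simp add: k2_def mult_ac)
  qed
  define k where "k = max 1 (max k1 k2)"
  have k: "1 \<le> k" "k1 \<le> k" "k2 \<le> k" by (auto simp: k_def)
  show ?thesis
  proof (rule that[of \<theta> "ln k"])
    show "\<theta> i < 0" if "i \<in> {1..d}" for i using a[OF that] by (simp add: \<theta>_def)
    fix w t assume w: "set w \<subseteq> {1..d}" and t: "t \<in> base \<Psi>"
    let ?E = "exp (sum_list (map \<theta> w))"
    have D: "0 < \<Psi>.D w t" by (rule \<Psi>.D_pos[OF w t])
    have "?E \<le> k * \<Psi>.D w t"
      using comp(1)[OF w t] mult_right_mono[OF k(2) less_imp_le[OF D]] by (rule order_trans)
    then have "ln ?E \<le> ln (k * \<Psi>.D w t)" using D k(1) by (subst ln_le_cancel_iff) auto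
    then have 1: "sum_list (map \<theta> w) \<le> ln k + ln (\<Psi>.D w t)" using D k(1) by (simp add: ln_mult)
    have "\<Psi>.D w t \<le> k * ?E"
      using comp(2)[OF w t] mult_right_mono[OF k(3) exp_ge_zero] by (rule order_trans)
    then have "ln (\<Psi>.D w t) \<le> ln (k * ?E)" using D k(1) by (subst ln_le_cancel_iff) auto
    then have "ln (\<Psi>.D w t) \<le> ln k + sum_list (map \<theta> w)" using k(1) by (simp add: ln_mult)
    with 1 show "\<bar>ln (\<Psi>.D w t) - sum_list (map \<theta> w)\<bar> \<le> ln k" by (simp add: abs_le_iff)
  qed
qed

lemma essentially_affine_log_ratios:
  assumes \<Psi>: "\<Psi> \<in> essentially_affine_systems d" and d: "2 \<le> d"
  obtains \<theta> where "log_ratios d \<Psi> \<theta>"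
proof -
  have "\<Psi> \<in> conformal_systems d" using \<Psi> by (simp add: essentially_affine_systems_def)
  then obtain U F c C where sys: "conformal_ifs d \<Psi> U F c C"
    using conformal_systems_imp_conformal_ifs d by blast
  interpret conformal_ifs d \<Psi> U F c C by (rule sys)
  obtain \<theta> K where neg: "\<And>i. i \<in> {1..d} \<Longrightarrow> \<theta> i < 0"
    and K: "\<And>w t. set w \<subseteq> {1..d} \<Longrightarrow> t \<in> base \<Psi> \<Longrightarrow> \<bar>ln (D w t) - sum_list (map \<theta> w)\<bar> \<le> K"
    using essentially_affine_comparison[OF \<Psi> sys] by blast
  obtain e where e: "continuous_on (shift_space d) e"
    "\<And>x. x \<in> shift_space d \<Longrightarrow> \<bar>e x\<bar> \<le> K"
    "\<And>x. x \<in> shift_space d \<Longrightarrow> geom_potential \<Psi> x = \<theta> (x 0) + e x - e (shift x)"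
    using cohomologous_first_letter[OF K] by blast
  obtain A where A: "0 < A"
    "\<And>x y n. x \<in> shift_space d \<Longrightarrow> y \<in> shift_space d \<Longrightarrow> \<forall>k<n. x k = y k \<Longrightarrow>
      \<bar>coding \<Psi> x - coding \<Psi> y\<bar> \<le> A * exp (sum_list (map \<theta> (map x [0..<n])))"
    "\<And>x y n. x \<in> shift_space d \<Longrightarrow> y \<in> shift_space d \<Longrightarrow> \<forall>k<n. x k = y k \<Longrightarrow> x n \<noteq> y n \<Longrightarrow>
      exp (sum_list (map \<theta> (map x [0..<n]))) \<le> A * \<bar>coding \<Psi> x - coding \<Psi> y\<bar>"
    using coding_distance[OF K] by blast
  have "log_ratios d \<Psi> \<theta>"
    unfolding log_ratios_def
  proof (intro conjI)
    show "\<exists>e K. continuous_on (shift_space d) e \<and> (\<forall>x\<in>shift_space d. \<bar>e x\<bar> \<le> K) \<and>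
        (\<forall>x\<in>shift_space d. geom_potential \<Psi> x = \<theta> (x 0) + e x - e (shift x))"
      using e by (intro exI[of _ e] exI[of _ K]) auto
    show "\<exists>A>0. \<forall>x\<in>shift_space d. \<forall>y\<in>shift_space d. \<forall>n. (\<forall>k<n. x k = y k) \<longrightarrow>
        \<bar>coding \<Psi> x - coding \<Psi> y\<bar> \<le> A * exp (sum_list (map \<theta> (map x [0..<n]))) \<and>
        (x n \<noteq> y n \<longrightarrow>
          exp (sum_list (map \<theta> (map x [0..<n]))) \<le> A * \<bar>coding \<Psi> x - coding \<Psi> y\<bar>)"
      by (rule exI[of _ A], intro conjI A(1) ballI allI impI; (rule A(2) A(3); assumption))
  qed (use neg in auto)
  then show ?thesis by (rule that)
qed


section \<open>Thermodynamics of the first-letter potential\<close>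

lemma log_ratios_birkhoff:
  assumes "log_ratios d \<Phi> \<theta>"
  obtains K where "0 \<le> K" "\<And>x n. x \<in> shift_space d \<Longrightarrow>
    \<bar>birkhoff_sum n (geom_potential \<Phi>) x - sum_list (map \<theta> (map x [0..<n]))\<bar> \<le> K"
proof -
  obtain e K where e: "\<And>x. x \<in> shift_space d \<Longrightarrow> \<bar>e x\<bar> \<le> K"
    "\<And>x. x \<in> shift_space d \<Longrightarrow> geom_potential \<Phi> x = \<theta> (x 0) + e x - e (shift x)"
    using assms unfolding log_ratios_def by blast
  have sum: "birkhoff_sum n (geom_potential \<Phi>) x
      = sum_list (map \<theta> (map x [0..<n])) + e x - e ((shift ^^ n) x)"
    if x: "x \<in> shift_space d" for x n
  proof (induction n)
    case (Suc n)
    have "((shift ^^ n) x) 0 = x n" by (simp add: shift_funpow)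
    then show ?case
      using e(2)[OF shift_funpow_in_shift_space[OF x], of n] Suc by (simp add: birkhoff_sum_Suc)
  qed (simp add: birkhoff_sum_def)
  have K: "\<bar>birkhoff_sum n (geom_potential \<Phi>) x - sum_list (map \<theta> (map x [0..<n]))\<bar> \<le> 2 * \<bar>K\<bar>"
    if x: "x \<in> shift_space d" for x n
    using e(1)[OF x] e(1)[OF shift_funpow_in_shift_space[OF x, of n]] unfolding sum[OF x] by linarith
  show ?thesis by (rule that[OF _ K]) auto
qed

lemma birkhoff_sum_affine:
  fixes a b :: real
  shows "birkhoff_sum n (\<lambda>x. a * f x + b) x = a * birkhoff_sum n f x + real n * b"
  by (simp add: birkhoff_sum_def sum.distrib sum_distrib_left)

lemma sum_list_affine:
  fixes \<theta> :: "'a \<Rightarrow> real" and a b :: real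
  shows "sum_list (map (\<lambda>i. a * \<theta> i + b) w) = a * sum_list (map \<theta> w) + real (length w) * b"
  by (induction w) (simp_all add: algebra_simps)

text \<open>A bounded transfer function changes each Birkhoff sum, and so each supremum over a cylinder,
  by a bounded amount.  The partition sums thus agree up to a constant factor with those of the
  first-letter potential, which are the powers of \<open>\<Sum>\<^sub>i exp (u \<theta>\<^sub>i)\<close>.\<close>
lemma geom_pressure_eq:
  assumes \<theta>: "log_ratios d \<Phi> \<theta>" and d: "1 \<le> d"
  shows "geom_pressure d \<Phi> u = ln (\<Sum>i\<in>{1..d}. exp (u * \<theta> i))"
proof -
  obtain K where K: "0 \<le> K" "\<And>x n. x \<in> shift_space d \<Longrightarrow>
      \<bar>birkhoff_sum n (geom_potential \<Phi>) x - sum_list (map \<theta> (map x [0..<n]))\<bar> \<le> K"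
    using log_ratios_birkhoff[OF \<theta>] by blast
  define f where "f x = u * geom_potential \<Phi> x" for x
  define Z where "Z = (\<Sum>i\<in>{1..d}. exp (u * \<theta> i))"
  define B where "B = \<bar>u\<bar> * K"
  have Z: "0 < Z" unfolding Z_def using d by (intro sum_pos) auto
  define S where "S n = (\<Sum>w\<in>words d n. exp (SUP x\<in>cylinder d w. birkhoff_sum n f x))" for n
  have f: "\<bar>birkhoff_sum n f x - u * sum_list (map \<theta> w)\<bar> \<le> B"
    if "w \<in> words d n" "x \<in> cylinder d w" for w x n
  proof -
    have x: "x \<in> shift_space d" "map x [0..<n] = w"
      using that by (auto simp: mem_cylinder_iff words_def)
    have "birkhoff_sum n f x - u * sum_list (map \<theta> w)
        = u * (birkhoff_sum n (geom_potential \<Phi>) x - sum_list (map \<theta> w))"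
      by (simp add: birkhoff_sum_def f_def sum_distrib_left algebra_simps)
    then show ?thesis
      using K(2)[OF x(1), of n] unfolding x(2) B_def by (simp add: abs_mult mult_left_mono)
  qed
  have sup: "u * sum_list (map \<theta> w) - B \<le> (SUP x\<in>cylinder d w. birkhoff_sum n f x)"
      "(SUP x\<in>cylinder d w. birkhoff_sum n f x) \<le> u * sum_list (map \<theta> w) + B"
    if w: "w \<in> words d n" for w n
  proof -
    have ne: "cylinder d w \<noteq> {}" by (rule cylinder_nonempty[OF w d])
    have up: "birkhoff_sum n f x \<le> u * sum_list (map \<theta> w) + B" if "x \<in> cylinder d w" for x
      using f[OF w that] by linarith
    then show "(SUP x\<in>cylinder d w. birkhoff_sum n f x) \<le> u * sum_list (map \<theta> w) + B"
      by (rule cSUP_least[OF ne])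
    obtain x where x: "x \<in> cylinder d w" using ne by blast
    have "u * sum_list (map \<theta> w) - B \<le> birkhoff_sum n f x" using f[OF w x] by linarith
    also have "\<dots> \<le> (SUP x\<in>cylinder d w. birkhoff_sum n f x)"
      using up by (intro cSUP_upper[OF x] bdd_aboveI2)
    finally show "u * sum_list (map \<theta> w) - B \<le> (SUP x\<in>cylinder d w. birkhoff_sum n f x)" .
  qed
  have Zn: "(\<Sum>w\<in>words d n. exp (u * sum_list (map \<theta> w))) = Z ^ n" for n
  proof -
    have "u * sum_list (map \<theta> w) = sum_list (map (\<lambda>i. u * \<theta> i) w)" for w
      by (simp add: sum_list_const_mult)
    then show ?thesis unfolding Z_def by (simp only: sum_exp_words)
  qed
  have S: "exp (- B) * Z ^ n \<le> S n" "S n \<le> exp B * Z ^ n" for n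
  proof -
    have "exp (- B) * Z ^ n = (\<Sum>w\<in>words d n. exp (u * sum_list (map \<theta> w) - B))"
      by (simp add: Zn[symmetric] sum_distrib_left exp_add[symmetric])
    also have "\<dots> \<le> S n" unfolding S_def using sup(1) by (intro sum_mono) auto
    finally show "exp (- B) * Z ^ n \<le> S n" .
    have "S n \<le> (\<Sum>w\<in>words d n. exp (u * sum_list (map \<theta> w) + B))"
      unfolding S_def using sup(2) by (intro sum_mono) auto
    also have "\<dots> = exp B * Z ^ n"
      by (simp add: Zn[symmetric] sum_distrib_left exp_add[symmetric] add.commute)
    finally show "S n \<le> exp B * Z ^ n" .
  qed
  have lnS: "\<bar>ln (S n) - n * ln Z\<bar> \<le> B" for n
  proof -
    have pos: "0 < exp (- B) * Z ^ n" using Z by simp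
    then have Sn: "0 < S n" using S(1) by (rule less_le_trans)
    have "ln (exp (- B) * Z ^ n) \<le> ln (S n)" by (rule ln_mono[OF S(1) pos])
    moreover have "ln (S n) \<le> ln (exp B * Z ^ n)" by (rule ln_mono[OF S(2) Sn])
    ultimately show ?thesis using Z by (simp add: ln_mult ln_realpow abs_le_iff)
  qed
  have "(\<lambda>n. 1 / real n * ln (S n) - ln Z) \<longlonglongrightarrow> 0"
  proof (rule Lim_null_comparison)
    show "\<forall>\<^sub>F n in sequentially. norm (1 / real n * ln (S n) - ln Z) \<le> B / real n"
      using eventually_gt_at_top[of 0]
    proof eventually_elim
      case (elim n)
      have "1 / real n * ln (S n) - ln Z = (ln (S n) - n * ln Z) / n"
        using elim by (simp add: field_simps)
      then show ?case using lnS[of n] elim by (simp add: divide_right_mono)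
    qed
    show "(\<lambda>n. B / real n) \<longlonglongrightarrow> 0" by (rule lim_const_over_n)
  qed
  then have "(\<lambda>n. 1 / real n * ln (S n)) \<longlonglongrightarrow> ln Z"
    by (simp add: LIM_zero_iff)
  then show ?thesis
    unfolding geom_pressure_def pressure_def f_def[symmetric] S_def[symmetric] Z_def[symmetric]
    by (rule limI)
qed

lemma pressure_normalization:
  assumes "log_ratios d \<Phi> \<theta>" "1 \<le> d"
  shows "(\<Sum>i\<in>{1..d}. exp (u * \<theta> i - geom_pressure d \<Phi> u)) = 1"
proof -
  have "0 < (\<Sum>i\<in>{1..d}. exp (u * \<theta> i))" using assms(2) by (intro sum_pos) auto
  then show ?thesis
    by (simp add: geom_pressure_eq[OF assms] exp_diff sum_divide_distrib[symmetric])
qed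

text \<open>The definite description in \<open>gibbs_measure\<close> is legitimate: the Bernoulli measure has the
  Gibbs property because the transfer function is bounded, and every invariant measure whose
  cylinder masses are bounded by a multiple of the Bernoulli masses equals it.\<close>
lemma gibbs_measure_bernoulli:
  assumes \<theta>: "log_ratios d \<Phi> \<theta>" and d: "1 \<le> d"
  shows "sets (gibbs_measure d \<Phi> u) = sets (restrict_space borel (shift_space d))"
    and "prob_space (gibbs_measure d \<Phi> u)"
    and "\<And>w. set w \<subseteq> {1..d} \<Longrightarrow> measure (gibbs_measure d \<Phi> u) (cylinder d w)
        = exp (sum_list (map (\<lambda>i. u * \<theta> i - geom_pressure d \<Phi> u) w))"
proof -
  define P where "P = geom_pressure d \<Phi> u"
  define \<phi> where "\<phi> i = u * \<theta> i - P" for i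
  have one: "(\<Sum>i\<in>{1..d}. exp (\<phi> i)) = 1"
    unfolding \<phi>_def P_def by (rule pressure_normalization[OF \<theta> d])
  let ?f = "\<lambda>x. u * geom_potential \<Phi> x - P"
  obtain K where K: "0 \<le> K" "\<And>x n. x \<in> shift_space d \<Longrightarrow>
      \<bar>birkhoff_sum n (geom_potential \<Phi>) x - sum_list (map \<theta> (map x [0..<n]))\<bar> \<le> K"
    using log_ratios_birkhoff[OF \<theta>] by blast
  define B where "B = \<bar>u\<bar> * K"
  have B: "0 \<le> B" using K(1) by (simp add: B_def)
  have f: "\<bar>birkhoff_sum n ?f x - sum_list (map \<phi> w)\<bar> \<le> B"
    if "w \<in> words d n" "x \<in> cylinder d w" for w x n
  proof -
    have x: "x \<in> shift_space d" "map x [0..<n] = w" and w: "length w = n"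
      using that by (auto simp: mem_cylinder_iff words_def)
    have "birkhoff_sum n ?f x = u * birkhoff_sum n (geom_potential \<Phi>) x + real n * (- P)"
      using birkhoff_sum_affine[where a = u and b = "- P"] by simp
    moreover have "sum_list (map \<phi> w) = u * sum_list (map \<theta> w) + real n * (- P)"
      unfolding \<phi>_def using sum_list_affine[where a = u and b = "- P" and \<theta> = \<theta> and w = w] w by simp
    ultimately have "birkhoff_sum n ?f x - sum_list (map \<phi> w)
        = u * (birkhoff_sum n (geom_potential \<Phi>) x - sum_list (map \<theta> w))"
      by (simp only: algebra_simps)
    then show ?thesis
      using K(2)[OF x(1), of n] unfolding x(2) B_def by (simp add: abs_mult mult_left_mono)
  qed
  obtain \<mu>0 where \<mu>0: "sets \<mu>0 = sets (restrict_space borel (shift_space d))" "prob_space \<mu>0"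
    "\<And>w. set w \<subseteq> {1..d} \<Longrightarrow> measure \<mu>0 (cylinder d w) = exp (sum_list (map \<phi> w))"
    using bernoulli_measure_exists[OF one] by blast
  have gibbs: "invariant_gibbs d ?f \<mu>0"
    unfolding invariant_gibbs_def
  proof (intro conjI ballI \<mu>0(1,2))
    show "emeasure \<mu>0 (shift -` A \<inter> space \<mu>0) = emeasure \<mu>0 A" if "A \<in> sets \<mu>0" for A
      by (rule shift_invariant_of_cylinders[OF one \<mu>0 that])
    show "\<exists>C\<ge>1. \<forall>n. \<forall>w\<in>words d n. \<forall>x\<in>cylinder d w.
        exp (birkhoff_sum n ?f x) / C \<le> measure \<mu>0 (cylinder d w) \<and>
        measure \<mu>0 (cylinder d w) \<le> C * exp (birkhoff_sum n ?f x)"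
    proof (intro exI[of _ "exp B"] conjI allI ballI)
      fix n w x assume wx: "w \<in> words d n" "x \<in> cylinder d w"
      then have m: "measure \<mu>0 (cylinder d w) = exp (sum_list (map \<phi> w))"
        by (intro \<mu>0(3)) (simp add: words_def)
      show "exp (birkhoff_sum n ?f x) / exp B \<le> measure \<mu>0 (cylinder d w)"
        unfolding m exp_diff[symmetric] exp_le_cancel_iff using f[OF wx] by linarith
      show "measure \<mu>0 (cylinder d w) \<le> exp B * exp (birkhoff_sum n ?f x)"
        unfolding m exp_add[symmetric] exp_le_cancel_iff using f[OF wx] by linarith
    qed (simp add: B)
  qed
  have unique: "\<mu> = \<mu>0" if g: "invariant_gibbs d ?f \<mu>" for \<mu>
  proof -
    have s: "sets \<mu> = sets (restrict_space borel (shift_space d))" and p: "prob_space \<mu>"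
      and inv: "\<And>A. A \<in> sets \<mu> \<Longrightarrow> emeasure \<mu> (shift -` A \<inter> space \<mu>) = emeasure \<mu> A"
      using g unfolding invariant_gibbs_def by auto
    obtain C where C: "1 \<le> C" "\<And>n w x. w \<in> words d n \<Longrightarrow> x \<in> cylinder d w \<Longrightarrow>
        measure \<mu> (cylinder d w) \<le> C * exp (birkhoff_sum n ?f x)"
      using g unfolding invariant_gibbs_def by blast
    have bound: "measure \<mu> (cylinder d w) \<le> (C * exp B) * exp (sum_list (map \<phi> w))"
      if "set w \<subseteq> {1..d}" for w
    proof -
      have w: "w \<in> words d (length w)" using that by (simp add: words_def)
      obtain x where x: "x \<in> cylinder d w" using cylinder_nonempty[OF w d] by blast
      have "exp (birkhoff_sum (length w) ?f x) \<le> exp (B + sum_list (map \<phi> w))"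
        unfolding exp_le_cancel_iff using f[OF w x] by linarith
      then have "C * exp (birkhoff_sum (length w) ?f x) \<le> C * exp (B + sum_list (map \<phi> w))"
        using C(1) by (intro mult_left_mono) auto
      with C(2)[OF w x] show ?thesis by (simp add: exp_add mult.assoc)
    qed
    show ?thesis
    proof (rule measure_eqI_cylinders[OF s \<mu>0(1)])
      show "finite_measure \<mu>" "finite_measure \<mu>0"
        using p \<mu>0(2) by (auto intro: prob_space.finite_measure)
      show "measure \<mu> (cylinder d w) = measure \<mu>0 (cylinder d w)" if "set w \<subseteq> {1..d}" for w
        using invariant_bounded_measure_eq_weights[OF one s p inv bound that] \<mu>0(3)[OF that] by simp
    qed
  qed
  have "gibbs_measure d \<Phi> u = \<mu>0"
    unfolding gibbs_measure_def P_def[symmetric]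
    by (rule the_equality[where P = "invariant_gibbs d ?f", OF gibbs unique])
  then show "sets (gibbs_measure d \<Phi> u) = sets (restrict_space borel (shift_space d))"
    "prob_space (gibbs_measure d \<Phi> u)"
    "\<And>w. set w \<subseteq> {1..d} \<Longrightarrow> measure (gibbs_measure d \<Phi> u) (cylinder d w)
        = exp (sum_list (map (\<lambda>i. u * \<theta> i - geom_pressure d \<Phi> u) w))"
    using \<mu>0 unfolding \<phi>_def P_def by simp_all
qed

lemma gibbs_measures_equal_iff:
  assumes \<theta>: "log_ratios d \<Phi> \<theta>" and \<eta>: "log_ratios d \<Psi> \<eta>" and d: "1 \<le> d"
  shows "gibbs_measure d \<Phi> u = gibbs_measure d \<Psi> v \<longleftrightarrow>
    (\<forall>i\<in>{1..d}. u * \<theta> i - geom_pressure d \<Phi> u = v * \<eta> i - geom_pressure d \<Psi> v)"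
proof
  note m = gibbs_measure_bernoulli(3)[OF \<theta> d, of _ u] gibbs_measure_bernoulli(3)[OF \<eta> d, of _ v]
  show "\<forall>i\<in>{1..d}. u * \<theta> i - geom_pressure d \<Phi> u = v * \<eta> i - geom_pressure d \<Psi> v"
    if eq: "gibbs_measure d \<Phi> u = gibbs_measure d \<Psi> v"
  proof
    fix i assume "i \<in> {1..d}"
    then show "u * \<theta> i - geom_pressure d \<Phi> u = v * \<eta> i - geom_pressure d \<Psi> v"
      using m(1)[of "[i]"] m(2)[of "[i]"] eq by simp
  qed
  assume eq: "\<forall>i\<in>{1..d}. u * \<theta> i - geom_pressure d \<Phi> u = v * \<eta> i - geom_pressure d \<Psi> v"
  show "gibbs_measure d \<Phi> u = gibbs_measure d \<Psi> v"
  proof (rule measure_eqI_cylinders[where d = d])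
    fix w assume w: "set w \<subseteq> {1..d}"
    then have "map (\<lambda>i. u * \<theta> i - geom_pressure d \<Phi> u) w = map (\<lambda>i. v * \<eta> i - geom_pressure d \<Psi> v) w"
      using eq by (intro map_cong) (auto simp: subset_iff)
    then show "measure (gibbs_measure d \<Phi> u) (cylinder d w) = measure (gibbs_measure d \<Psi> v) (cylinder d w)"
      using m[OF w] by (simp only:)
  qed (use gibbs_measure_bernoulli(1,2)[OF \<theta> d] gibbs_measure_bernoulli(1,2)[OF \<eta> d]
    in \<open>auto intro: prob_space.finite_measure\<close>)
qed

text \<open>A coboundary vanishes on constant sequences, which recovers the values of a first-letter
  function.\<close>
lemma cohomologous_iff:
  assumes \<theta>: "log_ratios d \<Phi> \<theta>" and \<eta>: "log_ratios d \<Psi> \<eta>"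
  shows "cohomologous d (geom_potential \<Phi>) (\<lambda>x. a * geom_potential \<Psi> x + b) \<longleftrightarrow>
    (\<forall>i\<in>{1..d}. \<theta> i = a * \<eta> i + b)"
proof -
  obtain e where e: "continuous_on (shift_space d) e"
    "\<And>x. x \<in> shift_space d \<Longrightarrow> geom_potential \<Phi> x = \<theta> (x 0) + e x - e (shift x)"
    using \<theta> unfolding log_ratios_def by blast
  obtain e' where e': "continuous_on (shift_space d) e'"
    "\<And>x. x \<in> shift_space d \<Longrightarrow> geom_potential \<Psi> x = \<eta> (x 0) + e' x - e' (shift x)"
    using \<eta> unfolding log_ratios_def by blast
  show ?thesis
  proof
    assume "cohomologous d (geom_potential \<Phi>) (\<lambda>x. a * geom_potential \<Psi> x + b)"
    then obtain g where g: "\<And>x. x \<in> shift_space d \<Longrightarrow>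
        geom_potential \<Phi> x - (a * geom_potential \<Psi> x + b) = g x - g (shift x)"
      unfolding cohomologous_def by blast
    show "\<forall>i\<in>{1..d}. \<theta> i = a * \<eta> i + b"
    proof
      fix i assume "i \<in> {1..d}"
      then have x: "(\<lambda>_. i) \<in> shift_space d" by (simp add: shift_space_def)
      have "shift (\<lambda>_. i) = (\<lambda>_. i)" by (simp add: shift_def)
      then show "\<theta> i = a * \<eta> i + b" using g[OF x] e(2)[OF x] e'(2)[OF x] by simp
    qed
  next
    assume eq: "\<forall>i\<in>{1..d}. \<theta> i = a * \<eta> i + b"
    show "cohomologous d (geom_potential \<Phi>) (\<lambda>x. a * geom_potential \<Psi> x + b)"
      unfolding cohomologous_def
    proof (intro exI[of _ "\<lambda>x. e x - a * e' x"] conjI ballI)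
      show "continuous_on (shift_space d) (\<lambda>x. e x - a * e' x)"
        by (intro continuous_intros e e')
      fix x assume x: "x \<in> shift_space d"
      then have \<theta>\<eta>: "\<theta> (x 0) = a * \<eta> (x 0) + b" using eq by (simp add: shift_space_def)
      show "geom_potential \<Phi> x - (a * geom_potential \<Psi> x + b)
          = e x - a * e' x - (e (shift x) - a * e' (shift x))"
        unfolding e(2)[OF x] e'(2)[OF x] \<theta>\<eta> by (simp add: algebra_simps)
    qed
  qed
qed

subsection \<open>Permuting the generators\<close>

lemma permuted_simps [simp]:
  "base (permuted \<tau> \<Phi>) = base \<Phi>" "gen (permuted \<tau> \<Phi>) i = gen \<Phi> (\<tau> i)"
  by (simp_all add: permuted_def)

lemma word_map_permuted: "word_map (gen (permuted \<tau> \<Phi>)) w = word_map (gen \<Phi>) (map \<tau> w)"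
  by (induction w) simp_all

lemma coding_permuted: "coding (permuted \<tau> \<Phi>) x = coding \<Phi> (\<lambda>n. \<tau> (x n))"
  by (simp add: coding_def word_map_permuted comp_def)

lemma geom_potential_permuted:
  "geom_potential (permuted \<tau> \<Phi>) x = geom_potential \<Phi> (\<lambda>n. \<tau> (x n))"
  by (simp add: geom_potential_def coding_permuted shift_def)

lemma permute_in_shift_space:
  "\<tau> permutes {1..d} \<Longrightarrow> x \<in> shift_space d \<Longrightarrow> (\<lambda>n. \<tau> (x n)) \<in> shift_space d"
  using permutes_in_image[of \<tau> "{1..d}"] unfolding shift_space_def by blast

lemma log_ratios_permuted:
  assumes \<tau>: "\<tau> permutes {1..d}" and \<theta>: "log_ratios d \<Phi> \<theta>"
  shows "log_ratios d (permuted \<tau> \<Phi>) (\<theta> \<circ> \<tau>)"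
  unfolding log_ratios_def
proof (intro conjI)
  let ?t = "\<lambda>x n. \<tau> (x n)"
  have t: "?t x \<in> shift_space d" if "x \<in> shift_space d" for x
    by (rule permute_in_shift_space[OF \<tau> that])
  show "\<forall>i\<in>{1..d}. (\<theta> \<circ> \<tau>) i < 0"
  proof
    fix i assume "i \<in> {1..d}"
    then have "\<tau> i \<in> {1..d}" using permutes_in_image[OF \<tau>] by blast
    then show "(\<theta> \<circ> \<tau>) i < 0" using \<theta> unfolding log_ratios_def by simp
  qed
  obtain e K where e: "continuous_on (shift_space d) e" "\<And>x. x \<in> shift_space d \<Longrightarrow> \<bar>e x\<bar> \<le> K"
    "\<And>x. x \<in> shift_space d \<Longrightarrow> geom_potential \<Phi> x = \<theta> (x 0) + e x - e (shift x)"
    using \<theta> unfolding log_ratios_def by blast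
  have "continuous_on (shift_space d) (\<lambda>x. e (?t x))"
  proof (rule continuous_on_compose2[OF e(1)])
    show "continuous_on (shift_space d) ?t"
    proof (rule continuous_on_coordinatewise_then_product)
      fix n
      have "continuous_on (shift_space d) (\<lambda>x. x n)"
        by (rule continuous_on_subset[OF continuous_on_product_coordinates]) simp
      then show "continuous_on (shift_space d) (\<lambda>x. \<tau> (x n))"
        by (rule continuous_on_compose2[of UNIV \<tau>, rotated]) (auto intro: Topological_Spaces.continuous_on_discrete)
    qed
  qed (use t in auto)
  then show "\<exists>e K. continuous_on (shift_space d) e \<and> (\<forall>x\<in>shift_space d. \<bar>e x\<bar> \<le> K) \<and>
      (\<forall>x\<in>shift_space d. geom_potential (permuted \<tau> \<Phi>) x = (\<theta> \<circ> \<tau>) (x 0) + e x - e (shift x))"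
    using e(2)[OF t] e(3)[OF t]
    by (intro exI[of _ "\<lambda>x. e (?t x)"] exI[of _ K]) (auto simp: geom_potential_permuted shift_def)
  obtain A where A: "A > 0" "\<forall>x\<in>shift_space d. \<forall>y\<in>shift_space d. \<forall>n. (\<forall>k<n. x k = y k) \<longrightarrow>
        \<bar>coding \<Phi> x - coding \<Phi> y\<bar> \<le> A * exp (sum_list (map \<theta> (map x [0..<n]))) \<and>
        (x n \<noteq> y n \<longrightarrow>
          exp (sum_list (map \<theta> (map x [0..<n]))) \<le> A * \<bar>coding \<Phi> x - coding \<Phi> y\<bar>)"
    using \<theta> unfolding log_ratios_def by blast
  show "\<exists>A>0. \<forall>x\<in>shift_space d. \<forall>y\<in>shift_space d. \<forall>n. (\<forall>k<n. x k = y k) \<longrightarrow>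
        \<bar>coding (permuted \<tau> \<Phi>) x - coding (permuted \<tau> \<Phi>) y\<bar>
          \<le> A * exp (sum_list (map (\<theta> \<circ> \<tau>) (map x [0..<n]))) \<and>
        (x n \<noteq> y n \<longrightarrow> exp (sum_list (map (\<theta> \<circ> \<tau>) (map x [0..<n])))
          \<le> A * \<bar>coding (permuted \<tau> \<Phi>) x - coding (permuted \<tau> \<Phi>) y\<bar>)"
  proof (rule exI[of _ A], intro conjI A(1) ballI allI impI)
    fix x y n assume x: "x \<in> shift_space d" and y: "y \<in> shift_space d" and eq: "\<forall>k<n. x k = y k"
    note * = A(2)[rule_format, OF t[OF x] t[OF y], of n]
    have map: "map \<theta> (map (?t x) [0..<n]) = map (\<theta> \<circ> \<tau>) (map x [0..<n])" by simp
    show "\<bar>coding (permuted \<tau> \<Phi>) x - coding (permuted \<tau> \<Phi>) y\<bar>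
          \<le> A * exp (sum_list (map (\<theta> \<circ> \<tau>) (map x [0..<n])))"
      using * eq unfolding map coding_permuted by simp
    assume "x n \<noteq> y n"
    then have "\<tau> (x n) \<noteq> \<tau> (y n)" using permutes_inj[OF \<tau>] by (simp add: inj_eq)
    then show "exp (sum_list (map (\<theta> \<circ> \<tau>) (map x [0..<n])))
          \<le> A * \<bar>coding (permuted \<tau> \<Phi>) x - coding (permuted \<tau> \<Phi>) y\<bar>"
      using * eq unfolding map coding_permuted by simp
  qed
qed

lemma geom_pressure_permuted:
  assumes \<tau>: "\<tau> permutes {1..d}" and \<theta>: "log_ratios d \<Phi> \<theta>" and d: "1 \<le> d"
  shows "geom_pressure d (permuted \<tau> \<Phi>) = geom_pressure d \<Phi>"
  using sum.reindex_bij_betw[OF permutes_imp_bij[OF \<tau>], of "\<lambda>i. exp (_ * \<theta> i)"]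
  by (intro HOL.ext) (simp add: geom_pressure_eq[OF \<theta> d] geom_pressure_eq[OF log_ratios_permuted[OF \<tau> \<theta>] d])

lemma lyapunov_spectrum_permuted:
  assumes \<tau>: "\<tau> permutes {1..d}"
  shows "lyapunov_spectrum d (permuted \<tau> \<Phi>) \<alpha> = lyapunov_spectrum d \<Phi> \<alpha>"
proof -
  let ?t = "\<lambda>x n. \<tau> (x n)"
  have birk: "birkhoff_sum n (geom_potential (permuted \<tau> \<Phi>)) x = birkhoff_sum n (geom_potential \<Phi>) (?t x)"
    for n x by (simp add: birkhoff_sum_def geom_potential_permuted shift_funpow)
  let ?L = "\<lambda>\<Phi>. {x \<in> shift_space d. (\<lambda>n. birkhoff_sum n (geom_potential \<Phi>) x / - real n) \<longlonglongrightarrow> \<alpha>}"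
  have "?t ` ?L (permuted \<tau> \<Phi>) = ?L \<Phi>"
  proof (intro equalityI subsetI)
    fix y assume y: "y \<in> ?L \<Phi>"
    let ?x = "\<lambda>n. inv \<tau> (y n)"
    have t: "y = ?t ?x" using permutes_inverses(1)[OF \<tau>] by simp
    have "?x \<in> ?L (permuted \<tau> \<Phi>)"
      using y permute_in_shift_space[OF permutes_inv[OF \<tau>]] t by (simp add: birk)
    with t show "y \<in> ?t ` ?L (permuted \<tau> \<Phi>)" by (rule image_eqI)
  qed (auto simp: birk permute_in_shift_space[OF \<tau>])
  moreover have "coding (permuted \<tau> \<Phi>) ` A = coding \<Phi> ` ?t ` A" for A
    by (simp add: image_image coding_permuted)
  ultimately show ?thesis by (simp add: lyapunov_spectrum_def)
qed

section \<open>The pressure determines the ratios up to order\<close>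

text \<open>Equality of power sums is equality of \<open>\<Sum>\<^sub>i p(x\<^sub>i)\<close> and \<open>\<Sum>\<^sub>i p(y\<^sub>i)\<close> for every polynomial
  \<open>p\<close>.  A polynomial that vanishes at all occurring values except \<open>z\<close> counts how often
  \<open>z\<close> occurs.\<close>
lemma equal_power_sums_imp_permuted:
  fixes x y :: "'a \<Rightarrow> real"
  assumes A: "finite A" and eq: "\<And>n :: nat. (\<Sum>i\<in>A. x i ^ n) = (\<Sum>i\<in>A. y i ^ n)"
  obtains \<tau> where "\<tau> permutes A" "\<And>i. i \<in> A \<Longrightarrow> x i = y (\<tau> i)"
proof -
  have poly: "(\<Sum>i\<in>A. poly p (x i)) = (\<Sum>i\<in>A. poly p (y i))" for p
  proof -
    have "(\<Sum>i\<in>A. poly p (z i)) = (\<Sum>k\<le>degree p. coeff p k * (\<Sum>i\<in>A. z i ^ k))" for z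
      unfolding poly_altdef sum_distrib_left by (rule sum.swap)
    then show ?thesis by (simp add: eq)
  qed
  have card: "card {i \<in> A. x i = z} = card {i \<in> A. y i = z}" for z
  proof -
    define V where "V = (x ` A \<union> y ` A) - {z}"
    define p where "p = (\<Prod>t\<in>V. [:- t, 1:])"
    have V: "finite V" using A by (simp add: V_def)
    have p0: "poly p t = 0" if "t \<in> V" for t
      using that V by (simp add: p_def poly_prod prod_zero_iff)
    have pz: "poly p z \<noteq> 0"
      using V by (auto simp: p_def poly_prod prod_zero_iff V_def)
    have count: "(\<Sum>i\<in>A. poly p (f i)) = card {i \<in> A. f i = z} * poly p z"
      if "f ` A \<subseteq> V \<union> {z}" for f
    proof -
      have "(\<Sum>i\<in>A. poly p (f i)) = (\<Sum>i\<in>A. if f i = z then poly p z else 0)"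
        using that p0 by (intro sum.cong) auto
      then show ?thesis using A by (simp add: sum.If_cases Int_def)
    qed
    have "x ` A \<subseteq> V \<union> {z}" "y ` A \<subseteq> V \<union> {z}" by (auto simp: V_def)
    from poly[of p] count[OF this(1)] count[OF this(2)] pz show ?thesis by simp
  qed
  have "image_mset x (mset_set A) = image_mset y (mset_set A)"
    using A card by (intro multiset_eqI) (simp add: count_image_mset_eq_card_vimage)
  then show ?thesis
    using image_mset_eq_implies_permutes[OF A] that by metis
qed

text \<open>At \<open>s = n\<close> the identity of pressures equates the \<open>n\<close>-th power sums of \<open>exp \<theta>\<^sub>i\<close> and of
  \<open>exp (a \<eta>\<^sub>i + b)\<close>.\<close>
lemma pressure_affine_iff:
  assumes \<theta>: "log_ratios d \<Phi> \<theta>" and \<eta>: "log_ratios d \<Psi> \<eta>" and d: "1 \<le> d"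
  shows "(\<forall>s. geom_pressure d \<Phi> s = geom_pressure d \<Psi> (s * a) + s * b) \<longleftrightarrow>
    (\<exists>\<tau>. \<tau> permutes {1..d} \<and> (\<forall>i\<in>{1..d}. \<theta> i = a * \<eta> (\<tau> i) + b))"
proof -
  have pos: "0 < (\<Sum>i\<in>{1..d}. exp (f i))" for f :: "nat \<Rightarrow> real"
    using d by (intro sum_pos) auto
  have "geom_pressure d \<Psi> (s * a) + s * b = ln (\<Sum>i\<in>{1..d}. exp (s * (a * \<eta> i + b)))" for s
  proof -
    have "(\<Sum>i\<in>{1..d}. exp (s * (a * \<eta> i + b))) = (\<Sum>i\<in>{1..d}. exp (s * a * \<eta> i)) * exp (s * b)"
      unfolding sum_distrib_right by (simp add: exp_add[symmetric] algebra_simps)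
    then show ?thesis using pos[of "\<lambda>i. s * a * \<eta> i"] by (simp add: geom_pressure_eq[OF \<eta> d] ln_mult)
  qed
  then have iff: "geom_pressure d \<Phi> s = geom_pressure d \<Psi> (s * a) + s * b \<longleftrightarrow>
      (\<Sum>i\<in>{1..d}. exp (s * \<theta> i)) = (\<Sum>i\<in>{1..d}. exp (s * (a * \<eta> i + b)))" for s
    using pos[of "\<lambda>i. s * \<theta> i"] pos[of "\<lambda>i. s * (a * \<eta> i + b)"]
    by (simp only: geom_pressure_eq[OF \<theta> d] ln_inj_iff)
  show ?thesis
  proof
    assume "\<forall>s. geom_pressure d \<Phi> s = geom_pressure d \<Psi> (s * a) + s * b"
    then have "(\<Sum>i\<in>{1..d}. exp (\<theta> i) ^ n) = (\<Sum>i\<in>{1..d}. exp (a * \<eta> i + b) ^ n)" for n :: nat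
      using iff[of "real n"] by (simp add: exp_of_nat_mult)
    then obtain \<tau> where "\<tau> permutes {1..d}" "\<And>i. i \<in> {1..d} \<Longrightarrow> exp (\<theta> i) = exp (a * \<eta> (\<tau> i) + b)"
      using equal_power_sums_imp_permuted[of "{1..d}" "\<lambda>i. exp (\<theta> i)" "\<lambda>i. exp (a * \<eta> i + b)"] by auto
    then show "\<exists>\<tau>. \<tau> permutes {1..d} \<and> (\<forall>i\<in>{1..d}. \<theta> i = a * \<eta> (\<tau> i) + b)" by auto
  next
    assume "\<exists>\<tau>. \<tau> permutes {1..d} \<and> (\<forall>i\<in>{1..d}. \<theta> i = a * \<eta> (\<tau> i) + b)"
    then obtain \<tau> where \<tau>: "\<tau> permutes {1..d}" "\<forall>i\<in>{1..d}. \<theta> i = a * \<eta> (\<tau> i) + b" by blast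
    have "(\<Sum>i\<in>{1..d}. exp (s * \<theta> i)) = (\<Sum>i\<in>{1..d}. exp (s * (a * \<eta> (\<tau> i) + b)))" for s
      using \<tau>(2) by (intro sum.cong) auto
    also have "(\<Sum>i\<in>{1..d}. exp (s * (a * \<eta> (\<tau> i) + b))) = (\<Sum>i\<in>{1..d}. exp (s * (a * \<eta> i + b)))" for s
      by (rule sum.reindex_bij_betw[OF permutes_imp_bij[OF \<tau>(1)]])
    finally show "\<forall>s. geom_pressure d \<Phi> s = geom_pressure d \<Psi> (s * a) + s * b"
      unfolding iff by blast
  qed
qed

lemma lyapunov_exponent_eq:
  assumes \<theta>: "log_ratios d \<Phi> \<theta>" and d: "1 \<le> d"
  shows "lyapunov_exponent d \<Phi> u
      = - (\<Sum>i\<in>{1..d}. \<theta> i * exp (u * \<theta> i - geom_pressure d \<Phi> u))"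
proof -
  let ?Z = "\<lambda>u. \<Sum>i\<in>{1..d}. exp (u * \<theta> i)"
  have pos: "0 < ?Z u" using d by (intro sum_pos) auto
  have "(?Z has_real_derivative (\<Sum>i\<in>{1..d}. \<theta> i * exp (u * \<theta> i))) (at u)"
    by (auto intro!: derivative_eq_intros sum.cong)
  then have "((\<lambda>u. ln (?Z u)) has_real_derivative (\<Sum>i\<in>{1..d}. \<theta> i * exp (u * \<theta> i)) / ?Z u) (at u)"
    using DERIV_chain2[where f = ln and g = ?Z, OF DERIV_ln_divide[OF pos]] by fastforce
  moreover have "geom_pressure d \<Phi> = (\<lambda>u. ln (?Z u))"
    by (rule HOL.ext) (rule geom_pressure_eq[OF \<theta> d])
  moreover have "(\<Sum>i\<in>{1..d}. \<theta> i * exp (u * \<theta> i - geom_pressure d \<Phi> u))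
      = (\<Sum>i\<in>{1..d}. \<theta> i * exp (u * \<theta> i)) / ?Z u"
    unfolding geom_pressure_eq[OF \<theta> d] exp_diff exp_ln[OF pos] sum_divide_distrib by simp
  ultimately show ?thesis by (simp add: lyapunov_exponent_def DERIV_imp_deriv)
qed

lemma lyapunov_exponent_pos:
  assumes \<theta>: "log_ratios d \<Phi> \<theta>" and d: "1 \<le> d"
  shows "0 < lyapunov_exponent d \<Phi> u"
proof -
  have "0 < (\<Sum>i\<in>{1..d}. - \<theta> i * exp (u * \<theta> i - geom_pressure d \<Phi> u))"
    using \<theta> d by (intro sum_pos) (auto simp: log_ratios_def intro!: mult_neg_pos)
  then show ?thesis by (simp add: lyapunov_exponent_eq[OF \<theta> d] sum_negf)
qed


section \<open>Hausdorff dimension and level sets\<close>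

text \<open>For null sets the bound on the diameters of a cover is automatic: if the sum of the
  \<open>s\<close>-th powers is below \<open>\<delta>\<close> to the power \<open>s\<close>, no member has diameter above
  \<open>\<delta>\<close>.\<close>
lemma hausdorff_measure_eq_0_iff:
  fixes A :: "'a::metric_space set"
  assumes s: "0 < s"
  shows "hausdorff_measure s A = 0 \<longleftrightarrow> (\<forall>\<epsilon>>0. \<exists>V :: nat \<Rightarrow> 'a set. A \<subseteq> (\<Union>i. V i) \<and>
    (\<forall>i. bounded (V i)) \<and> (\<Sum>i. ennreal (diameter (V i) powr s)) < ennreal \<epsilon>)" (is "_ \<longleftrightarrow> ?R")
proof
  assume "hausdorff_measure s A = 0"
  then have "hausdorff_premeasure 1 s A \<le> 0"
    unfolding hausdorff_measure_def by (metis SUP_upper greaterThan_iff zero_less_one)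
  then have "hausdorff_premeasure 1 s A < ennreal \<epsilon>" if "0 < \<epsilon>" for \<epsilon>
    using that by simp
  then have less: "\<exists>V\<in>{V :: nat \<Rightarrow> 'a set. A \<subseteq> (\<Union>i. V i) \<and> (\<forall>i. bounded (V i) \<and> diameter (V i) \<le> 1)}.
      (\<Sum>i. ennreal (diameter (V i) powr s)) < ennreal \<epsilon>" if "0 < \<epsilon>" for \<epsilon>
    using that unfolding hausdorff_premeasure_def INF_less_iff by blast
  show ?R
  proof (intro allI impI)
    fix \<epsilon> :: real assume "0 < \<epsilon>"
    from less[OF this] obtain V where "A \<subseteq> (\<Union>i. V i)" "\<forall>i. bounded (V i) \<and> diameter (V i) \<le> 1"
      "(\<Sum>i. ennreal (diameter (V i) powr s)) < ennreal \<epsilon>"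
      by (elim bexE CollectE conjE)
    then show "\<exists>V. A \<subseteq> (\<Union>i. V i) \<and> (\<forall>i. bounded (V i)) \<and>
        (\<Sum>i. ennreal (diameter (V i) powr s)) < ennreal \<epsilon>"
      by (intro exI[of _ V]) simp
  qed
next
  assume R: ?R
  have "hausdorff_premeasure \<delta> s A \<le> 0" if \<delta>: "0 < \<delta>" for \<delta>
  proof (rule ennreal_le_epsilon)
    fix \<epsilon> :: real assume \<epsilon>: "0 < \<epsilon>"
    have "0 < min \<epsilon> (\<delta> powr s)" using \<delta> \<epsilon> by simp
    then obtain V :: "nat \<Rightarrow> 'a set" where V: "A \<subseteq> (\<Union>i. V i)" "\<And>i. bounded (V i)"
      "(\<Sum>i. ennreal (diameter (V i) powr s)) < ennreal (min \<epsilon> (\<delta> powr s))"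
      using R by blast
    have "diameter (V i) \<le> \<delta>" for i
    proof (rule ccontr)
      assume "\<not> diameter (V i) \<le> \<delta>"
      then have "\<delta> powr s \<le> diameter (V i) powr s"
        using \<delta> s by (intro powr_mono2) auto
      then have "ennreal (\<delta> powr s) \<le> ennreal (diameter (V i) powr s)" by (rule ennreal_leI)
      also have "\<dots> \<le> (\<Sum>i. ennreal (diameter (V i) powr s))"
        using sum_le_suminf[OF summableI, of "{i}" "\<lambda>i. ennreal (diameter (V i) powr s)"]
        by (simp only: finite.intros zero_le sum.insert sum.empty empty_iff add_0_right not_False_eq_True)
      also have "\<dots> < ennreal (min \<epsilon> (\<delta> powr s))" by (rule V(3))
      also have "\<dots> \<le> ennreal (\<delta> powr s)" by (rule ennreal_leI) simp
      finally show False by simp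
    qed
    then have "hausdorff_premeasure \<delta> s A \<le> (\<Sum>i. ennreal (diameter (V i) powr s))"
      unfolding hausdorff_premeasure_def using V by (intro INF_lower) auto
    also have "\<dots> \<le> ennreal (min \<epsilon> (\<delta> powr s))" using V(3) by simp
    also have "\<dots> \<le> ennreal \<epsilon>" by (rule ennreal_leI) simp
    finally show "hausdorff_premeasure \<delta> s A \<le> 0 + ennreal \<epsilon>" by simp
  qed
  then have "hausdorff_measure s A \<le> 0"
    unfolding hausdorff_measure_def by (intro SUP_least) auto
  then show "hausdorff_measure s A = 0" by simp
qed

lemma hausdorff_null_subset:
  assumes s: "0 < s" and "A \<subseteq> B" and "hausdorff_measure s B = 0"
  shows "hausdorff_measure s A = 0"
  using assms(2,3) unfolding hausdorff_measure_eq_0_iff[OF s] by (meson order_trans)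

lemma hausdorff_null_countable_UN:
  fixes A :: "nat \<Rightarrow> 'a::metric_space set"
  assumes s: "0 < s" and null: "\<And>n. hausdorff_measure s (A n) = 0"
  shows "hausdorff_measure s (\<Union>n. A n) = 0"
  unfolding hausdorff_measure_eq_0_iff[OF s]
proof (intro allI impI)
  fix \<epsilon> :: real assume \<epsilon>: "0 < \<epsilon>"
  have "\<exists>V :: nat \<Rightarrow> 'a set. A n \<subseteq> (\<Union>i. V i) \<and> (\<forall>i. bounded (V i)) \<and>
      (\<Sum>i. ennreal (diameter (V i) powr s)) < ennreal (\<epsilon> / 2 * (1 / 2) ^ Suc n)" for n
    using null[of n] \<epsilon> unfolding hausdorff_measure_eq_0_iff[OF s] by simp
  then obtain V :: "nat \<Rightarrow> nat \<Rightarrow> 'a set" where V: "\<And>n. A n \<subseteq> (\<Union>i. V n i)" "\<And>n i. bounded (V n i)"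
    "\<And>n. (\<Sum>i. ennreal (diameter (V n i) powr s)) < ennreal (\<epsilon> / 2 * (1 / 2) ^ Suc n)"
    by metis
  define W where "W k = (case prod_decode k of (n, i) \<Rightarrow> V n i)" for k
  have "(\<Union>n. A n) \<subseteq> (\<Union>k. W k)"
  proof
    fix x assume "x \<in> (\<Union>n. A n)"
    then obtain n i where "x \<in> V n i" using V(1) by blast
    then have "x \<in> W (prod_encode (n, i))" by (simp add: W_def)
    then show "x \<in> (\<Union>k. W k)" by blast
  qed
  moreover have "bounded (W k)" for k
    using V(2) by (simp add: W_def split: prod.split)
  moreover have "(\<Sum>k. ennreal (diameter (W k) powr s)) < ennreal \<epsilon>"
  proof -
    have "(\<Sum>k. ennreal (diameter (W k) powr s))
        = (\<Sum>k. (\<lambda>(n, i). ennreal (diameter (V n i) powr s)) (prod_decode k))"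
      by (simp add: W_def case_prod_beta')
    also have "\<dots> = (\<Sum>n. \<Sum>i. ennreal (diameter (V n i) powr s))"
      by (rule suminf_ennreal_2dimen) simp
    also have "\<dots> \<le> (\<Sum>n. ennreal (\<epsilon> / 2 * (1 / 2) ^ Suc n))"
      using V(3) by (intro suminf_le) (auto intro: less_imp_le)
    also have "\<dots> = ennreal (\<epsilon> / 2 * 1)"
      using \<epsilon> by (intro suminf_ennreal_eq sums_mult power_half_series) auto
    also have "\<dots> < ennreal \<epsilon>" using \<epsilon> by (simp add: ennreal_less_iff)
    finally show ?thesis .
  qed
  ultimately show "\<exists>V. (\<Union>n. A n) \<subseteq> (\<Union>i. V i) \<and> (\<forall>i. bounded (V i)) \<and>
      (\<Sum>i. ennreal (diameter (V i) powr s)) < ennreal \<epsilon>" by blast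
qed

text \<open>The Hoelder map from \<open>p ` Z\<close> to \<open>q ` Z\<close> is given by a common parameter
  \<open>Z\<close>, as the two codings of a set of sequences are; neither coding has to be inverted.\<close>
lemma hausdorff_null_Hoelder:
  fixes p :: "'z \<Rightarrow> 'a::metric_space" and q :: "'z \<Rightarrow> 'b::real_normed_vector"
  assumes s: "0 < s" and null: "hausdorff_measure s (p ` Z) = 0"
    and \<gamma>: "0 < \<gamma>" and B: "0 < B"
    and Hoelder: "\<And>x y. x \<in> Z \<Longrightarrow> y \<in> Z \<Longrightarrow> dist (q x) (q y) \<le> B * dist (p x) (p y) powr \<gamma>"
  shows "hausdorff_measure (s / \<gamma>) (q ` Z) = 0"
proof -
  have s\<gamma>: "0 < s / \<gamma>" using s \<gamma> by simp
  show ?thesis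
    unfolding hausdorff_measure_eq_0_iff[OF s\<gamma>]
  proof (intro allI impI)
    fix \<epsilon> :: real assume \<epsilon>: "0 < \<epsilon>"
    define b where "b = B powr (s / \<gamma>)"
    have b: "0 < b" using B by (simp add: b_def)
    obtain V :: "nat \<Rightarrow> 'a set" where V: "p ` Z \<subseteq> (\<Union>i. V i)" "\<And>i. bounded (V i)"
      "(\<Sum>i. ennreal (diameter (V i) powr s)) < ennreal (\<epsilon> / b)"
      using null \<epsilon> b unfolding hausdorff_measure_eq_0_iff[OF s] by (meson divide_pos_pos)
    define W where "W i = q ` {x \<in> Z. p x \<in> V i}" for i
    have W: "dist u v \<le> B * diameter (V i) powr \<gamma>" if "u \<in> W i" "v \<in> W i" for u v i
    proof -
      obtain x y where xy: "u = q x" "v = q y" "x \<in> Z" "y \<in> Z" "p x \<in> V i" "p y \<in> V i"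
        using \<open>u \<in> W i\<close> \<open>v \<in> W i\<close> by (auto simp: W_def)
      have "dist u v \<le> B * dist (p x) (p y) powr \<gamma>" using Hoelder xy by simp
      also have "\<dots> \<le> B * diameter (V i) powr \<gamma>"
        using B \<gamma> diameter_bounded_bound[OF V(2) xy(5,6)]
        by (intro mult_left_mono powr_mono2) auto
      finally show ?thesis .
    qed
    have "q ` Z \<subseteq> (\<Union>i. W i)"
    proof
      fix y assume "y \<in> q ` Z"
      then obtain x i where "y = q x" "x \<in> Z" "p x \<in> V i" using V(1) by blast
      then have "y \<in> W i" by (simp add: W_def)
      then show "y \<in> (\<Union>i. W i)" by blast
    qed
    moreover have "bounded (W i)" for i
      unfolding bounded_two_points using W by blast
    moreover have "(\<Sum>i. ennreal (diameter (W i) powr (s / \<gamma>))) < ennreal \<epsilon>"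
    proof -
      have "diameter (W i) powr (s / \<gamma>) \<le> b * diameter (V i) powr s" for i
      proof -
        have "0 \<le> diameter (W i)"
          by (rule diameter_ge_0) (use W in \<open>auto simp: bounded_two_points\<close>)
        moreover have "diameter (W i) \<le> B * diameter (V i) powr \<gamma>"
          using W B by (intro diameter_le) (auto simp: dist_norm)
        ultimately have "diameter (W i) powr (s / \<gamma>) \<le> (B * diameter (V i) powr \<gamma>) powr (s / \<gamma>)"
          using s\<gamma> by (intro powr_mono2) auto
        also have "\<dots> = b * diameter (V i) powr s"
          using \<gamma> by (simp add: powr_mult powr_powr b_def)
        finally show ?thesis .
      qed
      then have "(\<Sum>i. ennreal (diameter (W i) powr (s / \<gamma>)))
          \<le> (\<Sum>i. ennreal b * ennreal (diameter (V i) powr s))"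
        using b by (intro suminf_le) (auto simp: ennreal_mult[symmetric] intro!: ennreal_leI)
      also have "\<dots> = ennreal b * (\<Sum>i. ennreal (diameter (V i) powr s))" by simp
      also have "\<dots> < ennreal b * ennreal (\<epsilon> / b)"
        using b V(3) by (intro ennreal_mult_strict_left_mono) auto
      also have "\<dots> = ennreal \<epsilon>" using b \<epsilon> by (simp add: ennreal_mult[symmetric])
      finally show ?thesis .
    qed
    ultimately show "\<exists>V. q ` Z \<subseteq> (\<Union>i. V i) \<and> (\<forall>i. bounded (V i)) \<and>
        (\<Sum>i. ennreal (diameter (V i) powr (s / \<gamma>))) < ennreal \<epsilon>" by blast
  qed
qed

text \<open>Let \<open>\<gamma> = s / t < \<beta> / \<alpha>\<close>.  On the set \<open>Z N\<close> of sequences whose averages from time \<open>N\<close> on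
  are at most \<open>\<alpha> + \<epsilon>\<close> for \<open>\<theta>\<close> and at least \<open>\<beta> - \<epsilon>\<close> for \<open>\<eta>\<close>, two sequences that part after \<open>n\<close> letters satisfy
  \<open>\<bar>\<pi>\<^sub>\<Phi> x - \<pi>\<^sub>\<Phi> y\<bar> \<ge> const exp (- n (\<alpha> + \<epsilon>))\<close> and
  \<open>\<bar>\<pi>\<^sub>\<Psi> x - \<pi>\<^sub>\<Psi> y\<bar> \<le> const exp (- n (\<beta> - \<epsilon>))\<close> when \<open>n \<ge> N\<close>, and smaller \<open>n\<close> only affect the
  constant.  So the change of coding is \<open>\<gamma>\<close>-Hoelder on \<open>Z N\<close>, and the level set is the
  countable union of these sets.\<close>
lemma level_set_null_transfer:
  assumes \<theta>: "log_ratios d \<Phi> \<theta>" and \<eta>: "log_ratios d \<Psi> \<eta>"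
    and L: "L \<subseteq> shift_space d"
    and lim_\<theta>: "\<And>x. x \<in> L \<Longrightarrow> (\<lambda>n. sum_list (map \<theta> (map x [0..<n])) / - real n) \<longlonglongrightarrow> \<alpha>"
    and lim_\<eta>: "\<And>x. x \<in> L \<Longrightarrow> (\<lambda>n. sum_list (map \<eta> (map x [0..<n])) / - real n) \<longlonglongrightarrow> \<beta>"
    and \<alpha>\<beta>: "0 < \<alpha>" "0 < \<beta>" and s: "0 < s" and st: "s * \<alpha> < t * \<beta>"
    and null: "hausdorff_measure s (coding \<Phi> ` L) = 0"
  shows "hausdorff_measure t (coding \<Psi> ` L) = 0"
proof -
  define S where "S \<theta> x n = sum_list (map \<theta> (map x [0..<n]))" for \<theta> :: "nat \<Rightarrow> real" and x n
  have S_mono: "S \<theta> x n \<le> S \<theta> x m"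
    if "log_ratios d \<Phi> \<theta>" "x \<in> shift_space d" "m \<le> n" for \<Phi> \<theta> x m n
  proof (rule lift_Suc_antimono_le[OF _ that(3)])
    fix n
    have "\<theta> (x n) < 0" using that(1,2) by (simp add: log_ratios_def shift_space_def)
    then show "S \<theta> x (Suc n) \<le> S \<theta> x n" by (simp add: S_def)
  qed
  have t: "0 < t" using st s \<alpha>\<beta> by (metis mult_pos_pos order_less_trans zero_less_mult_pos2)
  define \<gamma> where "\<gamma> = s / t"
  have \<gamma>: "0 < \<gamma>" "\<gamma> * \<alpha> < \<beta>" using s t st by (simp_all add: \<gamma>_def field_simps)
  \<comment> \<open>chosen so that \<open>\<beta> - \<epsilon> = \<gamma> (\<alpha> + \<epsilon>)\<close>\<close>
  define \<epsilon> where "\<epsilon> = (\<beta> - \<gamma> * \<alpha>) / (1 + \<gamma>)"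
  have \<epsilon>: "0 < \<epsilon>" using \<gamma> by (simp add: \<epsilon>_def)
  have "\<epsilon> * (1 + \<gamma>) = \<beta> - \<gamma> * \<alpha>" using \<gamma> by (simp add: \<epsilon>_def)
  then have balance: "\<beta> - \<epsilon> = \<gamma> * (\<alpha> + \<epsilon>)" by (simp add: algebra_simps)
  define Z where "Z N = {x \<in> L. \<forall>n\<ge>N. - (n * (\<alpha> + \<epsilon>)) \<le> S \<theta> x n \<and> S \<eta> x n \<le> - (n * (\<beta> - \<epsilon>))}"
    for N :: nat
  have cover: "L = (\<Union>N. Z N)"
  proof (intro equalityI subsetI)
    fix x assume x: "x \<in> L"
    have "\<forall>\<^sub>F n in sequentially. S \<theta> x n / - real n < \<alpha> + \<epsilon>"
      "\<forall>\<^sub>F n in sequentially. \<beta> - \<epsilon> < S \<eta> x n / - real n"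
      using order_tendstoD[OF lim_\<theta>[OF x]] order_tendstoD[OF lim_\<eta>[OF x]] \<epsilon>
      by (auto simp: S_def)
    then have "\<forall>\<^sub>F n in sequentially.
        - (n * (\<alpha> + \<epsilon>)) \<le> S \<theta> x n \<and> S \<eta> x n \<le> - (n * (\<beta> - \<epsilon>))"
      using eventually_gt_at_top[of 0] by eventually_elim (simp add: field_simps)
    then show "x \<in> (\<Union>N. Z N)" using x by (auto simp: Z_def eventually_sequentially)
  qed (auto simp: Z_def)
  obtain A1 where A1: "0 < A1" "\<And>x y n. x \<in> shift_space d \<Longrightarrow> y \<in> shift_space d \<Longrightarrow>
      \<forall>k<n. x k = y k \<Longrightarrow> x n \<noteq> y n \<Longrightarrow> exp (S \<theta> x n) \<le> A1 * \<bar>coding \<Phi> x - coding \<Phi> y\<bar>"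
    using \<theta> unfolding log_ratios_def S_def by blast
  obtain A2 where A2: "0 < A2" "\<And>x y n. x \<in> shift_space d \<Longrightarrow> y \<in> shift_space d \<Longrightarrow>
      \<forall>k<n. x k = y k \<Longrightarrow> \<bar>coding \<Psi> x - coding \<Psi> y\<bar> \<le> A2 * exp (S \<eta> x n)"
    using \<eta> unfolding log_ratios_def S_def by blast
  have "hausdorff_measure t (coding \<Psi> ` Z N) = 0" for N
  proof -
    define b where "b = N * (\<gamma> * (\<alpha> + \<epsilon>))"
    have b: "0 \<le> b" using \<gamma> \<alpha>\<beta> \<epsilon> by (simp add: b_def)
    have "hausdorff_measure (s / \<gamma>) (coding \<Psi> ` Z N) = 0"
    proof (rule hausdorff_null_Hoelder[OF s, where p = "coding \<Phi>" and B = "A2 * exp b * A1 powr \<gamma>"])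
      show "hausdorff_measure s (coding \<Phi> ` Z N) = 0"
        by (rule hausdorff_null_subset[OF s _ null]) (auto simp: Z_def)
      show "0 < A2 * exp b * A1 powr \<gamma>" using A1(1) A2(1) by simp
      fix x y assume xy: "x \<in> Z N" "y \<in> Z N"
      then have \<Sigma>: "x \<in> shift_space d" "y \<in> shift_space d" using L by (auto simp: Z_def)
      show "dist (coding \<Psi> x) (coding \<Psi> y) \<le> A2 * exp b * A1 powr \<gamma> * dist (coding \<Phi> x) (coding \<Phi> y) powr \<gamma>"
      proof (cases "x = y")
        case False
        then have ex: "\<exists>n. x n \<noteq> y n" by (simp add: fun_eq_iff)
        define n where "n = (LEAST n. x n \<noteq> y n)"
        have n: "x n \<noteq> y n" unfolding n_def by (rule LeastI_ex[OF ex])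
        have eq: "\<forall>k<n. x k = y k" unfolding n_def using not_less_Least by blast
        have key: "S \<eta> x n \<le> b + \<gamma> * S \<theta> x n"
        proof (cases "N \<le> n")
          case True
          then have *: "- (n * (\<alpha> + \<epsilon>)) \<le> S \<theta> x n" "S \<eta> x n \<le> - (n * (\<beta> - \<epsilon>))"
            using xy by (auto simp: Z_def)
          have "- (n * (\<beta> - \<epsilon>)) = \<gamma> * - (n * (\<alpha> + \<epsilon>))" unfolding balance by simp
          also have "\<dots> \<le> \<gamma> * S \<theta> x n" using *(1) \<gamma> by (intro mult_left_mono) auto
          finally show ?thesis using *(2) b by linarith
        next
          case False
          have "S \<eta> x n \<le> S \<eta> x 0" by (rule S_mono[OF \<eta> \<Sigma>(1)]) simp
          then have "S \<eta> x n \<le> 0" by (simp add: S_def)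
          moreover have "- (N * (\<alpha> + \<epsilon>)) \<le> S \<theta> x n"
          proof -
            have "- (N * (\<alpha> + \<epsilon>)) \<le> S \<theta> x N" using xy by (auto simp: Z_def)
            also have "\<dots> \<le> S \<theta> x n" using False by (intro S_mono[OF \<theta> \<Sigma>(1)]) simp
            finally show ?thesis .
          qed
          then have "\<gamma> * - (N * (\<alpha> + \<epsilon>)) \<le> \<gamma> * S \<theta> x n" using \<gamma> by (intro mult_left_mono) auto
          then have "- b \<le> \<gamma> * S \<theta> x n" by (simp add: b_def algebra_simps)
          ultimately show ?thesis by linarith
        qed
        have "dist (coding \<Psi> x) (coding \<Psi> y) \<le> A2 * exp (S \<eta> x n)"
          using A2(2)[OF \<Sigma> eq] by (simp add: dist_real_def)
        also have "\<dots> \<le> A2 * exp (b + \<gamma> * S \<theta> x n)" using A2(1) key by simp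
        also have "\<dots> = A2 * exp b * exp (S \<theta> x n) powr \<gamma>"
          by (simp add: exp_add exp_powr_real mult.commute)
        also have "exp (S \<theta> x n) powr \<gamma> \<le> (A1 * dist (coding \<Phi> x) (coding \<Phi> y)) powr \<gamma>"
          using A1(2)[OF \<Sigma> eq n] \<gamma> by (intro powr_mono2) (auto simp: dist_real_def)
        finally show ?thesis using A2(1) by (simp add: powr_mult mult.assoc)
      qed simp
    qed (rule \<gamma>(1))
    moreover have "s / \<gamma> = t" using s t by (simp add: \<gamma>_def)
    ultimately show ?thesis by simp
  qed
  then have "hausdorff_measure t (\<Union>N. coding \<Psi> ` Z N) = 0"
    by (rule hausdorff_null_countable_UN[OF t])
  then show ?thesis unfolding cover image_UN .
qed

lemma Inf_le_of_scaled:
  fixes S T :: "real set"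
  assumes S: "S \<noteq> {}" and pos: "\<And>t. t \<in> T \<Longrightarrow> 0 < t" "\<And>s. s \<in> S \<Longrightarrow> 0 < s"
    and \<alpha>\<beta>: "0 < \<alpha>" "0 < \<beta>"
    and step: "\<And>s t. s \<in> S \<Longrightarrow> s * \<alpha> < t * \<beta> \<Longrightarrow> t \<in> T"
  shows "\<beta> * Inf T \<le> \<alpha> * Inf S"
proof -
  have "Inf T \<le> \<alpha> * Inf S / \<beta>"
  proof (rule dense_ge)
    fix t assume "\<alpha> * Inf S / \<beta> < t"
    then have "Inf S < t * \<beta> / \<alpha>" using \<alpha>\<beta> by (simp add: field_simps)
    then obtain s where "s \<in> S" "s < t * \<beta> / \<alpha>" using cInf_lessD[OF S] by blast
    then have "t \<in> T" using \<alpha>\<beta> by (intro step[of s]) (auto simp: field_simps)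
    then show "Inf T \<le> t"
      using pos(1) by (intro cInf_lower) (auto intro!: bdd_belowI[of _ 0] less_imp_le)
  qed
  then show ?thesis using \<alpha>\<beta> by (simp add: field_simps)
qed

text \<open>The first case is an infinite dimension, which the conversion to real numbers turns into
  \<open>0\<close>.\<close>
lemma hausdorff_dim_real:
  defines "S A \<equiv> {s. 0 < s \<and> hausdorff_measure s A = 0}"
  shows "real_of_ereal (hausdorff_dim A) = (if S A = {} then 0 else Inf (S A))"
proof -
  have "hausdorff_dim A = (INF s\<in>S A. ereal s)"
    unfolding hausdorff_dim_def S_def by (rule arg_cong[where f = Inf]) auto
  moreover have "(INF s\<in>S A. ereal s) = ereal (Inf (S A))" if "S A \<noteq> {}"
    using that by (intro ereal_Inf'[symmetric]) (auto intro!: bdd_belowI[of _ 0] simp: S_def)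
  ultimately show ?thesis by (simp add: top_ereal_def)
qed

text \<open>The transfer of null sets works in both directions, so the critical exponents of the two
  codings of one level set differ by the factor \<open>\<alpha> / \<beta>\<close>.\<close>
lemma level_set_dim_scaling:
  assumes \<theta>: "log_ratios d \<Phi> \<theta>" and \<eta>: "log_ratios d \<Psi> \<eta>"
    and L: "L \<subseteq> shift_space d"
    and lim_\<theta>: "\<And>x. x \<in> L \<Longrightarrow> (\<lambda>n. sum_list (map \<theta> (map x [0..<n])) / - real n) \<longlonglongrightarrow> \<alpha>"
    and lim_\<eta>: "\<And>x. x \<in> L \<Longrightarrow> (\<lambda>n. sum_list (map \<eta> (map x [0..<n])) / - real n) \<longlonglongrightarrow> \<beta>"
    and \<alpha>\<beta>: "0 < \<alpha>" "0 < \<beta>"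
  shows "\<alpha> * real_of_ereal (hausdorff_dim (coding \<Phi> ` L))
    = \<beta> * real_of_ereal (hausdorff_dim (coding \<Psi> ` L))"
proof -
  define S where "S A = {s. 0 < s \<and> hausdorff_measure s A = 0}" for A :: "real set"
  let ?S = "S (coding \<Phi> ` L)" and ?T = "S (coding \<Psi> ` L)"
  have pos: "0 < s" if "s \<in> S A" for s A using that by (simp add: S_def)
  have pos': "0 < t" if "0 < a" "0 < b" "0 < s" "s * a < t * b" for a b s t :: real
    using that by (metis mult_pos_pos order_less_trans zero_less_mult_pos2)
  have ST: "t \<in> ?T" if "s \<in> ?S" "s * \<alpha> < t * \<beta>" for s t
    using level_set_null_transfer[OF \<theta> \<eta> L lim_\<theta> lim_\<eta> \<alpha>\<beta> _ that(2)] that(1)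
      pos'[OF \<alpha>\<beta> _ that(2)] by (simp add: S_def)
  have TS: "s \<in> ?S" if "t \<in> ?T" "t * \<beta> < s * \<alpha>" for s t
    using level_set_null_transfer[OF \<eta> \<theta> L lim_\<eta> lim_\<theta> \<alpha>\<beta>(2,1) _ that(2)] that(1)
      pos'[OF \<alpha>\<beta>(2,1) _ that(2)] by (simp add: S_def)
  show ?thesis
  proof (cases "?S = {}")
    case True
    have "?T = {}"
    proof (rule ccontr)
      assume "?T \<noteq> {}"
      then obtain t where "t \<in> ?T" by blast
      moreover have "t * \<beta> < ((t * \<beta> + 1) / \<alpha>) * \<alpha>" using \<alpha>\<beta> by simp
      ultimately show False using TS True by blast
    qed
    with True show ?thesis by (simp add: hausdorff_dim_real S_def)
  next
    case False
    then obtain s where s: "s \<in> ?S" by blast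
    moreover have "s * \<alpha> < ((s * \<alpha> + 1) / \<beta>) * \<beta>" using \<alpha>\<beta> by simp
    ultimately have T: "?T \<noteq> {}" using ST by blast
    have "\<beta> * Inf ?T \<le> \<alpha> * Inf ?S"
      by (rule Inf_le_of_scaled[OF False pos pos \<alpha>\<beta> ST])
    moreover have "\<alpha> * Inf ?S \<le> \<beta> * Inf ?T"
      by (rule Inf_le_of_scaled[OF T pos pos \<alpha>\<beta>(2,1) TS])
    ultimately show ?thesis
      using False T unfolding hausdorff_dim_real S_def[symmetric] by simp
  qed
qed

lemma level_set_eq:
  assumes \<theta>: "log_ratios d \<Phi> \<theta>" and x: "x \<in> shift_space d"
  shows "(\<lambda>n. birkhoff_sum n (geom_potential \<Phi>) x / - real n) \<longlonglongrightarrow> \<alpha> \<longleftrightarrow>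
    (\<lambda>n. sum_list (map \<theta> (map x [0..<n])) / - real n) \<longlonglongrightarrow> \<alpha>"
proof -
  obtain K where K: "0 \<le> K" "\<And>x n. x \<in> shift_space d \<Longrightarrow>
    \<bar>birkhoff_sum n (geom_potential \<Phi>) x - sum_list (map \<theta> (map x [0..<n]))\<bar> \<le> K"
    using log_ratios_birkhoff[OF \<theta>] by blast
  have "(\<lambda>n. birkhoff_sum n (geom_potential \<Phi>) x / - real n
      - sum_list (map \<theta> (map x [0..<n])) / - real n) \<longlonglongrightarrow> 0"
  proof (rule Lim_null_comparison)
    show "\<forall>\<^sub>F n in sequentially. norm (birkhoff_sum n (geom_potential \<Phi>) x / - real n
      - sum_list (map \<theta> (map x [0..<n])) / - real n) \<le> K / real n"
    proof (rule always_eventually, rule allI)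
      fix n
      have "\<bar>birkhoff_sum n (geom_potential \<Phi>) x - sum_list (map \<theta> (map x [0..<n]))\<bar> / real n \<le> K / real n"
        using K(2)[OF x] by (intro divide_right_mono) auto
      then show "norm (birkhoff_sum n (geom_potential \<Phi>) x / - real n
          - sum_list (map \<theta> (map x [0..<n])) / - real n) \<le> K / real n"
        unfolding diff_divide_distrib[symmetric] by (simp only: real_norm_def abs_divide abs_minus_cancel abs_of_nat)
    qed
    show "(\<lambda>n. K / real n) \<longlonglongrightarrow> 0" by (rule lim_const_over_n)
  qed
  then show ?thesis by (rule Lim_transform_eq)
qed

text \<open>The affine relation between the logarithmic ratios turns averages converging to
  \<open>\<beta>\<close> into averages converging to \<open>\<alpha>\<close>, so both spectra measure codings of the
  same set of sequences.\<close>
lemma lyapunov_spectrum_scaling: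
  assumes \<theta>: "log_ratios d \<Phi> \<theta>" and \<eta>: "log_ratios d \<Psi> \<eta>"
    and rel: "\<And>i. i \<in> {1..d} \<Longrightarrow> \<theta> i = a * \<eta> i + b" and a: "a \<noteq> 0"
    and \<alpha>: "\<alpha> = a * \<beta> - b" and \<alpha>\<beta>: "0 < \<alpha>" "0 < \<beta>"
  shows "\<alpha> * lyapunov_spectrum d \<Phi> \<alpha> = \<beta> * lyapunov_spectrum d \<Psi> \<beta>"
proof -
  define L where "L = {x \<in> shift_space d. (\<lambda>n. sum_list (map \<theta> (map x [0..<n])) / - real n) \<longlonglongrightarrow> \<alpha>}"
  have affine_lim: "(\<lambda>n. a * f n - b) \<longlonglongrightarrow> a * \<beta> - b \<longleftrightarrow> f \<longlonglongrightarrow> \<beta>" for f :: "nat \<Rightarrow> real"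
  proof
    assume "(\<lambda>n. a * f n - b) \<longlonglongrightarrow> a * \<beta> - b"
    then have "(\<lambda>n. (a * f n - b + b) / a) \<longlonglongrightarrow> (a * \<beta> - b + b) / a"
      by (rule tendsto_divide[OF tendsto_add[OF _ tendsto_const] tendsto_const a])
    then show "f \<longlonglongrightarrow> \<beta>"
      unfolding diff_add_cancel nonzero_mult_div_cancel_left[OF a] .
  qed (intro tendsto_intros)
  have same: "(\<lambda>n. sum_list (map \<theta> (map x [0..<n])) / - real n) \<longlonglongrightarrow> \<alpha> \<longleftrightarrow>
      (\<lambda>n. sum_list (map \<eta> (map x [0..<n])) / - real n) \<longlonglongrightarrow> \<beta>" if x: "x \<in> shift_space d" for x
  proof -
    let ?t = "\<lambda>n. sum_list (map \<theta> (map x [0..<n])) / - real n"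
    let ?e = "\<lambda>n. sum_list (map \<eta> (map x [0..<n])) / - real n"
    have "\<forall>\<^sub>F n in sequentially. ?t n = a * ?e n - b"
      using eventually_gt_at_top[of 0]
    proof eventually_elim
      case (elim n)
      have "map \<theta> (map x [0..<n]) = map (\<lambda>i. a * \<eta> i + b) (map x [0..<n])"
        using x rel by (auto simp: shift_space_def)
      then have "sum_list (map \<theta> (map x [0..<n]))
          = sum_list (map (\<lambda>i. a * \<eta> i + b) (map x [0..<n]))"
        by (rule arg_cong)
      also have "\<dots> = a * sum_list (map \<eta> (map x [0..<n])) + n * b"
        by (simp only: sum_list_affine length_map length_upt diff_zero)
      finally have "sum_list (map \<theta> (map x [0..<n]))
          = a * sum_list (map \<eta> (map x [0..<n])) + n * b" .
      then show ?case using elim by (simp only: ) (simp add: field_simps)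
    qed
    then have "?t \<longlonglongrightarrow> \<alpha> \<longleftrightarrow> (\<lambda>n. a * ?e n - b) \<longlonglongrightarrow> a * \<beta> - b"
      unfolding \<alpha> by (rule tendsto_cong)
    also have "\<dots> \<longleftrightarrow> ?e \<longlonglongrightarrow> \<beta>" by (rule affine_lim)
    finally show ?thesis .
  qed
  have "lyapunov_spectrum d \<Phi> \<alpha> = real_of_ereal (hausdorff_dim (coding \<Phi> ` L))"
    unfolding lyapunov_spectrum_def L_def using level_set_eq[OF \<theta>] by (metis (mono_tags, lifting) Collect_cong)
  moreover have "lyapunov_spectrum d \<Psi> \<beta> = real_of_ereal (hausdorff_dim (coding \<Psi> ` L))"
    unfolding lyapunov_spectrum_def L_def using level_set_eq[OF \<eta>] same by (metis (mono_tags, lifting) Collect_cong)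
  moreover have "\<alpha> * real_of_ereal (hausdorff_dim (coding \<Phi> ` L))
      = \<beta> * real_of_ereal (hausdorff_dim (coding \<Psi> ` L))"
  proof (rule level_set_dim_scaling[OF \<theta> \<eta> _ _ _ \<alpha>\<beta>])
    show "L \<subseteq> shift_space d" by (simp add: L_def)
    fix x assume "x \<in> L"
    then have x: "x \<in> shift_space d" "(\<lambda>n. sum_list (map \<theta> (map x [0..<n])) / - real n) \<longlonglongrightarrow> \<alpha>"
      unfolding L_def by (auto simp only: mem_Collect_eq)
    show "(\<lambda>n. sum_list (map \<theta> (map x [0..<n])) / - real n) \<longlonglongrightarrow> \<alpha>" by (rule x(2))
    show "(\<lambda>n. sum_list (map \<eta> (map x [0..<n])) / - real n) \<longlonglongrightarrow> \<beta>"
      by (rule iffD1[OF same[OF x(1)] x(2)])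
  qed
  ultimately show ?thesis by simp
qed

section \<open>The equivalence\<close>

theorem theorem4p5:
  fixes d :: nat and \<Phi> \<Psi> :: ifs and u v :: real
  assumes "d \<ge> 2"
    and "\<Phi> \<in> essentially_affine_systems d" and "\<Psi> \<in> essentially_affine_systems d"
    and "u \<noteq> 0" and "v \<noteq> 0"
  defines "i \<equiv> gibbs_equal_up_to_permutation d \<Phi> u \<Psi> v"
    and "ii \<equiv> potentials_cohomologous_up_to_permutation d \<Phi> (v / u) \<Psi>
           ((geom_pressure d \<Phi> u - geom_pressure d \<Psi> v) / u)"
    and "iii \<equiv> (\<forall>s::real. geom_pressure d \<Phi> s =
           geom_pressure d \<Psi> (s * (v / u))
             + s * ((geom_pressure d \<Phi> u - geom_pressure d \<Psi> v) / u))"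
    and "iv \<equiv> lyapunov_exponent d \<Phi> u * lyapunov_spectrum d \<Phi> (lyapunov_exponent d \<Phi> u) =
           lyapunov_exponent d \<Psi> v * lyapunov_spectrum d \<Psi> (lyapunov_exponent d \<Psi> v)"
  shows "(i \<longleftrightarrow> ii) \<and> (ii \<longleftrightarrow> iii) \<and> (i \<longrightarrow> iv) \<and> (ii \<longrightarrow> iv) \<and> (iii \<longrightarrow> iv)"
proof -
  have d: "1 \<le> d" using assms(1) by simp
  obtain \<theta> where \<theta>: "log_ratios d \<Phi> \<theta>"
    using essentially_affine_log_ratios[OF assms(2,1)] by blast
  obtain \<eta> where \<eta>: "log_ratios d \<Psi> \<eta>"
    using essentially_affine_log_ratios[OF assms(3,1)] by blast
  define a where "a = v / u"
  define b where "b = (geom_pressure d \<Phi> u - geom_pressure d \<Psi> v) / u"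
  \<comment> \<open>the relation between the ratios to which all three statements reduce\<close>
  define R where "R \<tau> \<longleftrightarrow> (\<forall>i\<in>{1..d}. \<theta> i = a * \<eta> (\<tau> i) + b)" for \<tau>
  have a: "a \<noteq> 0" using assms(4,5) by (simp add: a_def)
  have i: "i \<longleftrightarrow> (\<exists>\<tau>. \<tau> permutes {1..d} \<and> R \<tau>)"
  proof -
    have "gibbs_measure d \<Phi> u = gibbs_measure d (permuted \<tau> \<Psi>) v \<longleftrightarrow> R \<tau>"
      if \<tau>: "\<tau> permutes {1..d}" for \<tau>
      unfolding gibbs_measures_equal_iff[OF \<theta> log_ratios_permuted[OF \<tau> \<eta>] d]
        geom_pressure_permuted[OF \<tau> \<eta> d] R_def a_def b_def
      using assms(4) by (intro ball_cong refl) (auto simp: field_simps)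
    then show ?thesis unfolding i_def gibbs_equal_up_to_permutation_def by blast
  qed
  have ii: "ii \<longleftrightarrow> (\<exists>\<tau>. \<tau> permutes {1..d} \<and> R \<tau>)"
  proof -
    have "cohomologous d (geom_potential \<Phi>) (\<lambda>x. a * geom_potential (permuted \<tau> \<Psi>) x + b) \<longleftrightarrow> R \<tau>"
      if \<tau>: "\<tau> permutes {1..d}" for \<tau>
      unfolding cohomologous_iff[OF \<theta> log_ratios_permuted[OF \<tau> \<eta>]] R_def by simp
    then show ?thesis
      unfolding ii_def potentials_cohomologous_up_to_permutation_def a_def[symmetric] b_def[symmetric]
      by blast
  qed
  have iii: "iii \<longleftrightarrow> (\<exists>\<tau>. \<tau> permutes {1..d} \<and> R \<tau>)"
    unfolding iii_def a_def[symmetric] b_def[symmetric] R_def by (rule pressure_affine_iff[OF \<theta> \<eta> d])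
  have iv: iv if "\<tau> permutes {1..d}" "R \<tau>" for \<tau>
  proof -
    let ?\<Psi> = "permuted \<tau> \<Psi>"
    note \<eta>\<tau> = log_ratios_permuted[OF that(1) \<eta>]
    have P: "geom_pressure d ?\<Psi> = geom_pressure d \<Psi>" by (rule geom_pressure_permuted[OF that(1) \<eta> d])
    have rel: "\<theta> i = a * (\<eta> \<circ> \<tau>) i + b" if "i \<in> {1..d}" for i
      using \<open>R \<tau>\<close> that by (simp add: R_def)
    have weight: "v * (\<eta> \<circ> \<tau>) i - geom_pressure d ?\<Psi> v = u * \<theta> i - geom_pressure d \<Phi> u"
      if "i \<in> {1..d}" for i
      using rel[OF that] assms(4) by (simp add: P a_def b_def field_simps)
    let ?p = "\<lambda>i. exp (u * \<theta> i - geom_pressure d \<Phi> u)"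
    have exps: "lyapunov_exponent d \<Psi> v = lyapunov_exponent d ?\<Psi> v"
      by (simp add: lyapunov_exponent_def P)
    have "lyapunov_exponent d ?\<Psi> v = - (\<Sum>i\<in>{1..d}. (\<eta> \<circ> \<tau>) i * ?p i)"
      unfolding lyapunov_exponent_eq[OF \<eta>\<tau> d] using weight by (intro arg_cong[where f = uminus] sum.cong) simp_all
    moreover have "(\<Sum>i\<in>{1..d}. \<theta> i * ?p i) = (\<Sum>i\<in>{1..d}. a * ((\<eta> \<circ> \<tau>) i * ?p i) + b * ?p i)"
      by (rule sum.cong) (simp_all only: rel algebra_simps)
    then have "(\<Sum>i\<in>{1..d}. \<theta> i * ?p i) = a * (\<Sum>i\<in>{1..d}. (\<eta> \<circ> \<tau>) i * ?p i) + b * 1"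
      unfolding sum.distrib sum_distrib_left[symmetric] pressure_normalization[OF \<theta> d] .
    ultimately have "lyapunov_exponent d \<Phi> u = a * lyapunov_exponent d ?\<Psi> v - b"
      unfolding lyapunov_exponent_eq[OF \<theta> d] by simp
    from lyapunov_spectrum_scaling[OF \<theta> \<eta>\<tau> rel a this lyapunov_exponent_pos[OF \<theta> d] lyapunov_exponent_pos[OF \<eta>\<tau> d]]
    show ?thesis
      unfolding iv_def exps lyapunov_spectrum_permuted[OF that(1)] .
  qed
  show ?thesis using i ii iii iv by blast
qed

end
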